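(* Let $R$ be a ring, $I$ an ideal in $R$ and $n\ge 3$. Under the natural maps the following orbit spaces are in bijection: $$\mathrm{MSE}_n(R\oplus I,0\oplus I)\leftrightarrow \mathrm{MSE}_n(\mathbb{Z}\oplus(0\oplus I),0\oplus (0\oplus I))\leftrightarrow \mathrm{MSE}_n(\mathbb{Z}\oplus(0\oplus I))\leftrightarrow \mathrm{MSE}_n(\mathbb{Z}\oplus I)\leftrightarrow \mathrm{MSE}_n(\mathbb{Z}\oplus I,0\oplus I)\leftrightarrow \mathrm{MSE}_n(R,I).$$ Moreover, let $\pi_2:R\oplus I\to R$ be the surjective ring homomorphism $\pi_2(a,i)=a+i$, and assume that there exist group structures given by the $Vv$ rule on $\mathrm{MSE}_n(R,I)$ and on $\mathrm{MSE}_n(R\oplus I,0\oplus I)$. Then the induced map $\pi_2:\mathrm{MSE}_n(R\oplus I,0\oplus I)\to \mathrm{MSE}_n(R,I)$ is a group homomorphism. In particular, $\pi_2$ preserves the nice group structure: if the group structure on $\mathrm{MSE}_n(R\oplus I,0\oplus I)$ is nice, then so is the one on $\mathrm{MSE}_n(R,I)$.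
   Context: All rings are commutative with unity. $\mathrm{Um}_n(R)$ is the set of rows $v\in R^n$ such that $v\cdot w^t=1$ for some $w\in R^n$. For an ideal $I$ of $R$, $\mathrm{Um}_n(R,I)$ is the set of $v\in \mathrm{Um}_n(R)$ with $v\equiv e_1=(1,0,\dots,0)$ modulo $I$. $\mathrm{E}_n(R)$ is the subgroup of $\mathrm{GL}_n(R)$ generated by the matrices $E_{ij}(\lambda)=I_n+\lambda e_{ij}$, $i\neq j$, $\lambda\in R$; $\mathrm{E}_n(R,I)$ is the smallest normal subgroup of $\mathrm{E}_n(R)$ containing all $E_{21}(x)$, $x\in I$. These groups act by right multiplication, and $\mathrm{MSE}_n(R)=\mathrm{Um}_n(R)/\mathrm{E}_n(R)$, $\mathrm{MSE}_n(R,I)=\mathrm{Um}_n(R,I)/\mathrm{E}_n(R,I)$; $[v]$ denotes the class of $v$. Excision rings: $R\oplus I$ has coordinatewise addition and multiplication $(r,i)(s,j)=(rs,rj+si+ij)$, with identity $(1,0)$; $\mathbb{Z}\oplus I$ is defined in the same way, with ring homomorphism $f:\mathbb{Z}\oplus I\to R$, $f(m,i)=m+i$. Applying this to the ideal $0\oplus I$ of the ring $R\oplus I$ gives the ring $\mathbb{Z}\oplus(0\oplus I)$. Natural maps: for an ideal $J$ in a ring $B$ there are maps $F:\mathrm{MSE}_n(\mathbb{Z}\oplus J,0\oplus J)\to\mathrm{MSE}_n(B,J)$ induced by $(m,j)\mapsto m+j$, and $G:\mathrm{MSE}_n(\mathbb{Z}\oplus J,0\oplus J)\to\mathrm{MSE}_n(\mathbb{Z}\oplus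 J)$, $[v]\mapsto[v]$. The first two and the last two correspondences of the chain are these maps for $(B,J)=(R\oplus I,0\oplus I)$ and $(B,J)=(R,I)$ respectively; the middle one is induced by the ring map $\mathbb{Z}\oplus(0\oplus I)\to\mathbb{Z}\oplus I$, $(m,(0,i))\mapsto(m,i)$. The Excision theorem of van der Kallen says $F$ and $G$ are bijections for $n\ge3$. $Vv$ rule (Vaserstein, van der Kallen's rule), $n\ge3$: a group operation $\ast$ on $\mathrm{MSE}_n(R)$ is given by the $Vv$ rule if for all $v=(a,a_2,\dots,a_n)$, $w=(b,a_2,\dots,a_n)$ in $\mathrm{Um}_n(R)$ and $p\in R$ with $ap\equiv1\pmod{(a_2,\dots,a_n)}$ one has $[w]\ast[v]=[(a(b+p)-1,a_2(b+p),a_3,\dots,a_n)]$. A group operation on $\mathrm{MSE}_n(R,I)$ is given by the $Vv$ rule if the operation it induces on $\mathrm{MSE}_n(\mathbb{Z}\oplus I)$ through the bijections $F,G$ satisfies the $Vv$ rule in the previous sense. A group structure on $\mathrm{MSE}_n(R,I)$ given by the $Vv$ rule is called nice if $[(b,a_2,\dots,a_n)]\ast[(a,a_2,\dots,a_n)]=[(ab,a_2,\dots,a_n)]$ whenever $(a,a_2,\dots,a_n),(b,a_2,\dots,a_n)\in\mathrm{Um}_n(R,I)$; equivalently, if the analogous formula holds in the last coordinate, or in the $i$-th coordinate for all $2\le i\le n$.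
   Formalization: The claim that π_2 is a group homomorphism is proved when the group structure on MSE_n(R,I) given by the Vv rule is unique; without uniqueness it fails, e.g. for n=4, R=I=C(S^3×S^3), with quaternion multiplication on one side and its opposite on the other. *)

theory Defs
  imports "HOL-Algebra.Generated_Groups" "HOL-Algebra.Ideal"
begin

section \<open>Rows and matrices over a ring\<close>

text \<open>
  A row of length \<open>n\<close> over \<open>R\<close> is an extensional function on \<open>{1..n}\<close>, an \<open>n \<times> n\<close> matrix an
  extensional function on \<open>{1..n} \<times> {1..n}\<close>, so that equality of rows and of matrices is
  equality of functions.
\<close>

definition rows :: "nat \<Rightarrow> ('a, 'm) ring_scheme \<Rightarrow> (nat \<Rightarrow> 'a) set" where
  "rows n R = {1..n} \<rightarrow>\<^sub>E carrier R"

definition Um :: "nat \<Rightarrow> ('a, 'm) ring_scheme \<Rightarrow> (nat \<Rightarrow> 'a) set" where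
  "Um n R = {v \<in> rows n R. \<exists>w \<in> rows n R. (\<Oplus>\<^bsub>R\<^esub>i\<in>{1..n}. v i \<otimes>\<^bsub>R\<^esub> w i) = \<one>\<^bsub>R\<^esub>}"

definition Um_rel :: "nat \<Rightarrow> ('a, 'm) ring_scheme \<Rightarrow> 'a set \<Rightarrow> (nat \<Rightarrow> 'a) set" where
  "Um_rel n R I = {v \<in> Um n R. \<forall>i\<in>{1..n}. v i \<ominus>\<^bsub>R\<^esub> (if i = 1 then \<one>\<^bsub>R\<^esub> else \<zero>\<^bsub>R\<^esub>) \<in> I}"

definition mat_monoid :: "nat \<Rightarrow> ('a, 'm) ring_scheme \<Rightarrow> (nat \<times> nat \<Rightarrow> 'a) monoid" where
  "mat_monoid n R =
     \<lparr>carrier = {1..n} \<times> {1..n} \<rightarrow>\<^sub>E carrier R,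
      monoid.mult = (\<lambda>A B. \<lambda>(i, j)\<in>{1..n} \<times> {1..n}. \<Oplus>\<^bsub>R\<^esub>k\<in>{1..n}. A (i, k) \<otimes>\<^bsub>R\<^esub> B (k, j)),
      monoid.one = (\<lambda>(i, j)\<in>{1..n} \<times> {1..n}. if i = j then \<one>\<^bsub>R\<^esub> else \<zero>\<^bsub>R\<^esub>)\<rparr>"

definition GL_grp :: "nat \<Rightarrow> ('a, 'm) ring_scheme \<Rightarrow> (nat \<times> nat \<Rightarrow> 'a) monoid" where
  "GL_grp n R = units_of (mat_monoid n R)"

text \<open>The matrix \<open>I\<^sub>n + x e\<^sub>i\<^sub>j\<close>; only used for \<open>i \<noteq> j\<close>.\<close>

definition elem_mat :: "nat \<Rightarrow> ('a, 'm) ring_scheme \<Rightarrow> nat \<Rightarrow> nat \<Rightarrow> 'a \<Rightarrow> (nat \<times> nat \<Rightarrow> 'a)" where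
  "elem_mat n R i j x =
     (\<lambda>(k, l)\<in>{1..n} \<times> {1..n}.
        if k = l then \<one>\<^bsub>R\<^esub> else if k = i \<and> l = j then x else \<zero>\<^bsub>R\<^esub>)"

definition E_abs :: "nat \<Rightarrow> ('a, 'm) ring_scheme \<Rightarrow> (nat \<times> nat \<Rightarrow> 'a) set" where
  "E_abs n R = generate (GL_grp n R)
     {elem_mat n R i j x | i j x. i \<in> {1..n} \<and> j \<in> {1..n} \<and> i \<noteq> j \<and> x \<in> carrier R}"

definition E_rel :: "nat \<Rightarrow> ('a, 'm) ring_scheme \<Rightarrow> 'a set \<Rightarrow> (nat \<times> nat \<Rightarrow> 'a) set" where
  "E_rel n R I =
     \<Inter> {N. N \<lhd> ((GL_grp n R)\<lparr>carrier := E_abs n R\<rparr>) \<and> (\<forall>x\<in>I. elem_mat n R 2 1 x \<in> N)}"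

definition row_mult ::
    "nat \<Rightarrow> ('a, 'm) ring_scheme \<Rightarrow> (nat \<Rightarrow> 'a) \<Rightarrow> (nat \<times> nat \<Rightarrow> 'a) \<Rightarrow> (nat \<Rightarrow> 'a)" where
  "row_mult n R v M = (\<lambda>j\<in>{1..n}. \<Oplus>\<^bsub>R\<^esub>i\<in>{1..n}. v i \<otimes>\<^bsub>R\<^esub> M (i, j))"


section \<open>Orbit spaces\<close>

definition cls :: "nat \<Rightarrow> ('a, 'm) ring_scheme \<Rightarrow> (nat \<Rightarrow> 'a) \<Rightarrow> (nat \<Rightarrow> 'a) set" where
  "cls n R v = row_mult n R v ` E_abs n R"

definition cls_rel ::
    "nat \<Rightarrow> ('a, 'm) ring_scheme \<Rightarrow> 'a set \<Rightarrow> (nat \<Rightarrow> 'a) \<Rightarrow> (nat \<Rightarrow> 'a) set" where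
  "cls_rel n R I v = row_mult n R v ` E_rel n R I"

definition MSE :: "nat \<Rightarrow> ('a, 'm) ring_scheme \<Rightarrow> (nat \<Rightarrow> 'a) set set" where
  "MSE n R = cls n R ` Um n R"

definition MSE_rel :: "nat \<Rightarrow> ('a, 'm) ring_scheme \<Rightarrow> 'a set \<Rightarrow> (nat \<Rightarrow> 'a) set set" where
  "MSE_rel n R I = cls_rel n R I ` Um_rel n R I"


section \<open>Excision rings\<close>

definition excision :: "('a, 'm) ring_scheme \<Rightarrow> 'a set \<Rightarrow> ('a \<times> 'a) ring" where
  "excision R I =
     \<lparr>carrier = carrier R \<times> I,
      monoid.mult = (\<lambda>(r, i) (s, j).
        (r \<otimes>\<^bsub>R\<^esub> s, (r \<otimes>\<^bsub>R\<^esub> j) \<oplus>\<^bsub>R\<^esub> (s \<otimes>\<^bsub>R\<^esub> i) \<oplus>\<^bsub>R\<^esub> (i \<otimes>\<^bsub>R\<^esub> j))),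
      monoid.one = (\<one>\<^bsub>R\<^esub>, \<zero>\<^bsub>R\<^esub>),
      ring.zero = (\<zero>\<^bsub>R\<^esub>, \<zero>\<^bsub>R\<^esub>),
      ring.add = (\<lambda>(r, i) (s, j). (r \<oplus>\<^bsub>R\<^esub> s, i \<oplus>\<^bsub>R\<^esub> j))\<rparr>"

definition int_excision :: "('a, 'm) ring_scheme \<Rightarrow> 'a set \<Rightarrow> (int \<times> 'a) ring" where
  "int_excision R I =
     \<lparr>carrier = UNIV \<times> I,
      monoid.mult = (\<lambda>(r, i) (s, j).
        (r * s, add_pow R r j \<oplus>\<^bsub>R\<^esub> add_pow R s i \<oplus>\<^bsub>R\<^esub> (i \<otimes>\<^bsub>R\<^esub> j))),
      monoid.one = (1, \<zero>\<^bsub>R\<^esub>),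
      ring.zero = (0, \<zero>\<^bsub>R\<^esub>),
      ring.add = (\<lambda>(r, i) (s, j). (r + s, i \<oplus>\<^bsub>R\<^esub> j))\<rparr>"

text \<open>The ideals \<open>0 \<oplus> I\<close> of \<open>R \<oplus> I\<close> and of \<open>\<int> \<oplus> I\<close>.\<close>

definition exc_ideal :: "('a, 'm) ring_scheme \<Rightarrow> 'a set \<Rightarrow> ('a \<times> 'a) set" where
  "exc_ideal R I = {\<zero>\<^bsub>R\<^esub>} \<times> I"

definition int_exc_ideal :: "'a set \<Rightarrow> (int \<times> 'a) set" where
  "int_exc_ideal I = {0} \<times> I"

definition int_eval :: "('a, 'm) ring_scheme \<Rightarrow> int \<times> 'a \<Rightarrow> 'a" where
  "int_eval R = (\<lambda>(m, i). add_pow R m \<one>\<^bsub>R\<^esub> \<oplus>\<^bsub>R\<^esub> i)"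

definition pi2 :: "('a, 'm) ring_scheme \<Rightarrow> 'a \<times> 'a \<Rightarrow> 'a" where
  "pi2 R = (\<lambda>(a, i). a \<oplus>\<^bsub>R\<^esub> i)"


section \<open>Natural maps between orbit spaces\<close>

definition map_row :: "nat \<Rightarrow> ('a \<Rightarrow> 'b) \<Rightarrow> (nat \<Rightarrow> 'a) \<Rightarrow> (nat \<Rightarrow> 'b)" where
  "map_row n f v = (\<lambda>i\<in>{1..n}. f (v i))"

text \<open>
  The map of orbit spaces induced by a map \<open>f\<close> of rows, where \<open>q\<close> sends a row of the target to
  its class.  It is meaningful when all rows of an orbit are sent to one and the same class;
  \<open>induces\<close> says that \<open>h\<close> is the map of orbit spaces induced by \<open>f\<close> on the classes (under \<open>k\<close>)
  of the rows in \<open>U\<close>.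
\<close>

definition induced_map :: "('w \<Rightarrow> 'w set) \<Rightarrow> ('v \<Rightarrow> 'w) \<Rightarrow> 'v set \<Rightarrow> 'w set" where
  "induced_map q f C = the_elem ((\<lambda>v. q (f v)) ` C)"

definition induces ::
    "('v \<Rightarrow> 'w) \<Rightarrow> ('v set \<Rightarrow> 'w set) \<Rightarrow> 'v set \<Rightarrow> ('v \<Rightarrow> 'v set) \<Rightarrow> ('w \<Rightarrow> 'w set) \<Rightarrow> bool" where
  "induces f h U k q \<longleftrightarrow> (\<forall>v\<in>U. h (k v) = q (f v))"

definition F_map ::
    "nat \<Rightarrow> ('a, 'm) ring_scheme \<Rightarrow> 'a set \<Rightarrow> (nat \<Rightarrow> int \<times> 'a) set \<Rightarrow> (nat \<Rightarrow> 'a) set" where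
  "F_map n B J = induced_map (cls_rel n B J) (map_row n (int_eval B))"

definition G_map ::
    "nat \<Rightarrow> ('a, 'm) ring_scheme \<Rightarrow> 'a set
      \<Rightarrow> (nat \<Rightarrow> int \<times> 'a) set \<Rightarrow> (nat \<Rightarrow> int \<times> 'a) set" where
  "G_map n B J = induced_map (cls n (int_excision B J)) (\<lambda>v. v)"

definition drop_zero :: "int \<times> ('a \<times> 'a) \<Rightarrow> int \<times> 'a" where
  "drop_zero = (\<lambda>(m, (z, i)). (m, i))"

definition middle_map ::
    "nat \<Rightarrow> ('a, 'm) ring_scheme \<Rightarrow> 'a set
      \<Rightarrow> (nat \<Rightarrow> int \<times> ('a \<times> 'a)) set \<Rightarrow> (nat \<Rightarrow> int \<times> 'a) set" where
  "middle_map n R I = induced_map (cls n (int_excision R I)) (map_row n drop_zero)"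

definition pi2_map ::
    "nat \<Rightarrow> ('a, 'm) ring_scheme \<Rightarrow> 'a set \<Rightarrow> (nat \<Rightarrow> 'a \<times> 'a) set \<Rightarrow> (nat \<Rightarrow> 'a) set" where
  "pi2_map n R I = induced_map (cls_rel n R I) (map_row n (pi2 R))"


section \<open>The Vaserstein--van der Kallen rule\<close>

text \<open>The congruence is \<open>a p \<equiv> 1 (mod (a\<^sub>2, \<dots>, a\<^sub>n))\<close>, with \<open>v = (a, a\<^sub>2, \<dots>, a\<^sub>n)\<close> and \<open>w = (b, a\<^sub>2, \<dots>, a\<^sub>n)\<close>.\<close>

definition Vv_rule ::
    "nat \<Rightarrow> ('a, 'm) ring_scheme
      \<Rightarrow> ((nat \<Rightarrow> 'a) set \<Rightarrow> (nat \<Rightarrow> 'a) set \<Rightarrow> (nat \<Rightarrow> 'a) set) \<Rightarrow> bool" where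
  "Vv_rule n R star \<longleftrightarrow>
     (\<forall>v \<in> Um n R. \<forall>w \<in> Um n R. \<forall>p \<in> carrier R.
        (\<forall>i\<in>{2..n}. w i = v i) \<longrightarrow>
        (v 1 \<otimes>\<^bsub>R\<^esub> p) \<ominus>\<^bsub>R\<^esub> \<one>\<^bsub>R\<^esub> \<in> Idl\<^bsub>R\<^esub> (v ` {2..n}) \<longrightarrow>
        star (cls n R w) (cls n R v) =
          cls n R (\<lambda>i\<in>{1..n}.
            if i = 1 then (v 1 \<otimes>\<^bsub>R\<^esub> (w 1 \<oplus>\<^bsub>R\<^esub> p)) \<ominus>\<^bsub>R\<^esub> \<one>\<^bsub>R\<^esub>
            else if i = 2 then v 2 \<otimes>\<^bsub>R\<^esub> (w 1 \<oplus>\<^bsub>R\<^esub> p)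
            else v i))"

text \<open>The operation on \<open>MSE\<^sub>n(\<int> \<oplus> I)\<close> obtained from one on \<open>MSE\<^sub>n(R, I)\<close> along \<open>F \<circ> G\<^sup>-\<^sup>1\<close>.\<close>

definition transfer_op ::
    "nat \<Rightarrow> ('a, 'm) ring_scheme \<Rightarrow> 'a set
      \<Rightarrow> ((nat \<Rightarrow> 'a) set \<Rightarrow> (nat \<Rightarrow> 'a) set \<Rightarrow> (nat \<Rightarrow> 'a) set)
      \<Rightarrow> ((nat \<Rightarrow> int \<times> 'a) set \<Rightarrow> (nat \<Rightarrow> int \<times> 'a) set \<Rightarrow> (nat \<Rightarrow> int \<times> 'a) set)" where
  "transfer_op n R I star C D =
     (let M = MSE_rel n (int_excision R I) (int_exc_ideal I);
          h = (\<lambda>Z. F_map n R I (inv_into M (G_map n R I) Z))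
      in G_map n R I (inv_into M (F_map n R I) (star (h C) (h D))))"

definition Vv_group ::
    "nat \<Rightarrow> ('a, 'm) ring_scheme \<Rightarrow> 'a set \<Rightarrow> (nat \<Rightarrow> 'a) set monoid \<Rightarrow> bool" where
  "Vv_group n R I K \<longleftrightarrow>
     group K \<and> carrier K = MSE_rel n R I \<and>
     Vv_rule n (int_excision R I) (transfer_op n R I (mult K))"

text \<open>
  The rule prescribes the product of two classes only if they have representatives that agree
  outside the first coordinate, so in general it does not pin down a group structure.  Take
  \<open>n = 4\<close>, \<open>I = R\<close> the ring of continuous real functions on \<open>X = S\<^sup>3 \<times> S\<^sup>3\<close>.  Then
  \<open>MSE\<^sub>4(R, R) = [X, S\<^sup>3]\<close>, and pointwise quaternion multiplication and its opposite both obey the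
  rule but differ, as \<open>[X, S\<^sup>3]\<close> is not abelian.
\<close>

definition Vv_determined :: "nat \<Rightarrow> ('a, 'm) ring_scheme \<Rightarrow> 'a set \<Rightarrow> bool" where
  "Vv_determined n R I \<longleftrightarrow>
     (\<forall>K K'. Vv_group n R I K \<longrightarrow> Vv_group n R I K' \<longrightarrow>
        (\<forall>C \<in> MSE_rel n R I. \<forall>D \<in> MSE_rel n R I. C \<otimes>\<^bsub>K\<^esub> D = C \<otimes>\<^bsub>K'\<^esub> D))"

definition nice ::
    "nat \<Rightarrow> ('a, 'm) ring_scheme \<Rightarrow> 'a set \<Rightarrow> (nat \<Rightarrow> 'a) set monoid \<Rightarrow> bool" where
  "nice n R I K \<longleftrightarrow>
     (\<forall>v \<in> Um_rel n R I. \<forall>w \<in> Um_rel n R I.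
        (\<forall>i\<in>{2..n}. w i = v i) \<longrightarrow>
        cls_rel n R I w \<otimes>\<^bsub>K\<^esub> cls_rel n R I v = cls_rel n R I (v(1 := v 1 \<otimes>\<^bsub>R\<^esub> w 1)))"

end

theory Submission
  imports Defs "HOL-Algebra.IntRing" "Jordan_Normal_Form.Determinant"
begin

text \<open>
  Everything rests on one description of relative orbits.  Call two rows congruent to \<open>e\<^sub>1\<close> modulo \<open>I\<close>
  equivalent if one is obtained from the other by adding \<open>c v\<^sub>i\<close> to \<open>v\<^sub>j\<close> repeatedly, where \<open>i \<ge> 2\<close> or
  \<open>c \<in> I\<close>.  For \<open>n \<ge> 3\<close> the classes of this relation are exactly the \<open>E\<^sub>n(R, I)\<close>-orbits
  (\<open>cls_rel_eq_iff_row_equiv\<close>).  The group \<open>E\<^sub>n(R, I)\<close> is generated by the conjugates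
  \<open>g E\<^sub>2\<^sub>1(x) g\<^sup>-\<^sup>1\<close>, and such a conjugate is a transvection \<open>v \<mapsto> v + x (v c) r\<close>, where \<open>c\<close> is a unimodular
  column and \<open>r\<close> a row with \<open>r c = 0\<close>.  By an observation of Suslin, \<open>r\<close> is a combination of the rows
  \<open>c\<^sub>j e\<^sub>i - c\<^sub>i e\<^sub>j\<close>, and the transvections with these rows are products and commutators of
  permitted additions.  Conversely, every permitted addition stays inside the \<open>E\<^sub>n(R, I)\<close>-orbit because
  \<open>E\<^sub>n(R, I)\<close> is normal in \<open>E\<^sub>n(R)\<close>.

  The excision theorem follows.  On rows congruent to \<open>e\<^sub>1\<close>, the evaluation \<open>\<int> \<oplus> I \<rightarrow> R\<close> is a bijection.  The
  equivalence is already generated by the additions with \<open>c \<in> I\<close> and those of \<open>\<plusminus>v\<^sub>k\<close> to \<open>v\<^sub>1\<close>, whose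
  coefficients come from \<open>\<int> \<oplus> I\<close>; so the equivalence lifts from \<open>R\<close> to \<open>\<int> \<oplus> I\<close> and \<open>F\<close> is bijective
  (\<open>F_bij\<close>).  For \<open>G\<close> one uses the splitting \<open>\<int> \<rightarrow> \<int> \<oplus> I \<rightarrow> \<int>\<close>: up to \<open>E\<^sub>n(\<int> \<oplus> I, 0 \<oplus> I)\<close> the group
  \<open>E\<^sub>n(\<int> \<oplus> I)\<close> acts through \<open>E\<^sub>n(\<int>)\<close>.  The Euclidean algorithm moves every unimodular row to one congruent
  to \<open>e\<^sub>1\<close>, and the elements of \<open>E\<^sub>n(\<int>)\<close> that fix \<open>e\<^sub>1\<close> are products of matrices \<open>E\<^sub>i\<^sub>j(m)\<close> with
  \<open>i \<ge> 2\<close>, that is, of permitted additions (\<open>G_bij\<close>).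

  Finally \<open>\<pi>\<^sub>2\<close> composed with the evaluation on \<open>\<int> \<oplus> (0 \<oplus> I)\<close> is the isomorphism
  \<open>\<int> \<oplus> (0 \<oplus> I) \<rightarrow> \<int> \<oplus> I\<close> followed by the evaluation to \<open>R\<close>.  So, under \<open>F\<close> and \<open>G\<close>, the map induced
  by \<open>\<pi>\<^sub>2\<close> becomes the one induced by a ring isomorphism.  The \<open>Vv\<close> rule is written in ring operations,
  so ring homomorphisms preserve the products it prescribes, and transporting a group structure along
  the bijection \<open>\<pi>\<^sub>2\<close> gives another structure with the rule; if there is only one, \<open>\<pi>\<^sub>2\<close> is a
  homomorphism.  Niceness is tested on pairs of rows that agree outside the first coordinate, and such
  pairs lift along \<open>\<pi>\<^sub>2\<close>.
\<close>

hide_const (open) Matrix.rows Matrix.row Ring_Hom.ring_hom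
hide_fact (open) Matrix.rows_def Matrix.row_def

section \<open>Rows, matrices and row operations\<close>

lemma (in abelian_monoid) finsum_swap:
  assumes "finite A" "finite B" "\<And>i j. i \<in> A \<Longrightarrow> j \<in> B \<Longrightarrow> f i j \<in> carrier G"
  shows "(\<Oplus>i\<in>A. \<Oplus>j\<in>B. f i j) = (\<Oplus>j\<in>B. \<Oplus>i\<in>A. f i j)"
  using assms(1,3)
proof (induction A rule: finite_induct)
  case empty
  then show ?case by (simp add: finsum_zero)
next
  case (insert x F)
  have "(\<Oplus>i\<in>insert x F. \<Oplus>j\<in>B. f i j) = (\<Oplus>j\<in>B. f x j) \<oplus> (\<Oplus>j\<in>B. \<Oplus>i\<in>F. f i j)"
    using insert by (subst finsum_insert) (auto intro!: finsum_closed)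
  also have "\<dots> = (\<Oplus>j\<in>B. f x j \<oplus> (\<Oplus>i\<in>F. f i j))"
    using insert by (subst finsum_addf) (auto intro!: finsum_closed)
  also have "\<dots> = (\<Oplus>j\<in>B. \<Oplus>i\<in>insert x F. f i j)"
    using insert by (intro finsum_cong') (auto intro!: finsum_closed simp: finsum_insert)
  finally show ?case .
qed

lemma rows_carrier: "v \<in> rows n R \<Longrightarrow> i \<in> {1..n} \<Longrightarrow> v i \<in> carrier R"
  by (auto simp: rows_def)

lemma rows_eqI:
  assumes "v \<in> rows n R" "w \<in> rows n S" "\<And>i. i \<in> {1..n} \<Longrightarrow> v i = w i"
  shows "v = w"
  using assms unfolding rows_def by (auto intro: PiE_ext)

lemma rows_update:
  "v \<in> rows n R \<Longrightarrow> j \<in> {1..n} \<Longrightarrow> x \<in> carrier R \<Longrightarrow> v(j := x) \<in> rows n R"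
  unfolding rows_def by (auto simp: PiE_iff extensional_def)

locale matrix_ring = cring R for R :: "('a, 'm) ring_scheme" (structure) + fixes n :: nat
begin

abbreviation M where "M \<equiv> mat_monoid n R"
abbreviation GL where "GL \<equiv> GL_grp n R"
abbreviation E where "E \<equiv> E_abs n R"
abbreviation act (infixl \<open>\<star>\<close> 70) where "v \<star> A \<equiv> row_mult n R v A"
abbreviation el where "el \<equiv> elem_mat n R"

definition dot :: "(nat \<Rightarrow> 'a) \<Rightarrow> (nat \<Rightarrow> 'a) \<Rightarrow> 'a" where
  "dot v w = (\<Oplus>i\<in>{1..n}. v i \<otimes> w i)"

lemma dot_closed:
  "v \<in> {1..n} \<rightarrow> carrier R \<Longrightarrow> w \<in> {1..n} \<rightarrow> carrier R \<Longrightarrow> dot v w \<in> carrier R"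
  unfolding dot_def by (auto intro!: finsum_closed)

lemma dot_cong: "(\<And>i. i \<in> {1..n} \<Longrightarrow> v i = v' i) \<Longrightarrow> (\<And>i. i \<in> {1..n} \<Longrightarrow> w i = w' i) \<Longrightarrow>
    v' \<in> {1..n} \<rightarrow> carrier R \<Longrightarrow> w' \<in> {1..n} \<rightarrow> carrier R \<Longrightarrow> dot v w = dot v' w'"
  unfolding dot_def by (intro finsum_cong') auto

lemma dot_add:
  assumes "v \<in> {1..n} \<rightarrow> carrier R" "u \<in> {1..n} \<rightarrow> carrier R" "w \<in> {1..n} \<rightarrow> carrier R"
  shows "dot (\<lambda>i. v i \<oplus> u i) w = dot v w \<oplus> dot u w"
proof -
  have "dot (\<lambda>i. v i \<oplus> u i) w = (\<Oplus>i\<in>{1..n}. v i \<otimes> w i \<oplus> u i \<otimes> w i)"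
    unfolding dot_def using assms by (intro finsum_cong') (auto simp: Pi_def l_distr)
  also have "\<dots> = dot v w \<oplus> dot u w"
    unfolding dot_def using assms by (intro finsum_addf) (auto simp: Pi_def)
  finally show ?thesis .
qed

lemma dot_smult:
  assumes "v \<in> {1..n} \<rightarrow> carrier R" "w \<in> {1..n} \<rightarrow> carrier R" "a \<in> carrier R"
  shows "dot (\<lambda>i. a \<otimes> v i) w = a \<otimes> dot v w"
proof -
  have "dot (\<lambda>i. a \<otimes> v i) w = (\<Oplus>i\<in>{1..n}. a \<otimes> (v i \<otimes> w i))"
    unfolding dot_def using assms by (intro finsum_cong') (auto simp: Pi_def m_assoc)
  also have "\<dots> = a \<otimes> dot v w"
    unfolding dot_def using assms by (subst finsum_rdistr) (auto simp: Pi_def)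
  finally show ?thesis .
qed

lemma dot_unit:
  assumes "i \<in> {1..n}" "w \<in> {1..n} \<rightarrow> carrier R" "x \<in> carrier R"
  shows "dot (\<lambda>k. if k = i then x else \<zero>) w = x \<otimes> w i"
proof -
  have "dot (\<lambda>k. if k = i then x else \<zero>) w = (\<Oplus>k\<in>{1..n}. if i = k then x \<otimes> w k else \<zero>)"
    unfolding dot_def using assms by (intro finsum_cong') (auto simp: Pi_def)
  also have "\<dots> = x \<otimes> w i"
    using assms by (intro finsum_singleton) (auto simp: Pi_def)
  finally show ?thesis .
qed

lemma dot_comm:
  assumes "v \<in> {1..n} \<rightarrow> carrier R" "w \<in> {1..n} \<rightarrow> carrier R"
  shows "dot v w = dot w v"
  unfolding dot_def using assms by (intro finsum_cong') (auto simp: Pi_def m_comm)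

lemma carrier_M: "A \<in> carrier M \<longleftrightarrow> A \<in> {1..n} \<times> {1..n} \<rightarrow>\<^sub>E carrier R"
  by (simp add: mat_monoid_def)

lemma M_entry: "A \<in> carrier M \<Longrightarrow> i \<in> {1..n} \<Longrightarrow> j \<in> {1..n} \<Longrightarrow> A (i, j) \<in> carrier R"
  by (auto simp: carrier_M)

lemma M_eqI:
  assumes "A \<in> carrier M" "B \<in> carrier M"
    "\<And>i j. i \<in> {1..n} \<Longrightarrow> j \<in> {1..n} \<Longrightarrow> A (i, j) = B (i, j)"
  shows "A = B"
  using assms unfolding carrier_M by (intro PiE_ext) auto

lemma M_mult_entry:
  "i \<in> {1..n} \<Longrightarrow> j \<in> {1..n} \<Longrightarrow>
    (A \<otimes>\<^bsub>M\<^esub> B) (i, j) = dot (\<lambda>k. A (i, k)) (\<lambda>k. B (k, j))"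
  by (simp add: mat_monoid_def dot_def)

lemma act_entry: "j \<in> {1..n} \<Longrightarrow> (v \<star> A) j = dot v (\<lambda>k. A (k, j))"
  by (simp add: row_mult_def dot_def)

lemma M_mult_closed: "A \<in> carrier M \<Longrightarrow> B \<in> carrier M \<Longrightarrow> A \<otimes>\<^bsub>M\<^esub> B \<in> carrier M"
  by (auto simp: mat_monoid_def PiE_iff intro!: finsum_closed)

lemma M_one_closed: "\<one>\<^bsub>M\<^esub> \<in> carrier M"
  by (auto simp: mat_monoid_def)

lemma act_closed: "v \<in> rows n R \<Longrightarrow> A \<in> carrier M \<Longrightarrow> v \<star> A \<in> rows n R"
  unfolding rows_def row_mult_def by (auto simp: carrier_M intro!: finsum_closed)

lemma dot_assoc:
  assumes "v \<in> {1..n} \<rightarrow> carrier R" "A \<in> carrier M" "w \<in> {1..n} \<rightarrow> carrier R"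
  shows "dot (\<lambda>j. dot v (\<lambda>k. A (k, j))) w = dot v (\<lambda>k. dot (\<lambda>j. A (k, j)) w)"
proof -
  have A: "A (k, j) \<in> carrier R" if "k \<in> {1..n}" "j \<in> {1..n}" for k j
    using assms that by (auto simp: M_entry)
  have "dot (\<lambda>j. dot v (\<lambda>k. A (k, j))) w
      = (\<Oplus>j\<in>{1..n}. \<Oplus>k\<in>{1..n}. (v k \<otimes> A (k, j)) \<otimes> w j)"
    unfolding dot_def using assms A
    by (intro finsum_cong') (auto simp: Pi_def finsum_ldistr intro!: finsum_closed)
  also have "\<dots> = (\<Oplus>k\<in>{1..n}. \<Oplus>j\<in>{1..n}. (v k \<otimes> A (k, j)) \<otimes> w j)"
    using assms A by (intro finsum_swap) (auto simp: Pi_def)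
  also have "\<dots> = (\<Oplus>k\<in>{1..n}. \<Oplus>j\<in>{1..n}. v k \<otimes> (A (k, j) \<otimes> w j))"
    using assms A
    by (intro finsum_cong' finsum_closed refl) (auto simp: Pi_def m_assoc intro!: finsum_closed)
  also have "\<dots> = dot v (\<lambda>k. dot (\<lambda>j. A (k, j)) w)"
    unfolding dot_def using assms A
    by (intro finsum_cong') (auto simp: Pi_def finsum_rdistr intro!: finsum_closed)
  finally show ?thesis .
qed

lemma act_assoc:
  assumes "v \<in> rows n R" "A \<in> carrier M" "B \<in> carrier M"
  shows "v \<star> A \<star> B = v \<star> (A \<otimes>\<^bsub>M\<^esub> B)"
proof (rule rows_eqI)
  fix j assume j: "j \<in> {1..n}"
  have v: "v \<in> {1..n} \<rightarrow> carrier R" using assms by (auto simp: rows_carrier)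
  have "(v \<star> A \<star> B) j = dot (\<lambda>j. dot v (\<lambda>k. A (k, j))) (\<lambda>k. B (k, j))"
    using assms j v by (simp add: act_entry) (intro dot_cong, auto simp: act_entry M_entry intro!: dot_closed)
  also have "\<dots> = dot v (\<lambda>k. dot (\<lambda>j. A (k, j)) (\<lambda>k. B (k, j)))"
    using assms j v by (intro dot_assoc) (auto simp: M_entry)
  also have "\<dots> = (v \<star> (A \<otimes>\<^bsub>M\<^esub> B)) j"
    using assms j v
    by (simp add: act_entry)
      (intro dot_cong, auto simp: M_mult_entry M_entry intro!: dot_closed)
  finally show "(v \<star> A \<star> B) j = (v \<star> (A \<otimes>\<^bsub>M\<^esub> B)) j" .
qed (use assms in \<open>auto intro!: act_closed M_mult_closed\<close>)

definition row :: "(nat \<times> nat \<Rightarrow> 'a) \<Rightarrow> nat \<Rightarrow> nat \<Rightarrow> 'a" where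
  "row A i = (\<lambda>j\<in>{1..n}. A (i, j))"

lemma row_closed: "A \<in> carrier M \<Longrightarrow> i \<in> {1..n} \<Longrightarrow> row A i \<in> rows n R"
  by (auto simp: row_def rows_def M_entry)

lemma row_mult_row:
  assumes "A \<in> carrier M" "B \<in> carrier M" "i \<in> {1..n}"
  shows "row (A \<otimes>\<^bsub>M\<^esub> B) i = row A i \<star> B"
proof (rule rows_eqI)
  fix j assume j: "j \<in> {1..n}"
  show "row (A \<otimes>\<^bsub>M\<^esub> B) i j = (row A i \<star> B) j"
    using assms j by (simp add: row_def M_mult_entry act_entry) (intro dot_cong, auto simp: M_entry)
qed (use assms in \<open>auto intro!: row_closed act_closed M_mult_closed\<close>)

lemma M_eqI_rows:
  assumes "A \<in> carrier M" "B \<in> carrier M" "\<And>i. i \<in> {1..n} \<Longrightarrow> row A i = row B i"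
  shows "A = B"
proof (rule M_eqI)
  fix i j assume "i \<in> {1..n}" "j \<in> {1..n}"
  then show "A (i, j) = B (i, j)" using fun_cong[OF assms(3), of i j] by (simp add: row_def)
qed (use assms in auto)

definition unit_row :: "nat \<Rightarrow> nat \<Rightarrow> 'a" where
  "unit_row i = (\<lambda>j\<in>{1..n}. if j = i then \<one> else \<zero>)"

lemma unit_row_closed: "unit_row i \<in> rows n R"
  by (auto simp: unit_row_def rows_def)

lemma row_one: "i \<in> {1..n} \<Longrightarrow> row \<one>\<^bsub>M\<^esub> i = unit_row i"
  by (auto simp: row_def unit_row_def mat_monoid_def)

lemma unit_row_act:
  assumes "A \<in> carrier M" "i \<in> {1..n}"
  shows "unit_row i \<star> A = row A i"
proof (rule rows_eqI)
  fix j assume j: "j \<in> {1..n}"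
  have "dot (unit_row i) (\<lambda>k. A (k, j)) = dot (\<lambda>k. if k = i then \<one> else \<zero>) (\<lambda>k. A (k, j))"
    using assms j by (intro dot_cong) (auto simp: unit_row_def M_entry)
  also have "\<dots> = A (i, j)" using assms j by (subst dot_unit) (auto simp: M_entry)
  finally show "(unit_row i \<star> A) j = row A i j" using j by (simp add: act_entry row_def)
qed (use assms in \<open>auto intro!: row_closed act_closed unit_row_closed\<close>)

lemma act_one:
  assumes "v \<in> rows n R"
  shows "v \<star> \<one>\<^bsub>M\<^esub> = v"
proof (rule rows_eqI)
  fix j assume j: "j \<in> {1..n}"
  have v: "v \<in> {1..n} \<rightarrow> carrier R" using assms by (auto simp: rows_carrier)
  have "(v \<star> \<one>\<^bsub>M\<^esub>) j = dot v (\<lambda>k. if k = j then \<one> else \<zero>)"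
    using j v by (simp add: act_entry) (intro dot_cong, auto simp: mat_monoid_def)
  also have "\<dots> = dot (\<lambda>k. if k = j then \<one> else \<zero>) v" using v by (intro dot_comm) auto
  also have "\<dots> = v j" using j v by (subst dot_unit) (auto simp: Pi_def)
  finally show "(v \<star> \<one>\<^bsub>M\<^esub>) j = v j" .
qed (use assms in \<open>auto intro!: act_closed M_one_closed\<close>)

lemma M_eqI_act:
  assumes "A \<in> carrier M" "B \<in> carrier M" "\<And>v. v \<in> rows n R \<Longrightarrow> v \<star> A = v \<star> B"
  shows "A = B"
proof (rule M_eqI_rows)
  fix i assume "i \<in> {1..n}"
  then show "row A i = row B i"
    using assms(3)[OF unit_row_closed[of i]] assms(1,2) by (simp add: unit_row_act)
qed (use assms in auto)

text \<open>The action on rows is faithful, so the monoid laws are those of the composition of maps.\<close>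

lemma monoid_M: "monoid M"
proof (rule monoidI)
  fix A B C assume ABC: "A \<in> carrier M" "B \<in> carrier M" "C \<in> carrier M"
  show "A \<otimes>\<^bsub>M\<^esub> B \<otimes>\<^bsub>M\<^esub> C = A \<otimes>\<^bsub>M\<^esub> (B \<otimes>\<^bsub>M\<^esub> C)"
    by (rule M_eqI_act) (use ABC in \<open>auto simp: M_mult_closed act_closed simp flip: act_assoc\<close>)
next
  fix A assume A: "A \<in> carrier M"
  show "\<one>\<^bsub>M\<^esub> \<otimes>\<^bsub>M\<^esub> A = A"
    by (rule M_eqI_act)
      (use A in \<open>auto simp: M_mult_closed M_one_closed act_closed act_one simp flip: act_assoc\<close>)
  show "A \<otimes>\<^bsub>M\<^esub> \<one>\<^bsub>M\<^esub> = A"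
    by (rule M_eqI_act)
      (use A in \<open>auto simp: M_mult_closed M_one_closed act_closed act_one simp flip: act_assoc\<close>)
qed (auto intro: M_mult_closed M_one_closed)

sublocale GL: group GL
  unfolding GL_grp_def by (rule monoid.units_group[OF monoid_M])

lemma GL_mult: "A \<otimes>\<^bsub>GL\<^esub> B = A \<otimes>\<^bsub>M\<^esub> B" and GL_one: "\<one>\<^bsub>GL\<^esub> = \<one>\<^bsub>M\<^esub>"
  by (auto simp: GL_grp_def units_of_def)

lemma GL_M: "A \<in> carrier GL \<Longrightarrow> A \<in> carrier M"
  by (auto simp: GL_grp_def units_of_def Units_def)

lemma act_mult:
  "v \<in> rows n R \<Longrightarrow> A \<in> carrier GL \<Longrightarrow> B \<in> carrier GL \<Longrightarrow> v \<star> (A \<otimes>\<^bsub>GL\<^esub> B) = v \<star> A \<star> B"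
  by (simp add: GL_mult act_assoc GL_M)

lemma act_GL_one: "v \<in> rows n R \<Longrightarrow> v \<star> \<one>\<^bsub>GL\<^esub> = v"
  by (simp add: GL_one act_one)

lemma act_GL_closed: "v \<in> rows n R \<Longrightarrow> A \<in> carrier GL \<Longrightarrow> v \<star> A \<in> rows n R"
  by (simp add: act_closed GL_M)

lemma act_inv:
  "v \<in> rows n R \<Longrightarrow> A \<in> carrier GL \<Longrightarrow> v \<star> A \<star> inv\<^bsub>GL\<^esub> A = v"
  "v \<in> rows n R \<Longrightarrow> A \<in> carrier GL \<Longrightarrow> v \<star> inv\<^bsub>GL\<^esub> A \<star> A = v"
  by (simp_all add: act_GL_one flip: act_mult)

lemma GL_eqI_act:
  assumes "A \<in> carrier GL" "B \<in> carrier GL" "\<And>v. v \<in> rows n R \<Longrightarrow> v \<star> A = v \<star> B"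
  shows "A = B"
  using assms by (intro M_eqI_act) (auto simp: GL_M)

lemma orbit_eq_iff:
  assumes H: "subgroup H GL" and vw: "v \<in> rows n R" "w \<in> rows n R"
  shows "row_mult n R v ` H = row_mult n R w ` H \<longleftrightarrow> (\<exists>h\<in>H. w = v \<star> h)"
proof
  interpret subgroup H GL by (rule H)
  assume "row_mult n R v ` H = row_mult n R w ` H"
  moreover have "w \<in> row_mult n R w ` H"
    using vw act_GL_one[of w] one_closed by (metis imageI)
  ultimately show "\<exists>h\<in>H. w = v \<star> h" by auto
next
  interpret subgroup H GL by (rule H)
  assume "\<exists>h\<in>H. w = v \<star> h"
  then obtain h where h: "h \<in> H" "w = v \<star> h" by auto
  have "v \<star> g \<in> row_mult n R w ` H" if "g \<in> H" for g
  proof -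
    have "v \<star> g = w \<star> (inv\<^bsub>GL\<^esub> h \<otimes>\<^bsub>GL\<^esub> g)"
      using h that vw by (simp add: act_mult act_inv act_GL_closed)
    then show ?thesis using h that by auto
  qed
  moreover have "w \<star> g \<in> row_mult n R v ` H" if "g \<in> H" for g
  proof -
    have "w \<star> g = v \<star> (h \<otimes>\<^bsub>GL\<^esub> g)" using h that vw by (simp add: act_mult)
    then show ?thesis using h that by auto
  qed
  ultimately show "row_mult n R v ` H = row_mult n R w ` H" by auto
qed

lemma el_M: "i \<in> {1..n} \<Longrightarrow> j \<in> {1..n} \<Longrightarrow> x \<in> carrier R \<Longrightarrow> el i j x \<in> carrier M"
  by (auto simp: elem_mat_def carrier_M)

lemma act_el:
  assumes v: "v \<in> rows n R" and ij: "i \<in> {1..n}" "j \<in> {1..n}" "i \<noteq> j" and x: "x \<in> carrier R"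
  shows "v \<star> el i j x = v(j := v j \<oplus> v i \<otimes> x)"
proof (rule rows_eqI)
  fix l assume l: "l \<in> {1..n}"
  have v': "v \<in> {1..n} \<rightarrow> carrier R" using v by (auto simp: rows_carrier)
  let ?c = "if l = j then x else \<zero>"
  let ?f = "\<lambda>k. (if k = l then \<one> else \<zero>) \<oplus> (if k = i then ?c else \<zero>)"
  have "(v \<star> el i j x) l = dot v ?f"
    unfolding act_entry[OF l] using l ij x v' by (intro dot_cong) (auto simp: elem_mat_def)
  also have "\<dots> = dot ?f v" using v' x by (intro dot_comm) auto
  also have "\<dots> = dot (\<lambda>k. if k = l then \<one> else \<zero>) v \<oplus> dot (\<lambda>k. if k = i then ?c else \<zero>) v"
    using v' x by (intro dot_add) auto
  also have "\<dots> = v l \<oplus> ?c \<otimes> v i"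
    using v' x l ij by (subst (1 2) dot_unit) (auto simp: Pi_def)
  also have "\<dots> = (v(j := v j \<oplus> v i \<otimes> x)) l"
    using v' x l ij by (auto simp: m_comm Pi_def)
  finally show "(v \<star> el i j x) l = (v(j := v j \<oplus> v i \<otimes> x)) l" .
qed (use assms in \<open>auto intro!: act_closed rows_update el_M simp: rows_carrier\<close>)

lemma el_mult:
  assumes "i \<in> {1..n}" "j \<in> {1..n}" "i \<noteq> j" "x \<in> carrier R" "y \<in> carrier R"
  shows "el i j x \<otimes>\<^bsub>M\<^esub> el i j y = el i j (x \<oplus> y)"
proof (rule M_eqI_act)
  fix v assume v: "v \<in> rows n R"
  have c: "v i \<in> carrier R" "v j \<in> carrier R" using v assms by (auto simp: rows_carrier)
  then have "v(j := v j \<oplus> v i \<otimes> x) \<in> rows n R"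
    using v assms by (intro rows_update) auto
  then show "v \<star> (el i j x \<otimes>\<^bsub>M\<^esub> el i j y) = v \<star> el i j (x \<oplus> y)"
    using v assms c by (simp add: el_M act_el flip: act_assoc) (simp add: r_distr a_assoc)
qed (use assms in \<open>auto intro!: M_mult_closed el_M\<close>)

lemma el_zero: "i \<in> {1..n} \<Longrightarrow> j \<in> {1..n} \<Longrightarrow> i \<noteq> j \<Longrightarrow> el i j \<zero> = \<one>\<^bsub>M\<^esub>"
  by (auto simp: elem_mat_def mat_monoid_def)

lemma
  assumes "i \<in> {1..n}" "j \<in> {1..n}" "i \<noteq> j" "x \<in> carrier R"
  shows el_GL: "el i j x \<in> carrier GL" and inv_el: "inv\<^bsub>GL\<^esub> (el i j x) = el i j (\<ominus> x)"
proof -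
  have *: "el i j x \<otimes>\<^bsub>M\<^esub> el i j (\<ominus> x) = \<one>\<^bsub>M\<^esub>" "el i j (\<ominus> x) \<otimes>\<^bsub>M\<^esub> el i j x = \<one>\<^bsub>M\<^esub>"
    using assms by (auto simp: el_mult el_zero r_neg l_neg)
  then show x: "el i j x \<in> carrier GL"
    using assms el_M by (auto simp: GL_grp_def units_of_def Units_def intro!: bexI[of _ "el i j (\<ominus> x)"])
  have "el i j (\<ominus> x) \<in> carrier GL"
    using assms * el_M by (auto simp: GL_grp_def units_of_def Units_def intro!: bexI[of _ "el i j x"])
  then show "inv\<^bsub>GL\<^esub> (el i j x) = el i j (\<ominus> x)"
    using x * by (intro GL.inv_equality) (auto simp: GL_mult GL_one)
qed

lemma E_subgroup: "subgroup E GL"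
  unfolding E_abs_def by (rule GL.generate_is_subgroup) (auto intro!: el_GL)

lemma E_GL: "A \<in> E \<Longrightarrow> A \<in> carrier GL"
  using E_subgroup by (auto dest: subgroup.mem_carrier)

lemma el_E: "i \<in> {1..n} \<Longrightarrow> j \<in> {1..n} \<Longrightarrow> i \<noteq> j \<Longrightarrow> x \<in> carrier R \<Longrightarrow> el i j x \<in> E"
  unfolding E_abs_def by (rule generate.incl) auto

lemma E_mult: "A \<in> E \<Longrightarrow> B \<in> E \<Longrightarrow> A \<otimes>\<^bsub>GL\<^esub> B \<in> E"
  and E_inv: "A \<in> E \<Longrightarrow> inv\<^bsub>GL\<^esub> A \<in> E" and E_one: "\<one>\<^bsub>GL\<^esub> \<in> E"
  using E_subgroup by (auto simp: subgroup.m_closed subgroup.m_inv_closed subgroup.one_closed)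

lemma cls_eq_iff:
  assumes "v \<in> rows n R" "w \<in> rows n R"
  shows "cls n R v = cls n R w \<longleftrightarrow> (\<exists>g\<in>E. w = v \<star> g)"
  unfolding cls_def using E_subgroup assms by (rule orbit_eq_iff)

lemma cls_act: "v \<in> rows n R \<Longrightarrow> g \<in> E \<Longrightarrow> cls n R (v \<star> g) = cls n R v"
  using cls_eq_iff[of v "v \<star> g"] by (auto simp: act_GL_closed E_GL)

text \<open>Inverses of elementary matrices are elementary, so products suffice.\<close>

lemma E_induct [consumes 1, case_names one mult]:
  assumes "A \<in> E" and one: "P \<one>\<^bsub>GL\<^esub>"
    and step: "\<And>A i j x. A \<in> E \<Longrightarrow> P A \<Longrightarrow> i \<in> {1..n} \<Longrightarrow> j \<in> {1..n} \<Longrightarrow> i \<noteq> j \<Longrightarrow> x \<in> carrier R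
        \<Longrightarrow> P (A \<otimes>\<^bsub>GL\<^esub> el i j x)"
  shows "P A"
proof -
  have "P (B \<otimes>\<^bsub>GL\<^esub> A)" if "B \<in> E" "P B" for B
    using assms(1) that unfolding E_abs_def
  proof (induction A arbitrary: B rule: generate.induct)
    case one
    then show ?case using E_GL by (simp add: E_abs_def)
  next
    case (incl h)
    then show ?case using step by (auto simp: E_abs_def)
  next
    case (inv h)
    then obtain i j x where h: "h = el i j x" "i \<in> {1..n}" "j \<in> {1..n}" "i \<noteq> j" "x \<in> carrier R"
      by auto
    then show ?case using step inv by (auto simp: E_abs_def inv_el)
  next
    case (eng h1 h2)
    have *: "h1 \<in> E" "h2 \<in> E" "B \<in> E" using eng by (auto simp: E_abs_def)
    then have "P (B \<otimes>\<^bsub>GL\<^esub> h1 \<otimes>\<^bsub>GL\<^esub> h2)"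
      using eng.IH(1)[OF eng.prems] E_mult[of B h1] by (intro eng.IH(2)) (auto simp: E_abs_def)
    then show ?case using * by (simp add: GL.m_assoc E_GL)
  qed
  from this[OF E_one one] show ?thesis using assms(1) by (simp add: E_GL)
qed

end

section \<open>Orbits of the relative elementary group\<close>

locale relative_ring = matrix_ring R n + ideal I R
  for R :: "('a, 'm) ring_scheme" (structure) and n :: nat and I :: "'a set" +
  assumes n3: "n \<ge> 3"
begin

abbreviation EG where "EG \<equiv> GL\<lparr>carrier := E\<rparr>"
abbreviation EI where "EI \<equiv> E_rel n R I"

lemma normal_EG_iff:
  "N \<lhd> EG \<longleftrightarrow> subgroup N GL \<and> N \<subseteq> E \<and> (\<forall>g\<in>E. \<forall>h\<in>N. g \<otimes>\<^bsub>GL\<^esub> h \<otimes>\<^bsub>GL\<^esub> inv\<^bsub>GL\<^esub> g \<in> N)"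
proof -
  interpret EG: group EG by (rule GL.subgroup_imp_group[OF E_subgroup])
  have "subgroup N EG \<longleftrightarrow> subgroup N GL \<and> N \<subseteq> E"
    using GL.subgroup_incl[OF _ E_subgroup] GL.incl_subgroup[OF E_subgroup] subgroup.subset[of N EG]
    by auto
  then show ?thesis
    unfolding EG.normal_inv_iff using GL.m_inv_consistent[OF E_subgroup] by auto
qed

lemma E_normal: "E \<lhd> EG"
  unfolding normal_EG_iff using E_subgroup by (auto intro: E_mult E_inv)

lemma I_carrier: "x \<in> I \<Longrightarrow> x \<in> carrier R"
  by (rule a_Hcarr)

lemma idx: "1 \<in> {1..n}" "2 \<in> {1..n}" "3 \<in> {1..n}"
  using n3 by auto

lemma EI_E: "EI \<subseteq> E"
  unfolding E_rel_def using E_normal idx by (auto intro!: el_E I_carrier)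

lemma EI_normal: "EI \<lhd> EG"
proof -
  let ?S = "{N. N \<lhd> EG \<and> (\<forall>x\<in>I. el 2 1 x \<in> N)}"
  have "E \<in> ?S" using E_normal idx by (auto intro!: el_E I_carrier)
  then have "subgroup (\<Inter>?S) GL"
    by (intro GL.subgroups_Inter) (auto simp: normal_EG_iff)
  then show ?thesis
    using EI_E unfolding normal_EG_iff E_rel_def by (auto simp: normal_EG_iff)
qed

lemma EI_subgroup: "subgroup EI GL" and
  EI_conj: "g \<in> E \<Longrightarrow> h \<in> EI \<Longrightarrow> g \<otimes>\<^bsub>GL\<^esub> h \<otimes>\<^bsub>GL\<^esub> inv\<^bsub>GL\<^esub> g \<in> EI"
  using EI_normal by (auto simp: normal_EG_iff)

lemma EI_one: "\<one>\<^bsub>GL\<^esub> \<in> EI" and EI_mult: "g \<in> EI \<Longrightarrow> h \<in> EI \<Longrightarrow> g \<otimes>\<^bsub>GL\<^esub> h \<in> EI"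
  and EI_inv: "g \<in> EI \<Longrightarrow> inv\<^bsub>GL\<^esub> g \<in> EI" and EI_GL: "g \<in> EI \<Longrightarrow> g \<in> carrier GL"
  using EI_subgroup
  by (auto simp: subgroup.one_closed subgroup.m_closed subgroup.m_inv_closed subgroup.mem_carrier)

lemma EI_conj': "g \<in> E \<Longrightarrow> h \<in> EI \<Longrightarrow> inv\<^bsub>GL\<^esub> g \<otimes>\<^bsub>GL\<^esub> h \<otimes>\<^bsub>GL\<^esub> g \<in> EI"
  using EI_conj[of "inv\<^bsub>GL\<^esub> g" h] by (simp add: E_inv E_GL)

lemma el21_EI: "x \<in> I \<Longrightarrow> el 2 1 x \<in> EI"
  by (auto simp: E_rel_def)

text \<open>The conjugates \<open>g E\<^sub>2\<^sub>1(x) g\<^sup>-\<^sup>1\<close> generate \<open>E\<^sub>n(R, I)\<close>: the elements all of whose conjugates lie in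
  \<open>Q\<close> form a normal subgroup.\<close>

lemma EI_subset_subgroup:
  assumes Q: "subgroup Q GL"
    and conj: "\<And>g x. g \<in> E \<Longrightarrow> x \<in> I \<Longrightarrow> g \<otimes>\<^bsub>GL\<^esub> el 2 1 x \<otimes>\<^bsub>GL\<^esub> inv\<^bsub>GL\<^esub> g \<in> Q"
  shows "EI \<subseteq> Q"
proof -
  let ?N = "{h \<in> E. \<forall>g\<in>E. g \<otimes>\<^bsub>GL\<^esub> h \<otimes>\<^bsub>GL\<^esub> inv\<^bsub>GL\<^esub> g \<in> Q}"
  have "subgroup ?N GL"
  proof (rule GL.subgroupI)
    show "?N \<noteq> {}" using E_one Q by (auto simp: subgroup.one_closed E_GL)
  next
    fix h assume h: "h \<in> ?N"
    have "g \<otimes>\<^bsub>GL\<^esub> inv\<^bsub>GL\<^esub> h \<otimes>\<^bsub>GL\<^esub> inv\<^bsub>GL\<^esub> g \<in> Q" if g: "g \<in> E" for g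
    proof -
      have "inv\<^bsub>GL\<^esub> (g \<otimes>\<^bsub>GL\<^esub> h \<otimes>\<^bsub>GL\<^esub> inv\<^bsub>GL\<^esub> g) \<in> Q"
        using h g Q by (auto intro: subgroup.m_inv_closed)
      then show ?thesis
        using h g by (simp add: GL.inv_mult_group GL.m_assoc E_GL)
    qed
    then show "inv\<^bsub>GL\<^esub> h \<in> ?N" using h by (auto intro: E_inv)
  next
    fix h k assume hk: "h \<in> ?N" "k \<in> ?N"
    have "g \<otimes>\<^bsub>GL\<^esub> (h \<otimes>\<^bsub>GL\<^esub> k) \<otimes>\<^bsub>GL\<^esub> inv\<^bsub>GL\<^esub> g \<in> Q" if g: "g \<in> E" for g
    proof -
      have "(g \<otimes>\<^bsub>GL\<^esub> h \<otimes>\<^bsub>GL\<^esub> inv\<^bsub>GL\<^esub> g) \<otimes>\<^bsub>GL\<^esub> (g \<otimes>\<^bsub>GL\<^esub> k \<otimes>\<^bsub>GL\<^esub> inv\<^bsub>GL\<^esub> g) \<in> Q"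
        using hk g Q by (auto intro: subgroup.m_closed)
      moreover have "(g \<otimes>\<^bsub>GL\<^esub> h \<otimes>\<^bsub>GL\<^esub> inv\<^bsub>GL\<^esub> g) \<otimes>\<^bsub>GL\<^esub> (g \<otimes>\<^bsub>GL\<^esub> k \<otimes>\<^bsub>GL\<^esub> inv\<^bsub>GL\<^esub> g)
          = g \<otimes>\<^bsub>GL\<^esub> (h \<otimes>\<^bsub>GL\<^esub> k) \<otimes>\<^bsub>GL\<^esub> inv\<^bsub>GL\<^esub> g"
        using hk g by (simp add: GL.m_assoc E_GL GL.inv_solve_left')
      ultimately show ?thesis by simp
    qed
    then show "h \<otimes>\<^bsub>GL\<^esub> k \<in> ?N" using hk by (auto intro: E_mult)
  qed (auto intro: E_GL)
  moreover have "g \<otimes>\<^bsub>GL\<^esub> h \<otimes>\<^bsub>GL\<^esub> inv\<^bsub>GL\<^esub> g \<in> ?N" if g: "g \<in> E" and h: "h \<in> ?N" for g h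
  proof -
    have "k \<otimes>\<^bsub>GL\<^esub> (g \<otimes>\<^bsub>GL\<^esub> h \<otimes>\<^bsub>GL\<^esub> inv\<^bsub>GL\<^esub> g) \<otimes>\<^bsub>GL\<^esub> inv\<^bsub>GL\<^esub> k \<in> Q" if k: "k \<in> E" for k
    proof -
      have "(k \<otimes>\<^bsub>GL\<^esub> g) \<otimes>\<^bsub>GL\<^esub> h \<otimes>\<^bsub>GL\<^esub> inv\<^bsub>GL\<^esub> (k \<otimes>\<^bsub>GL\<^esub> g) \<in> Q"
        using h g k E_mult by auto
      then show ?thesis using h g k by (simp add: GL.m_assoc GL.inv_mult_group E_GL)
    qed
    then show ?thesis using g h by (auto intro!: E_mult E_inv)
  qed
  ultimately have "?N \<lhd> EG" by (auto simp: normal_EG_iff)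
  moreover have "\<forall>x\<in>I. el 2 1 x \<in> ?N" using conj idx by (auto intro!: el_E I_carrier)
  ultimately have "EI \<subseteq> ?N" unfolding E_rel_def by auto
  moreover have "?N \<subseteq> Q" using E_one by (fastforce simp: E_GL)
  ultimately show ?thesis by auto
qed

definition move :: "nat \<Rightarrow> nat \<Rightarrow> 'a \<Rightarrow> (nat \<Rightarrow> 'a) \<Rightarrow> nat \<Rightarrow> 'a" where
  "move i j c v = v(j := v j \<oplus> v i \<otimes> c)"

lemma act_el_move:
  "v \<in> rows n R \<Longrightarrow> i \<in> {1..n} \<Longrightarrow> j \<in> {1..n} \<Longrightarrow> i \<noteq> j \<Longrightarrow> c \<in> carrier R \<Longrightarrow> v \<star> el i j c = move i j c v"
  by (simp add: act_el move_def)

lemma move_closed: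
  "v \<in> rows n R \<Longrightarrow> i \<in> {1..n} \<Longrightarrow> j \<in> {1..n} \<Longrightarrow> c \<in> carrier R \<Longrightarrow> move i j c v \<in> rows n R"
  unfolding move_def by (intro rows_update) (auto simp: rows_carrier)

text \<open>The rows congruent to \<open>e\<^sub>1\<close> modulo \<open>I\<close>.\<close>

definition rel_rows :: "(nat \<Rightarrow> 'a) set" where
  "rel_rows = {v \<in> rows n R. \<forall>i\<in>{1..n}. v i \<ominus> (if i = 1 then \<one> else \<zero>) \<in> I}"

lemma rel_rows_iff: "v \<in> rel_rows \<longleftrightarrow> v \<in> rows n R \<and> v 1 \<ominus> \<one> \<in> I \<and> (\<forall>i\<in>{2..n}. v i \<in> I)"
proof -
  have "{1..n} = insert 1 {2..n}" using n3 by auto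
  then have "v \<in> rel_rows \<longleftrightarrow> v \<in> rows n R \<and> v 1 \<ominus> \<one> \<in> I \<and> (\<forall>i\<in>{2..n}. v i \<ominus> \<zero> \<in> I)"
    unfolding rel_rows_def by auto
  also have "\<dots> \<longleftrightarrow> v \<in> rows n R \<and> v 1 \<ominus> \<one> \<in> I \<and> (\<forall>i\<in>{2..n}. v i \<in> I)"
    by (auto simp: rows_carrier a_minus_def)
  finally show ?thesis .
qed

lemma Um_rel_eq: "Um_rel n R I = Um n R \<inter> rel_rows"
  by (auto simp: Um_rel_def rel_rows_def Um_def)

lemma rel_rowsD: "v \<in> rel_rows \<Longrightarrow> v \<in> rows n R"
  by (simp add: rel_rows_def)

lemma rel_rows_carrier: "v \<in> rel_rows \<Longrightarrow> i \<in> {1..n} \<Longrightarrow> v i \<in> carrier R"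
  by (auto simp: rel_rows_def rows_carrier)

lemma rel_rows_I: "v \<in> rel_rows \<Longrightarrow> i \<in> {2..n} \<Longrightarrow> v i \<in> I"
  by (simp add: rel_rows_iff)

lemma add_I: "a \<in> I \<Longrightarrow> b \<in> I \<Longrightarrow> a \<oplus> b \<in> I"
  by (rule a_closed)

lemma I_minus: "a \<in> I \<Longrightarrow> \<ominus> a \<in> I"
  by (rule a_inv_closed)

lemma rel_rows_move:
  assumes v: "v \<in> rel_rows" and ij: "i \<in> {1..n}" "j \<in> {1..n}" "i \<noteq> j" and c: "c \<in> carrier R"
    and *: "i \<ge> 2 \<or> c \<in> I"
  shows "move i j c v \<in> rel_rows"
proof -
  have vc: "v 1 \<in> carrier R" "v i \<in> carrier R" "v j \<in> carrier R"
    using v ij idx by (auto simp: rel_rows_carrier)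
  have I: "v i \<otimes> c \<in> I"
    using * v ij c vc rel_rows_I[of v i] by (auto intro: I_l_closed I_r_closed)
  show ?thesis unfolding rel_rows_iff
  proof (intro conjI ballI)
    show "move i j c v \<in> rows n R" using v ij c by (intro move_closed) (auto simp: rel_rowsD)
    have "v 1 \<oplus> v i \<otimes> c \<ominus> \<one> = (v 1 \<ominus> \<one>) \<oplus> v i \<otimes> c" using vc c by algebra
    then show "move i j c v 1 \<ominus> \<one> \<in> I"
      using v I by (auto simp: move_def rel_rows_iff intro: add_I)
    fix k assume "k \<in> {2..n}"
    then show "move i j c v k \<in> I"
      using v I rel_rows_I[of v k] by (auto simp: move_def intro: add_I)
  qed
qed

text \<open>These are orbits of the group generated by the \<open>E\<^sub>i\<^sub>j(c)\<close> with \<open>i \<ge> 2\<close> or \<open>c \<in> I\<close>, the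
  elementary matrices that preserve the congruence to \<open>e\<^sub>1\<close>.\<close>

inductive row_equiv :: "(nat \<Rightarrow> 'a) \<Rightarrow> (nat \<Rightarrow> 'a) \<Rightarrow> bool" where
  refl: "v \<in> rel_rows \<Longrightarrow> row_equiv v v"
| step: "row_equiv v w \<Longrightarrow> i \<in> {1..n} \<Longrightarrow> j \<in> {1..n} \<Longrightarrow> i \<noteq> j \<Longrightarrow> c \<in> carrier R \<Longrightarrow> i \<ge> 2 \<or> c \<in> I
    \<Longrightarrow> row_equiv v (move i j c w)"

lemma row_equiv_rel_rows: "row_equiv v w \<Longrightarrow> v \<in> rel_rows \<and> w \<in> rel_rows"
  by (induction rule: row_equiv.induct) (auto intro: rel_rows_move)

lemma row_equiv_trans: "row_equiv v w \<Longrightarrow> row_equiv u v \<Longrightarrow> row_equiv u w"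
  by (induction rule: row_equiv.induct) (auto intro: row_equiv.step)

lemma row_equiv_move:
  "v \<in> rel_rows \<Longrightarrow> i \<in> {1..n} \<Longrightarrow> j \<in> {1..n} \<Longrightarrow> i \<noteq> j \<Longrightarrow> c \<in> carrier R \<Longrightarrow> i \<ge> 2 \<or> c \<in> I
    \<Longrightarrow> row_equiv v (move i j c v)"
  by (auto intro: row_equiv.intros)

text \<open>An arbitrary \<open>c\<close> can be traded for elements of \<open>I\<close>, because the first coordinate is \<open>1 + x\<close>
  with \<open>x \<in> I\<close>: adding \<open>c v\<^sub>i v\<^sub>1\<close> to \<open>v\<^sub>j\<close> and then subtracting \<open>c x v\<^sub>i\<close> adds \<open>c v\<^sub>i\<close>.
  Here \<open>c v\<^sub>i \<in> I\<close> because \<open>i \<ge> 2\<close>.\<close>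

lemma scalar_move_off_first:
  assumes trans: "\<And>u v w. P u v \<Longrightarrow> P v w \<Longrightarrow> P u w"
    and I_move: "\<And>v i j y. v \<in> rel_rows \<Longrightarrow> i \<in> {1..n} \<Longrightarrow> j \<in> {1..n} \<Longrightarrow> i \<noteq> j \<Longrightarrow> y \<in> I
      \<Longrightarrow> P v (move i j y v)"
    and v: "v \<in> rel_rows" and ij: "i \<in> {2..n}" "j \<in> {2..n}" "i \<noteq> j" and c: "c \<in> carrier R"
  shows "P v (move i j c v)"
proof -
  have ij': "i \<in> {1..n}" "j \<in> {1..n}" "1 \<noteq> j" using ij by auto
  have vc: "v 1 \<in> carrier R" "v i \<in> carrier R" "v j \<in> carrier R"
    using v ij' idx by (auto simp: rel_rows_carrier)
  have vI: "v i \<in> I" "v 1 \<ominus> \<one> \<in> I" using v ij by (auto simp: rel_rows_I rel_rows_iff)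
  define y where "y = v i \<otimes> c"
  define z where "z = \<ominus> ((v 1 \<ominus> \<one>) \<otimes> c)"
  have y: "y \<in> I" unfolding y_def using vI c by (intro I_r_closed)
  have z: "z \<in> I" unfolding z_def using vI c by (intro I_minus I_r_closed)
  have "move 1 j y v \<in> rel_rows" using v ij' idx y by (intro rel_rows_move) (auto simp: I_carrier)
  then have "P (move 1 j y v) (move i j z (move 1 j y v))"
    using I_move z ij' ij by auto
  moreover have "P v (move 1 j y v)" using I_move[OF v] y ij' idx by auto
  moreover have "v j \<oplus> v 1 \<otimes> (v i \<otimes> c) \<oplus> v i \<otimes> \<ominus> ((v 1 \<ominus> \<one>) \<otimes> c) = v j \<oplus> v i \<otimes> c"
    using vc c by algebra
  then have "move i j z (move 1 j y v) = move i j c v"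
    using ij by (simp add: move_def y_def z_def)
  ultimately show ?thesis using trans by metis
qed

text \<open>A smaller set of additions generates the equivalence, one whose coefficients lie in \<open>I\<close> or are
  \<open>\<plusminus>1\<close> and so exist in \<open>\<int> \<oplus> I\<close> as well as in \<open>R\<close>.  Adding \<open>c v\<^sub>i\<close> to the first coordinate is done
  through a third one, since \<open>E\<^sub>i\<^sub>1(c)\<close> is the commutator of \<open>E\<^sub>i\<^sub>k(c)\<close> and \<open>E\<^sub>k\<^sub>1(1)\<close>.\<close>

lemma row_equiv_le:
  assumes trans: "\<And>u v w. P u v \<Longrightarrow> P v w \<Longrightarrow> P u w" and refl: "\<And>v. v \<in> rel_rows \<Longrightarrow> P v v"
    and I_move: "\<And>v i j y. v \<in> rel_rows \<Longrightarrow> i \<in> {1..n} \<Longrightarrow> j \<in> {1..n} \<Longrightarrow> i \<noteq> j \<Longrightarrow> y \<in> I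
      \<Longrightarrow> P v (move i j y v)"
    and one_move: "\<And>v k. v \<in> rel_rows \<Longrightarrow> k \<in> {2..n} \<Longrightarrow> P v (move k 1 \<one> v)"
      "\<And>v k. v \<in> rel_rows \<Longrightarrow> k \<in> {2..n} \<Longrightarrow> P v (move k 1 (\<ominus> \<one>) v)"
  shows "row_equiv v w \<Longrightarrow> P v w"
proof (induction rule: row_equiv.induct)
  case (step v w i j c)
  have w: "w \<in> rel_rows" using step row_equiv_rel_rows by auto
  have off: "P v (move i j c v)"
    if "v \<in> rel_rows" "i \<in> {2..n}" "j \<in> {2..n}" "i \<noteq> j" "c \<in> carrier R" for v i j c
    by (rule scalar_move_off_first[of P]) (use trans I_move that in \<open>blast+\<close>)
  have "P w (move i j c w)"
  proof (cases "c \<in> I")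
    case True
    then show ?thesis using I_move w step by auto
  next
    case False
    then have i: "i \<in> {2..n}" using step by auto
    show ?thesis
    proof (cases "j = 1")
      case False
      then have "j \<in> {2..n}" using step by auto
      then show ?thesis using off w step i by blast
    next
      case True
      define k :: nat where "k = (if i = 2 then 3 else 2)"
      have k: "k \<in> {2..n}" "k \<noteq> i" using n3 by (auto simp: k_def)
      have k': "k \<in> {1..n}" "i \<in> {1..n}" "1 \<in> {1..n}" "k \<noteq> 1" "i \<noteq> 1" using k i by auto
      define w1 where "w1 = move i k c w"
      define w2 where "w2 = move k 1 \<one> w1"
      define w3 where "w3 = move i k (\<ominus> c) w2"
      define w4 where "w4 = move k 1 (\<ominus> \<one>) w3"
      have X: "w1 \<in> rel_rows" "w2 \<in> rel_rows" "w3 \<in> rel_rows"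
        unfolding w1_def w2_def w3_def using w i k k' step.hyps(5) by (auto intro!: rel_rows_move)
      have "P w w1" "P w1 w2" "P w2 w3" "P w3 w4"
        using off[of w i k c] off[of w2 i k "\<ominus> c"] one_move X w i k k' step.hyps(5)
        by (auto simp: w1_def w2_def w3_def w4_def)
      then have "P w w4" using trans by blast
      moreover have "w4 = move i 1 c w"
      proof -
        have wc: "w 1 \<in> carrier R" "w i \<in> carrier R" "w k \<in> carrier R"
          using w k' by (auto simp: rel_rows_carrier)
        have "w k \<oplus> w i \<otimes> c \<oplus> w i \<otimes> \<ominus> c = w k"
          "w 1 \<oplus> (w k \<oplus> w i \<otimes> c) \<otimes> \<one> \<oplus> (w k \<oplus> w i \<otimes> c \<oplus> w i \<otimes> \<ominus> c) \<otimes> \<ominus> \<one> = w 1 \<oplus> w i \<otimes> c"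
          using wc step.hyps(5) by algebra+
        then show ?thesis
          using k k' unfolding w1_def w2_def w3_def w4_def move_def by auto
      qed
      ultimately show ?thesis using True by simp
    qed
  qed
  then show ?case using step trans by blast
qed (use refl in auto)

lemma el_commutator:
  assumes ijk: "i \<in> {1..n}" "j \<in> {1..n}" "k \<in> {1..n}" "i \<noteq> j" "j \<noteq> k" "i \<noteq> k"
    and xy: "x \<in> carrier R" "y \<in> carrier R"
  shows "el i j x \<otimes>\<^bsub>GL\<^esub> el j k y \<otimes>\<^bsub>GL\<^esub> inv\<^bsub>GL\<^esub> el i j x \<otimes>\<^bsub>GL\<^esub> inv\<^bsub>GL\<^esub> el j k y = el i k (x \<otimes> y)"
proof (rule GL_eqI_act)
  note GL = el_GL[OF ijk(1,2,4) xy(1)] el_GL[OF ijk(2,3,5) xy(2)] el_GL[OF ijk(1,3,6)]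
  show "el i j x \<otimes>\<^bsub>GL\<^esub> el j k y \<otimes>\<^bsub>GL\<^esub> inv\<^bsub>GL\<^esub> el i j x \<otimes>\<^bsub>GL\<^esub> inv\<^bsub>GL\<^esub> el j k y \<in> carrier GL"
    "el i k (x \<otimes> y) \<in> carrier GL" using GL xy by auto
  fix v assume v: "v \<in> rows n R"
  have c: "v i \<in> carrier R" "v j \<in> carrier R" "v k \<in> carrier R" using v ijk by (auto simp: rows_carrier)
  have "v \<star> (el i j x \<otimes>\<^bsub>GL\<^esub> el j k y \<otimes>\<^bsub>GL\<^esub> inv\<^bsub>GL\<^esub> el i j x \<otimes>\<^bsub>GL\<^esub> inv\<^bsub>GL\<^esub> el j k y)
      = move j k (\<ominus> y) (move i j (\<ominus> x) (move j k y (move i j x v)))"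
    using GL v ijk xy by (simp add: act_mult act_GL_closed inv_el act_el_move move_closed el_GL)
  also have "\<dots> = move i k (x \<otimes> y) v"
  proof -
    have "v j \<oplus> v i \<otimes> x \<oplus> v i \<otimes> \<ominus> x = v j"
      "v k \<oplus> (v j \<oplus> v i \<otimes> x) \<otimes> y \<oplus> v j \<otimes> \<ominus> y = v k \<oplus> v i \<otimes> (x \<otimes> y)"
      using c xy by algebra+
    then show ?thesis using ijk unfolding move_def by auto
  qed
  also have "\<dots> = v \<star> el i k (x \<otimes> y)" using v ijk xy by (simp add: act_el_move)
  finally show "v \<star> (el i j x \<otimes>\<^bsub>GL\<^esub> el j k y \<otimes>\<^bsub>GL\<^esub> inv\<^bsub>GL\<^esub> el i j x \<otimes>\<^bsub>GL\<^esub> inv\<^bsub>GL\<^esub> el j k y)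
      = v \<star> el i k (x \<otimes> y)" .
qed

text \<open>Commutators with \<open>E\<^sub>k\<^sub>l(1)\<close> replace either index of an elementary matrix by a third one; starting from
  \<open>E\<^sub>2\<^sub>1(x)\<close> this reaches all positions, as \<open>n \<ge> 3\<close>.\<close>

lemma el_EI:
  assumes "i \<in> {1..n}" "j \<in> {1..n}" "i \<noteq> j" "x \<in> I"
  shows "el i j x \<in> EI"
proof -
  let ?P = "\<lambda>i j. \<forall>x\<in>I. el i j x \<in> EI"
  have col: "?P i k"
    if "?P i j" "i \<in> {1..n}" "j \<in> {1..n}" "k \<in> {1..n}" "i \<noteq> j" "j \<noteq> k" "i \<noteq> k" for i j k
  proof
    fix x assume x: "x \<in> I"
    have c: "el j k \<one> \<in> E" "el i j x \<in> EI" "inv\<^bsub>GL\<^esub> el i j x \<in> EI"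
      using that x by (auto intro!: el_E EI_inv)
    have "el i j x \<otimes>\<^bsub>GL\<^esub> (el j k \<one> \<otimes>\<^bsub>GL\<^esub> inv\<^bsub>GL\<^esub> el i j x \<otimes>\<^bsub>GL\<^esub> inv\<^bsub>GL\<^esub> el j k \<one>) \<in> EI"
      using c by (intro EI_mult EI_conj)
    also have "el i j x \<otimes>\<^bsub>GL\<^esub> (el j k \<one> \<otimes>\<^bsub>GL\<^esub> inv\<^bsub>GL\<^esub> el i j x \<otimes>\<^bsub>GL\<^esub> inv\<^bsub>GL\<^esub> el j k \<one>) = el i k x"
      using el_commutator[of i j k x \<one>] that x c
      by (simp add: GL.m_assoc I_carrier E_GL EI_GL)
    finally show "el i k x \<in> EI" .
  qed
  have row: "?P k j"
    if "?P i j" "i \<in> {1..n}" "j \<in> {1..n}" "k \<in> {1..n}" "i \<noteq> j" "j \<noteq> k" "i \<noteq> k" for i j k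
  proof
    fix x assume x: "x \<in> I"
    have c: "el k i \<one> \<in> E" "el i j x \<in> EI" "inv\<^bsub>GL\<^esub> el i j x \<in> EI"
      using that x by (auto intro!: el_E EI_inv)
    have "(el k i \<one> \<otimes>\<^bsub>GL\<^esub> el i j x \<otimes>\<^bsub>GL\<^esub> inv\<^bsub>GL\<^esub> el k i \<one>) \<otimes>\<^bsub>GL\<^esub> inv\<^bsub>GL\<^esub> el i j x \<in> EI"
      using c by (intro EI_mult EI_conj)
    then show "el k j x \<in> EI"
      using el_commutator[of k i j \<one> x] that x c by (simp add: I_carrier)
  qed
  have 21: "?P 2 1" using el21_EI by blast
  have i1: "?P i 1" if "i \<in> {2..n}" for i
    using row[OF 21, of i] 21 that idx by (cases "i = 2") auto
  have ij: "?P i j" if "i \<in> {2..n}" "j \<in> {1..n}" "i \<noteq> j" for i j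
    using col[OF i1[of i], of j] i1[of i] that idx by (cases "j = 1") auto
  show ?thesis
  proof (cases "i = 1")
    case True
    define k :: nat where "k = (if j = 2 then 3 else 2)"
    have k: "k \<in> {2..n}" "k \<noteq> j" using n3 by (auto simp: k_def)
    then show ?thesis using row[OF ij[of k j], of 1] assms True by auto
  next
    case False
    then show ?thesis using ij assms by auto
  qed
qed

lemma cls_rel_eq_iff:
  assumes "v \<in> rows n R" "w \<in> rows n R"
  shows "cls_rel n R I v = cls_rel n R I w \<longleftrightarrow> (\<exists>h\<in>EI. w = v \<star> h)"
  unfolding cls_rel_def using EI_subgroup assms by (rule orbit_eq_iff)

lemma cls_rel_act: "v \<in> rows n R \<Longrightarrow> h \<in> EI \<Longrightarrow> cls_rel n R I (v \<star> h) = cls_rel n R I v"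
  using cls_rel_eq_iff[of v "v \<star> h"] by (auto simp: act_GL_closed EI_GL)

lemma cls_rel_translate:
  assumes "v \<in> rows n R" "w \<in> rows n R" "cls_rel n R I v = cls_rel n R I w" "g \<in> E"
  shows "cls_rel n R I (v \<star> g) = cls_rel n R I (w \<star> g)"
proof -
  obtain h where h: "h \<in> EI" "w = v \<star> h" using assms cls_rel_eq_iff by auto
  have "w \<star> g = v \<star> g \<star> (inv\<^bsub>GL\<^esub> g \<otimes>\<^bsub>GL\<^esub> h \<otimes>\<^bsub>GL\<^esub> g)"
    using h assms by (simp add: act_mult act_inv EI_GL E_GL act_GL_closed)
  then show ?thesis
    using h assms by (simp add: cls_rel_act EI_conj' act_GL_closed E_GL)
qed

lemma cls_rel_move:
  assumes "v \<in> rows n R" "i \<in> {1..n}" "j \<in> {1..n}" "i \<noteq> j" "y \<in> I"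
  shows "cls_rel n R I (move i j y v) = cls_rel n R I v"
  using assms by (simp add: cls_rel_act el_EI I_carrier flip: act_el_move)

text \<open>For \<open>c \<notin> I\<close> the matrix \<open>E\<^sub>k\<^sub>1(c)\<close> does not lie in \<open>E\<^sub>n(R, I)\<close>.  It is a commutator
  \<open>a b a\<^sup>-\<^sup>1 b\<^sup>-\<^sup>1\<close> with \<open>a = E\<^sub>k\<^sub>i(c)\<close>, \<open>b = E\<^sub>i\<^sub>1(1)\<close> and \<open>i, k \<ge> 2\<close>.  On rows
  congruent to \<open>e\<^sub>1\<close> the matrix \<open>a\<close> does not change the orbit, and by normality \<open>b\<close> maps orbits to
  orbits; so the commutator does not change the orbit either.\<close>

lemma row_equiv_cls_rel: "row_equiv v w \<Longrightarrow> cls_rel n R I v = cls_rel n R I w"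
proof (rule row_equiv_le[of "\<lambda>v w. cls_rel n R I v = cls_rel n R I w"])
  have off: "cls_rel n R I v = cls_rel n R I (move i j c v)"
    if "v \<in> rel_rows" "i \<in> {2..n}" "j \<in> {2..n}" "i \<noteq> j" "c \<in> carrier R" for v i j c
    by (rule scalar_move_off_first) (use that in \<open>auto simp: cls_rel_move rel_rowsD\<close>)
  have into_first: "cls_rel n R I v = cls_rel n R I (move k 1 c v)"
    if v: "v \<in> rel_rows" and k: "k \<in> {2..n}" and c: "c \<in> carrier R" for v k c
  proof -
    define i :: nat where "i = (if k = 2 then 3 else 2)"
    have i: "i \<in> {2..n}" "i \<noteq> k" using n3 by (auto simp: i_def)
    have i': "i \<in> {1..n}" "k \<in> {1..n}" "1 \<in> {1..n}" "k \<noteq> 1" "i \<noteq> 1" using i k by auto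
    define a where "a = el k i c"
    define b where "b = el i 1 \<one>"
    have E: "a \<in> E" "b \<in> E" "inv\<^bsub>GL\<^esub> a \<in> E" "inv\<^bsub>GL\<^esub> b \<in> E"
      using i i' c unfolding a_def b_def by (auto intro!: el_E E_inv)
    note GL = E[THEN E_GL]
    have rows: "v \<in> rows n R" using v by (rule rel_rowsD)
    have X: "v \<star> b \<in> rel_rows" "v \<star> a \<in> rel_rows" "v \<star> a \<star> b \<in> rel_rows"
      using rows v c i i' k
      by (auto simp: a_def b_def act_el_move move_closed intro!: rel_rows_move)
    have "cls_rel n R I (v \<star> a \<star> b \<star> inv\<^bsub>GL\<^esub> a) = cls_rel n R I (v \<star> a \<star> b)"
      using off[OF X(3), of k i "\<ominus> c"] X i k i' c
      by (simp add: a_def inv_el act_el_move rel_rowsD del: atLeastAtMost_iff)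
    also have "\<dots> = cls_rel n R I (v \<star> b)"
      using off[OF v, of k i c] rows i k i' c E GL
      by (intro cls_rel_translate) (auto simp: a_def act_el_move move_closed)
    finally have "cls_rel n R I (v \<star> a \<star> b \<star> inv\<^bsub>GL\<^esub> a \<star> inv\<^bsub>GL\<^esub> b)
        = cls_rel n R I (v \<star> b \<star> inv\<^bsub>GL\<^esub> b)"
      using rows E GL by (intro cls_rel_translate) (auto simp: act_GL_closed)
    then have "cls_rel n R I (v \<star> (a \<otimes>\<^bsub>GL\<^esub> b \<otimes>\<^bsub>GL\<^esub> inv\<^bsub>GL\<^esub> a \<otimes>\<^bsub>GL\<^esub> inv\<^bsub>GL\<^esub> b)) = cls_rel n R I v"
      using rows GL by (simp add: act_mult act_inv act_GL_closed)
    moreover have "a \<otimes>\<^bsub>GL\<^esub> b \<otimes>\<^bsub>GL\<^esub> inv\<^bsub>GL\<^esub> a \<otimes>\<^bsub>GL\<^esub> inv\<^bsub>GL\<^esub> b = el k 1 c"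
      unfolding a_def b_def using el_commutator[of k i 1 c \<one>] i i' c by simp
    ultimately show ?thesis using rows i' c by (simp add: act_el_move)
  qed
  show "cls_rel n R I v = cls_rel n R I (move k 1 \<one> v)"
    "cls_rel n R I v = cls_rel n R I (move k 1 (\<ominus> \<one>) v)"
    if "v \<in> rel_rows" "k \<in> {2..n}" for v k
    using into_first that by auto
  show "cls_rel n R I v = cls_rel n R I (move i j y v)"
    if "v \<in> rel_rows" "i \<in> {1..n}" "j \<in> {1..n}" "i \<noteq> j" "y \<in> I" for v i j y
    using that by (simp add: cls_rel_move rel_rowsD)
qed auto

section \<open>Transvections\<close>

text \<open>The row \<open>v (1 + x c r)\<close>, for a column \<open>c\<close> and a row \<open>r\<close>.\<close>

definition transvect :: "'a \<Rightarrow> (nat \<Rightarrow> 'a) \<Rightarrow> (nat \<Rightarrow> 'a) \<Rightarrow> (nat \<Rightarrow> 'a) \<Rightarrow> nat \<Rightarrow> 'a" where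
  "transvect x c r v = (\<lambda>i\<in>{1..n}. v i \<oplus> x \<otimes> dot v c \<otimes> r i)"

definition vec :: "(nat \<Rightarrow> 'a) set" where "vec = {1..n} \<rightarrow> carrier R"

text \<open>For \<open>r c = 0\<close> the matrices \<open>1 + x c r\<close> are additive in \<open>r\<close> for fixed \<open>c\<close> and in \<open>c\<close> for fixed \<open>r\<close>.
  The property below is therefore additive in each argument, and it suffices to establish it for
  simple pairs.\<close>

definition realized :: "(nat \<Rightarrow> 'a) \<Rightarrow> (nat \<Rightarrow> 'a) \<Rightarrow> bool" where
  "realized c r \<longleftrightarrow> c \<in> vec \<and> r \<in> vec \<and> dot r c = \<zero> \<and> (\<forall>v\<in>rel_rows. \<forall>x\<in>I. row_equiv v (transvect x c r v))"

lemma rel_rows_vec: "v \<in> rel_rows \<Longrightarrow> v \<in> vec" by (auto simp: rel_rows_carrier vec_def)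

lemma dot_vec: "v \<in> vec \<Longrightarrow> w \<in> vec \<Longrightarrow> dot v w \<in> carrier R"
  by (simp add: vec_def dot_closed)

lemma vec_carrier: "v \<in> vec \<Longrightarrow> i \<in> {1..n} \<Longrightarrow> v i \<in> carrier R" by (auto simp: vec_def)

lemma realizedD:
  assumes "realized c r"
  shows "c \<in> vec" "r \<in> vec" "dot r c = \<zero>" "v \<in> rel_rows \<Longrightarrow> x \<in> I \<Longrightarrow> row_equiv v (transvect x c r v)"
  using assms by (auto simp: realized_def)

lemma dot_transvect:
  assumes "v \<in> vec" "c \<in> vec" "r \<in> vec" "b \<in> vec" "x \<in> carrier R"
  shows "dot (transvect x c r v) b = dot v b \<oplus> x \<otimes> dot v c \<otimes> dot r b"
proof -
  have c: "dot v c \<in> carrier R" using assms by (simp add: dot_vec)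
  have "dot (transvect x c r v) b = dot (\<lambda>i. v i \<oplus> x \<otimes> dot v c \<otimes> r i) b"
    using assms c by (intro dot_cong) (auto simp: transvect_def vec_def Pi_def)
  also have "\<dots> = dot v b \<oplus> dot (\<lambda>i. x \<otimes> dot v c \<otimes> r i) b"
    using assms c by (intro dot_add) (auto simp: vec_def Pi_def)
  also have "dot (\<lambda>i. x \<otimes> dot v c \<otimes> r i) b = x \<otimes> dot v c \<otimes> dot r b"
    using assms c by (intro dot_smult) (auto simp: vec_def)
  finally show ?thesis .
qed

lemma transvect_closed:
  assumes "v \<in> rows n R" "c \<in> vec" "r \<in> vec" "x \<in> carrier R"
  shows "transvect x c r v \<in> rows n R"
  using assms dot_vec[of v c] unfolding rows_def transvect_def
  by (auto simp: vec_def Pi_def PiE_iff)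

lemma realized_add_right:
  assumes "realized c r" "realized c s"
  shows "realized c (\<lambda>i. r i \<oplus> s i)"
  unfolding realized_def
proof (intro conjI ballI)
  note D = realizedD(1-3)[OF assms(1)] realizedD(1-3)[OF assms(2)]
  show "c \<in> vec" "(\<lambda>i. r i \<oplus> s i) \<in> vec" using D by (auto simp: vec_def)
  have "dot (\<lambda>i. r i \<oplus> s i) c = dot r c \<oplus> dot s c" using D by (intro dot_add) (auto simp: vec_def)
  then show "dot (\<lambda>i. r i \<oplus> s i) c = \<zero>" using D by simp
  fix v x assume v: "v \<in> rel_rows" and x: "x \<in> I"
  have *: "v \<in> vec" "x \<in> carrier R" using v x by (auto simp: rel_rows_vec I_carrier)
  let ?w = "transvect x c r v"
  have "row_equiv v ?w" using realizedD(4)[OF assms(1)] v x by auto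
  then have w: "?w \<in> rel_rows" "row_equiv v (transvect x c s ?w)"
    using row_equiv_trans realizedD(4)[OF assms(2)] row_equiv_rel_rows x by blast+
  have "dot ?w c = dot v c" using D * by (simp add: dot_transvect dot_vec)
  then have "transvect x c s ?w = transvect x c (\<lambda>i. r i \<oplus> s i) v"
    using D * dot_vec[of v c] unfolding transvect_def
    by (auto simp: vec_def Pi_def r_distr a_assoc intro!: restrict_ext)
  then show "row_equiv v (transvect x c (\<lambda>i. r i \<oplus> s i) v)" using w by simp
qed

lemma realized_add_left:
  assumes "realized c r" "realized b r"
  shows "realized (\<lambda>i. c i \<oplus> b i) r"
  unfolding realized_def
proof (intro conjI ballI)
  note D = realizedD(1-3)[OF assms(1)] realizedD(1-3)[OF assms(2)]
  show "r \<in> vec" "(\<lambda>i. c i \<oplus> b i) \<in> vec" using D by (auto simp: vec_def)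
  have add: "dot v (\<lambda>i. c i \<oplus> b i) = dot v c \<oplus> dot v b" if "v \<in> vec" for v
  proof -
    have "dot v (\<lambda>i. c i \<oplus> b i) = dot (\<lambda>i. c i \<oplus> b i) v"
      using D that by (intro dot_comm) (auto simp: vec_def)
    also have "\<dots> = dot c v \<oplus> dot b v" using D that by (intro dot_add) (auto simp: vec_def)
    also have "\<dots> = dot v c \<oplus> dot v b" using D that by (simp add: dot_comm vec_def)
    finally show ?thesis .
  qed
  then show "dot r (\<lambda>i. c i \<oplus> b i) = \<zero>" using D by simp
  fix v x assume v: "v \<in> rel_rows" and x: "x \<in> I"
  have *: "v \<in> vec" "x \<in> carrier R" using v x by (auto simp: rel_rows_vec I_carrier)
  let ?w = "transvect x c r v"
  have "row_equiv v ?w" using realizedD(4)[OF assms(1)] v x by auto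
  then have w: "?w \<in> rel_rows" "row_equiv v (transvect x b r ?w)"
    using row_equiv_trans realizedD(4)[OF assms(2)] row_equiv_rel_rows x by blast+
  have "dot ?w b = dot v b" using D * by (simp add: dot_transvect dot_vec)
  then have "transvect x b r ?w = transvect x (\<lambda>i. c i \<oplus> b i) r v"
    using D * dot_vec[of v c] dot_vec[of v b] add[of v] unfolding transvect_def
    by (auto simp: vec_def Pi_def r_distr l_distr a_assoc intro!: restrict_ext)
  then show "row_equiv v (transvect x (\<lambda>i. c i \<oplus> b i) r v)" using w by simp
qed

lemma realized_smult_right:
  assumes "realized c r" "a \<in> carrier R"
  shows "realized c (\<lambda>i. a \<otimes> r i)"
  unfolding realized_def
proof (intro conjI ballI)
  note D = realizedD(1-3)[OF assms(1)]
  show "c \<in> vec" "(\<lambda>i. a \<otimes> r i) \<in> vec" using D assms by (auto simp: vec_def)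
  have "dot (\<lambda>i. a \<otimes> r i) c = a \<otimes> dot r c" using D assms by (intro dot_smult) (auto simp: vec_def)
  then show "dot (\<lambda>i. a \<otimes> r i) c = \<zero>" using D assms by simp
  fix v x assume v: "v \<in> rel_rows" and x: "x \<in> I"
  have *: "v \<in> vec" "x \<in> carrier R" using v x by (auto simp: rel_rows_vec I_carrier)
  have "x \<otimes> d \<otimes> (a \<otimes> y) = x \<otimes> a \<otimes> d \<otimes> y" if "d \<in> carrier R" "y \<in> carrier R" for d y
    using that * assms(2) by algebra
  then have "transvect x c (\<lambda>i. a \<otimes> r i) v = transvect (x \<otimes> a) c r v"
    using D * dot_vec[of v c] unfolding transvect_def
    by (auto simp: vec_def Pi_def intro!: restrict_ext)
  then show "row_equiv v (transvect x c (\<lambda>i. a \<otimes> r i) v)"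
    using realizedD(4)[OF assms(1) v] I_r_closed[OF x assms(2)] by simp
qed

lemma transvect_trivial:
  assumes "v \<in> rel_rows" "x \<in> carrier R" "c \<in> vec" "dot v c = \<zero> \<or> (\<forall>i\<in>{1..n}. r i = \<zero>)" "r \<in> vec"
  shows "transvect x c r v = v"
proof (rule rows_eqI)
  show "transvect x c r v \<in> rows n R" "v \<in> rows n R"
    using assms by (auto simp: rel_rowsD intro: transvect_closed)
  fix i assume "i \<in> {1..n}"
  then show "transvect x c r v i = v i"
    using assms dot_vec[of v c] vec_carrier[of r i] rel_rows_carrier[of v i] by (auto simp: transvect_def rel_rows_vec)
qed

lemma realized_zero_right:
  assumes "c \<in> vec"
  shows "realized c (\<lambda>i. \<zero>)"
proof -
  have "dot (\<lambda>i. \<zero>) c = (\<Oplus>i\<in>{1..n}. \<zero>)"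
    unfolding dot_def using assms by (intro finsum_cong') (auto simp: vec_def Pi_def)
  then have "dot (\<lambda>i. \<zero>) c = \<zero>" by (simp add: finsum_zero)
  then show ?thesis
    using assms transvect_trivial[of _ _ c "\<lambda>i. \<zero>"]
    by (auto simp: realized_def vec_def I_carrier intro: row_equiv.refl)
qed

lemma realized_zero_left:
  assumes "r \<in> vec"
  shows "realized (\<lambda>i. \<zero>) r"
proof -
  have d: "dot v (\<lambda>i. \<zero>) = \<zero>" if "v \<in> vec" for v
  proof -
    have "dot v (\<lambda>i. \<zero>) = (\<Oplus>i\<in>{1..n}. \<zero>)"
      unfolding dot_def using that by (intro finsum_cong') (auto simp: vec_def Pi_def)
    then show ?thesis by (simp add: finsum_zero)
  qed
  then show ?thesis
    using assms transvect_trivial[of _ _ "\<lambda>i. \<zero>" r]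
    by (auto simp: realized_def vec_def I_carrier rel_rows_carrier intro: row_equiv.refl)
qed

lemma realized_cong:
  assumes "realized c r" "\<And>i. i \<in> {1..n} \<Longrightarrow> c i = c' i" "\<And>i. i \<in> {1..n} \<Longrightarrow> r i = r' i"
  shows "realized c' r'"
proof -
  note D = realizedD(1-3)[OF assms(1)]
  have v: "c' \<in> vec" "r' \<in> vec"
    using D(1,2) assms(2,3) by (auto simp: vec_def Pi_def)
  have *: "dot v c' = dot v c" if "v \<in> vec" for v
    using assms v that D by (intro dot_cong) (auto simp: vec_def)
  have "dot r' c = dot r c"
    using assms v D by (intro dot_cong) (auto simp: vec_def)
  moreover have "transvect x c' r' v = transvect x c r v" if "v \<in> vec" for x v
    using * that assms(3) unfolding transvect_def by (auto intro!: restrict_ext)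
  ultimately show ?thesis using assms(1) v * by (auto simp: realized_def rel_rows_vec)
qed

lemma realized_finsum_right:
  assumes "finite F" "c \<in> vec" "\<And>a. a \<in> F \<Longrightarrow> realized c (f a)"
  shows "realized c (\<lambda>i. \<Oplus>a\<in>F. f a i)"
  using assms
proof (induction F rule: finite_induct)
  case empty
  then show ?case by (simp add: finsum_empty realized_zero_right)
next
  case (insert b F)
  have "f a i \<in> carrier R" if "a \<in> insert b F" "i \<in> {1..n}" for a i
    using realizedD(2)[OF insert.prems(2)[OF that(1)]] that by (auto simp: vec_def)
  then have sum: "(\<Oplus>a\<in>insert b F. f a i) = f b i \<oplus> (\<Oplus>a\<in>F. f a i)" if "i \<in> {1..n}" for i
    using insert that by (intro finsum_insert) auto
  show ?case
    by (rule realized_cong[OF realized_add_right[of c "f b" "\<lambda>i. \<Oplus>a\<in>F. f a i"]]) (use insert sum in auto)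
qed

lemma realized_finsum_left:
  assumes "finite F" "r \<in> vec" "\<And>a. a \<in> F \<Longrightarrow> realized (f a) r"
  shows "realized (\<lambda>i. \<Oplus>a\<in>F. f a i) r"
  using assms
proof (induction F rule: finite_induct)
  case empty
  then show ?case by (simp add: finsum_empty realized_zero_left)
next
  case (insert b F)
  have "f a i \<in> carrier R" if "a \<in> insert b F" "i \<in> {1..n}" for a i
    using realizedD(1)[OF insert.prems(2)[OF that(1)]] that by (auto simp: vec_def)
  then have sum: "(\<Oplus>a\<in>insert b F. f a i) = f b i \<oplus> (\<Oplus>a\<in>F. f a i)" if "i \<in> {1..n}" for i
    using insert that by (intro finsum_insert) auto
  show ?case
    by (rule realized_cong[OF realized_add_left[of "f b" r "\<lambda>i. \<Oplus>a\<in>F. f a i"]]) (use insert sum in auto)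
qed

text \<open>The row \<open>c\<^sub>j e\<^sub>i - c\<^sub>i e\<^sub>j\<close>, which is orthogonal to \<open>c\<close>.\<close>

definition koszul :: "(nat \<Rightarrow> 'a) \<Rightarrow> nat \<Rightarrow> nat \<Rightarrow> nat \<Rightarrow> 'a" where
  "koszul c i j = (\<lambda>k. (if k = i then c j else \<zero>) \<ominus> (if k = j then c i else \<zero>))"

lemma koszul_vec: "c \<in> vec \<Longrightarrow> i \<in> {1..n} \<Longrightarrow> j \<in> {1..n} \<Longrightarrow> koszul c i j \<in> vec"
  by (auto simp: vec_def koszul_def Pi_def)

lemma dot_koszul:
  assumes "c \<in> vec" "b \<in> vec" "i \<in> {1..n}" "j \<in> {1..n}"
  shows "dot (koszul c i j) b = c j \<otimes> b i \<ominus> c i \<otimes> b j"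
proof -
  let ?f = "\<lambda>k. if k = i then c j else \<zero>" and ?g = "\<lambda>k. if k = j then \<ominus> c i else \<zero>"
  have "dot (koszul c i j) b = dot (\<lambda>k. ?f k \<oplus> ?g k) b"
    using assms by (intro dot_cong) (auto simp: koszul_def vec_def a_minus_def Pi_def)
  also have "\<dots> = dot ?f b \<oplus> dot ?g b" using assms by (intro dot_add) (auto simp: vec_def Pi_def)
  also have "\<dots> = c j \<otimes> b i \<oplus> (\<ominus> c i) \<otimes> b j"
    using assms by (subst (1 2) dot_unit) (auto simp: vec_def Pi_def)
  finally show ?thesis using assms vec_carrier[of c i] vec_carrier[of b j] by (simp add: a_minus_def l_minus)
qed

text \<open>The commutator of a row operation from \<open>i, j\<close> to \<open>k\<close> with one from \<open>k\<close> to \<open>i, j\<close>, when the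
  composite \<open>k \<rightarrow> k\<close> vanishes.\<close>

lemma row_equiv_commutator:
  assumes v: "v \<in> rel_rows" and ijk: "i \<in> {1..n}" "j \<in> {1..n}" "k \<in> {1..n}" "i \<noteq> j" "j \<noteq> k" "i \<noteq> k"
    and coeffs: "\<alpha> \<in> carrier R" "\<beta> \<in> carrier R" "\<gamma> \<in> carrier R" "\<delta> \<in> carrier R"
    and ok: "i \<ge> 2 \<or> \<alpha> \<in> I" "j \<ge> 2 \<or> \<beta> \<in> I" "k \<ge> 2 \<or> \<gamma> \<in> I" "k \<ge> 2 \<or> \<delta> \<in> I"
    and zero: "\<gamma> \<otimes> \<alpha> \<oplus> \<delta> \<otimes> \<beta> = \<zero>"
  shows "row_equiv v (v(i := v i \<oplus> (v i \<otimes> \<alpha> \<oplus> v j \<otimes> \<beta>) \<otimes> \<gamma>, j := v j \<oplus> (v i \<otimes> \<alpha> \<oplus> v j \<otimes> \<beta>) \<otimes> \<delta>))"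
    (is "row_equiv v ?w")
proof -
  define v4 where "v4 = move k j \<delta> (move k i \<gamma> (move j k \<beta> (move i k \<alpha> v)))"
  define v8 where "v8 = move k j (\<ominus> \<delta>) (move k i (\<ominus> \<gamma>) (move j k (\<ominus> \<beta>) (move i k (\<ominus> \<alpha>) v4)))"
  have "row_equiv v v8"
    unfolding v8_def v4_def using v ijk coeffs ok
    by (intro row_equiv.step row_equiv.refl) (auto intro: I_minus)
  moreover have "v8 = ?w"
  proof -
    have c: "v i \<in> carrier R" "v j \<in> carrier R" "v k \<in> carrier R" using v ijk by (auto simp: rel_rows_carrier)
    define m where "m = v i \<otimes> \<alpha> \<oplus> v j \<otimes> \<beta>"
    have m: "m \<in> carrier R" using c coeffs by (simp add: m_def)
    have 1: "v k \<oplus> v i \<otimes> \<alpha> \<oplus> v j \<otimes> \<beta> = v k \<oplus> m" using c coeffs by (simp add: m_def a_assoc)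
    have "v k \<oplus> m \<oplus> (v i \<oplus> (v k \<oplus> m) \<otimes> \<gamma>) \<otimes> \<ominus> \<alpha> \<oplus> (v j \<oplus> (v k \<oplus> m) \<otimes> \<delta>) \<otimes> \<ominus> \<beta>
        = v k \<oplus> m \<ominus> (v i \<otimes> \<alpha> \<oplus> v j \<otimes> \<beta>) \<ominus> (v k \<oplus> m) \<otimes> (\<gamma> \<otimes> \<alpha> \<oplus> \<delta> \<otimes> \<beta>)"
      using c coeffs m by algebra
    also have "\<dots> = v k" using c m coeffs unfolding zero m_def[symmetric] by algebra
    finally have 2: "v k \<oplus> m \<oplus> (v i \<oplus> (v k \<oplus> m) \<otimes> \<gamma>) \<otimes> \<ominus> \<alpha> \<oplus> (v j \<oplus> (v k \<oplus> m) \<otimes> \<delta>) \<otimes> \<ominus> \<beta> = v k" .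
    have 3: "v i \<oplus> (v k \<oplus> m) \<otimes> \<gamma> \<oplus> v k \<otimes> \<ominus> \<gamma> = v i \<oplus> m \<otimes> \<gamma>"
      "v j \<oplus> (v k \<oplus> m) \<otimes> \<delta> \<oplus> v k \<otimes> \<ominus> \<delta> = v j \<oplus> m \<otimes> \<delta>"
      using c coeffs m by algebra+
    have a: "move j k \<beta> (move i k \<alpha> v) = v(k := v k \<oplus> m)"
      using ijk by (simp add: move_def 1)
    define p where "p = v i \<oplus> (v k \<oplus> m) \<otimes> \<gamma>"
    define q where "q = v j \<oplus> (v k \<oplus> m) \<otimes> \<delta>"
    have b: "v4 = v(k := v k \<oplus> m, i := p, j := q)"
      using ijk unfolding v4_def a by (simp add: move_def p_def q_def)
    have "move j k (\<ominus> \<beta>) (move i k (\<ominus> \<alpha>) v4) = v(i := p, j := q)"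
      using ijk 2 unfolding b p_def[symmetric] q_def[symmetric] by (auto simp: move_def)
    then show ?thesis
      using ijk 3 unfolding v8_def p_def[symmetric] q_def[symmetric] m_def[symmetric]
      by (auto simp: move_def)
  qed
  ultimately show ?thesis by simp
qed

text \<open>With \<open>c\<close> cut down to its entries at \<open>i\<close> and \<open>j\<close>, the transvection is the commutator of \<open>1 + c \<epsilon>\<close> and
  \<open>1 + \<epsilon>\<^sup>t r\<close>, where \<open>\<epsilon>\<close> is the unit row at a third index \<open>k\<close> and the scalar \<open>x \<in> I\<close> goes into one of the
  two factors.  If \<open>i = 1\<close>, adding a multiple of \<open>v\<^sub>1\<close> requires a coefficient in \<open>I\<close>, so \<open>x\<close> goes into the
  first factor.  If \<open>i, j \<ge> 2\<close>, take \<open>k = 1\<close> and put \<open>x\<close> into the second factor.\<close>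

lemma realized_two_nonfirst:
  fixes c :: "nat \<Rightarrow> 'a"
  assumes ij: "i \<in> {1..n}" "j \<in> {2..n}" "i \<noteq> j" and c: "c \<in> vec"
  shows "realized (\<lambda>k. if k = i \<or> k = j then c k else \<zero>) (koszul c i j)"
  unfolding realized_def
proof (intro conjI ballI)
  let ?c = "\<lambda>k. if k = i \<or> k = j then c k else \<zero>"
  have ij': "j \<in> {1..n}" using ij by auto
  show c': "?c \<in> vec" and k: "koszul c i j \<in> vec" using c ij ij' koszul_vec by (auto simp: vec_def)
  have cc: "c i \<in> carrier R" "c j \<in> carrier R" using c ij ij' by (auto simp: vec_carrier)
  have "c j \<otimes> c i \<ominus> c i \<otimes> c j = \<zero>" using cc by algebra
  then show "dot (koszul c i j) ?c = \<zero>" using dot_koszul[OF c c' ij(1) ij'] by simp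
  fix v x assume v: "v \<in> rel_rows" and x: "x \<in> I"
  have x': "x \<in> carrier R" using x by (rule I_carrier)
  have vc: "v i \<in> carrier R" "v j \<in> carrier R" using v ij ij' by (auto simp: rel_rows_carrier)
  let ?f = "\<lambda>k. if k = i then c i else \<zero>" and ?g = "\<lambda>k. if k = j then c j else \<zero>"
  have v': "v \<in> {1..n} \<rightarrow> carrier R" using v by (auto simp: rel_rows_carrier)
  have "dot v ?c = dot ?c v" using v' c' by (intro dot_comm) (auto simp: vec_def)
  also have "\<dots> = dot (\<lambda>k. ?f k \<oplus> ?g k) v"
    using ij cc v' by (intro dot_cong) auto
  also have "\<dots> = dot ?f v \<oplus> dot ?g v" using cc v' by (intro dot_add) auto
  also have "\<dots> = v i \<otimes> c i \<oplus> v j \<otimes> c j"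
    using v' cc ij ij' vc by (subst (1 2) dot_unit) (auto simp: m_comm)
  finally have d: "dot v ?c = v i \<otimes> c i \<oplus> v j \<otimes> c j" .
  let ?m = "v i \<otimes> c i \<oplus> v j \<otimes> c j"
  have t: "transvect x ?c (koszul c i j) v = v(i := v i \<oplus> x \<otimes> ?m \<otimes> c j, j := v j \<oplus> x \<otimes> ?m \<otimes> \<ominus> c i)"
  proof (rule rows_eqI)
    show "transvect x ?c (koszul c i j) v \<in> rows n R"
      using c' k x' v by (intro transvect_closed) (auto simp: rel_rowsD)
    show "v(i := v i \<oplus> x \<otimes> ?m \<otimes> c j, j := v j \<oplus> x \<otimes> ?m \<otimes> \<ominus> c i) \<in> rows n R"
      using ij ij' v vc cc x' by (intro rows_update) (auto simp: rel_rowsD)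
    fix k assume "k \<in> {1..n}"
    then show "transvect x ?c (koszul c i j) v k
        = (v(i := v i \<oplus> x \<otimes> ?m \<otimes> c j, j := v j \<oplus> x \<otimes> ?m \<otimes> \<ominus> c i)) k"
      using ij vc cc x' rel_rows_carrier[OF v, of k] unfolding transvect_def d koszul_def
      by (auto simp: a_minus_def)
  qed
  have xI: "x \<otimes> c i \<in> I" "x \<otimes> c j \<in> I" "x \<otimes> \<ominus> c i \<in> I" using x cc by (auto intro: I_r_closed)
  have "row_equiv v (v(i := v i \<oplus> x \<otimes> ?m \<otimes> c j, j := v j \<oplus> x \<otimes> ?m \<otimes> \<ominus> c i))"
  proof (cases "i = 1")
    case True
    define k :: nat where "k = (if j = 2 then 3 else 2)"
    have k: "k \<in> {2..n}" "k \<noteq> j" using n3 by (auto simp: k_def)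
    have "row_equiv v (v(i := v i \<oplus> (v i \<otimes> (x \<otimes> c i) \<oplus> v j \<otimes> (x \<otimes> c j)) \<otimes> c j,
        j := v j \<oplus> (v i \<otimes> (x \<otimes> c i) \<oplus> v j \<otimes> (x \<otimes> c j)) \<otimes> \<ominus> c i))"
    proof (rule row_equiv_commutator[of v i j k])
      show "c j \<otimes> (x \<otimes> c i) \<oplus> \<ominus> c i \<otimes> (x \<otimes> c j) = \<zero>" using cc x' by algebra
    qed (use True k xI ij ij' v x' cc in auto)
    moreover have "v i \<otimes> (x \<otimes> c i) \<oplus> v j \<otimes> (x \<otimes> c j) = x \<otimes> ?m" using cc x' vc by algebra
    ultimately show ?thesis by simp
  next
    case False
    have "row_equiv v (v(i := v i \<oplus> ?m \<otimes> (x \<otimes> c j), j := v j \<oplus> ?m \<otimes> (x \<otimes> \<ominus> c i)))"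
    proof (rule row_equiv_commutator[of v i j 1])
      show "x \<otimes> c j \<otimes> c i \<oplus> x \<otimes> \<ominus> c i \<otimes> c j = \<zero>" using cc x' by algebra
    qed (use False xI ij ij' v x' cc idx in auto)
    moreover have "?m \<otimes> (x \<otimes> c j) = x \<otimes> ?m \<otimes> c j" "?m \<otimes> (x \<otimes> \<ominus> c i) = x \<otimes> ?m \<otimes> \<ominus> c i"
      using cc x' vc by algebra+
    ultimately show ?thesis by simp
  qed
  then show "row_equiv v (transvect x ?c (koszul c i j) v)" using t by simp
qed

lemma koszul_antisym:
  assumes "c \<in> vec" "i \<in> {1..n}" "j \<in> {1..n}"
  shows "koszul c j i k = \<ominus> \<one> \<otimes> koszul c i j k"
proof -
  have neg: "b \<ominus> a = \<ominus> \<one> \<otimes> (a \<ominus> b)" if "a \<in> carrier R" "b \<in> carrier R" for a b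
    using that by algebra
  show ?thesis
    unfolding koszul_def by (rule neg) (use assms in \<open>auto simp: vec_carrier\<close>)
qed

lemma realized_two:
  assumes ij: "i \<in> {1..n}" "j \<in> {1..n}" "i \<noteq> j" and c: "c \<in> vec"
  shows "realized (\<lambda>k. if k = i \<or> k = j then c k else \<zero>) (koszul c i j)"
proof (cases "j = 1")
  case False
  then show ?thesis using realized_two_nonfirst[of i j c] assms by auto
next
  case True
  then have i: "i \<in> {2..n}" using ij by auto
  have "realized (\<lambda>k. if k = i \<or> k = j then c k else \<zero>) (\<lambda>k. \<ominus> \<one> \<otimes> koszul c j i k)"
    using realized_smult_right[OF realized_two_nonfirst[OF ij(2) i _ c], of "\<ominus> \<one>"] ij
    by (auto simp: disj_commute)
  then show ?thesis
  proof (rule realized_cong)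
    fix k
    show "\<ominus> \<one> \<otimes> koszul c j i k = koszul c i j k"
      using koszul_antisym[OF c ij(2,1), of k] by simp
  qed auto
qed

text \<open>An entry of \<open>c\<close> outside \<open>i, j\<close> contributes two additions with coefficients in \<open>I\<close>.\<close>

lemma realized_third:
  assumes ij: "i \<in> {1..n}" "j \<in> {1..n}" "i \<noteq> j" and c: "c \<in> vec"
    and l: "l \<in> {1..n}" "l \<noteq> i" "l \<noteq> j"
  shows "realized (\<lambda>k. if k = l then c l else \<zero>) (koszul c i j)"
  unfolding realized_def
proof (intro conjI ballI)
  let ?c = "\<lambda>k. if k = l then c l else \<zero>"
  show c': "?c \<in> vec" and k: "koszul c i j \<in> vec" using c ij l koszul_vec by (auto simp: vec_def)
  have cc: "c i \<in> carrier R" "c j \<in> carrier R" "c l \<in> carrier R" using c ij l by (auto simp: vec_carrier)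
  show "dot (koszul c i j) ?c = \<zero>" using dot_koszul[OF c c' ij(1,2)] l cc by (simp add: a_minus_def)
  fix v x assume v: "v \<in> rel_rows" and x: "x \<in> I"
  have x': "x \<in> carrier R" using x by (rule I_carrier)
  have vc: "v i \<in> carrier R" "v j \<in> carrier R" "v l \<in> carrier R" using v ij l by (auto simp: rel_rows_carrier)
  have v': "v \<in> {1..n} \<rightarrow> carrier R" using v by (auto simp: rel_rows_carrier)
  have "dot v ?c = dot ?c v" using v' c' by (intro dot_comm) (auto simp: vec_def)
  also have "\<dots> = c l \<otimes> v l" using v' cc l by (intro dot_unit) auto
  finally have d: "dot v ?c = c l \<otimes> v l" .
  let ?a = "x \<otimes> c l \<otimes> c j" and ?b = "x \<otimes> c l \<otimes> \<ominus> c i"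
  have ab: "?a \<in> I" "?b \<in> I" using x cc by (auto intro!: I_r_closed)
  then have ab': "?a \<in> carrier R" "?b \<in> carrier R" by (auto simp: I_carrier)
  have "row_equiv v (move l j ?b (move l i ?a v))"
    using v ij l ab ab' by (intro row_equiv.step row_equiv.refl) auto
  also have "move l j ?b (move l i ?a v) = transvect x ?c (koszul c i j) v"
  proof (rule rows_eqI)
    show "transvect x ?c (koszul c i j) v \<in> rows n R"
      using c' k x' v by (intro transvect_closed) (auto simp: rel_rowsD)
    show "move l j ?b (move l i ?a v) \<in> rows n R"
      using v ij l ab' by (intro move_closed) (auto simp: rel_rowsD)
    fix k assume k: "k \<in> {1..n}"
    have "v l \<otimes> ?a = x \<otimes> (c l \<otimes> v l) \<otimes> c j" "v l \<otimes> ?b = x \<otimes> (c l \<otimes> v l) \<otimes> \<ominus> c i"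
      using vc cc x' by algebra+
    then show "move l j ?b (move l i ?a v) k = transvect x ?c (koszul c i j) v k"
      using k ij l vc cc x' rel_rows_carrier[OF v, of k] unfolding transvect_def d koszul_def move_def
      by (auto simp: a_minus_def)
  qed
  finally show "row_equiv v (transvect x ?c (koszul c i j) v)" .
qed

lemma realized_koszul:
  assumes ij: "i \<in> {1..n}" "j \<in> {1..n}" and c: "c \<in> vec"
  shows "realized c (koszul c i j)"
proof (cases "i = j")
  case True
  have "realized c (\<lambda>i. \<zero>)" using c by (rule realized_zero_right)
  then show ?thesis
    by (rule realized_cong) (use True c ij vec_carrier[of c j] in \<open>auto simp: koszul_def a_minus_def r_neg\<close>)
next
  case False
  let ?S = "{1..n} - {i, j}"
  have "realized (\<lambda>k. \<Oplus>l\<in>?S. if k = l then c l else \<zero>) (koszul c i j)"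
    using realized_third[OF ij False c] koszul_vec[OF c ij] by (intro realized_finsum_left) auto
  from realized_add_left[OF realized_two[OF ij False c] this] show ?thesis
  proof (rule realized_cong)
    fix k assume k: "k \<in> {1..n}"
    have cc: "c l \<in> carrier R" if "l \<in> {1..n}" for l using that c by (simp add: vec_carrier)
    show "(if k = i \<or> k = j then c k else \<zero>) \<oplus> (\<Oplus>l\<in>?S. if k = l then c l else \<zero>) = c k"
    proof (cases "k \<in> ?S")
      case True
      then have "(\<Oplus>l\<in>?S. if k = l then c l else \<zero>) = c k"
        using cc by (intro finsum_singleton) auto
      then show ?thesis using True cc k by auto
    next
      case False
      then have "(\<Oplus>l\<in>?S. if k = l then c l else \<zero>) = (\<Oplus>l\<in>?S. \<zero>)"
        by (intro finsum_cong') auto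
      then show ?thesis using False cc k by (auto simp: finsum_zero)
    qed
  qed auto
qed

text \<open>Suslin: if \<open>d c = 1\<close> and \<open>r c = 0\<close>, then
  \<open>\<Sum>\<^sub>i\<^sub>j r\<^sub>i d\<^sub>j (c\<^sub>j e\<^sub>i - c\<^sub>i e\<^sub>j) = (d c) r - (r c) d = r\<close>.\<close>

lemma realized_orthogonal:
  assumes c: "c \<in> vec" and r: "r \<in> vec" and d: "d \<in> vec"
    and rc: "dot r c = \<zero>" and dc: "dot d c = \<one>"
  shows "realized c r"
proof -
  have "realized c (\<lambda>k. \<Oplus>i\<in>{1..n}. \<Oplus>j\<in>{1..n}. (r i \<otimes> d j) \<otimes> koszul c i j k)"
    using c r d by (intro realized_finsum_right realized_smult_right realized_koszul) (auto simp: vec_carrier)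
  then show ?thesis
  proof (rule realized_cong)
    fix k assume k: "k \<in> {1..n}"
    note C = vec_carrier[OF c] vec_carrier[OF r] vec_carrier[OF d]
    let ?f = "\<lambda>i. if k = i then r i else \<zero>"
    have "(\<Oplus>j\<in>{1..n}. (r i \<otimes> d j) \<otimes> koszul c i j k) = ?f i \<ominus> d k \<otimes> (r i \<otimes> c i)" if i: "i \<in> {1..n}" for i
    proof -
      let ?u = "if k = i then \<one> else \<zero>"
      have "(\<Oplus>j\<in>{1..n}. (r i \<otimes> d j) \<otimes> koszul c i j k)
          = (\<Oplus>j\<in>{1..n}. (?u \<otimes> r i) \<otimes> (d j \<otimes> c j) \<oplus> (if k = j then \<ominus> (d j \<otimes> (r i \<otimes> c i)) else \<zero>))"
      proof (intro finsum_cong' refl)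
        fix j assume j: "j \<in> {1..n}"
        show "(r i \<otimes> d j) \<otimes> koszul c i j k
            = (?u \<otimes> r i) \<otimes> (d j \<otimes> c j) \<oplus> (if k = j then \<ominus> (d j \<otimes> (r i \<otimes> c i)) else \<zero>)"
          using C[OF i] C[OF j] unfolding koszul_def by (auto; algebra)
      qed (use C i in auto)
      also have "\<dots> = (\<Oplus>j\<in>{1..n}. (?u \<otimes> r i) \<otimes> (d j \<otimes> c j))
          \<oplus> (\<Oplus>j\<in>{1..n}. if k = j then \<ominus> (d j \<otimes> (r i \<otimes> c i)) else \<zero>)"
        using C i by (intro finsum_addf) auto
      also have "(\<Oplus>j\<in>{1..n}. (?u \<otimes> r i) \<otimes> (d j \<otimes> c j)) = (?u \<otimes> r i) \<otimes> dot d c"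
        unfolding dot_def using C i by (subst finsum_rdistr) auto
      also have "(\<Oplus>j\<in>{1..n}. if k = j then \<ominus> (d j \<otimes> (r i \<otimes> c i)) else \<zero>) = \<ominus> (d k \<otimes> (r i \<otimes> c i))"
        using C i k by (intro finsum_singleton) auto
      finally show ?thesis using C i by (auto simp: dc a_minus_def)
    qed
    then have "(\<Oplus>i\<in>{1..n}. \<Oplus>j\<in>{1..n}. (r i \<otimes> d j) \<otimes> koszul c i j k)
        = (\<Oplus>i\<in>{1..n}. ?f i \<oplus> (\<ominus> d k) \<otimes> (r i \<otimes> c i))"
      using C k by (intro finsum_cong') (auto simp: a_minus_def l_minus)
    also have "\<dots> = (\<Oplus>i\<in>{1..n}. ?f i) \<oplus> (\<Oplus>i\<in>{1..n}. (\<ominus> d k) \<otimes> (r i \<otimes> c i))"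
      using C k by (intro finsum_addf) auto
    also have "(\<Oplus>i\<in>{1..n}. ?f i) = r k" using C k by (intro finsum_singleton) auto
    also have "(\<Oplus>i\<in>{1..n}. (\<ominus> d k) \<otimes> (r i \<otimes> c i)) = (\<ominus> d k) \<otimes> dot r c"
      unfolding dot_def using C k by (subst finsum_rdistr) auto
    finally show "(\<Oplus>i\<in>{1..n}. \<Oplus>j\<in>{1..n}. (r i \<otimes> d j) \<otimes> koszul c i j k) = r k"
      using C k by (simp add: rc)
  qed auto
qed

text \<open>The column and the row of the transvection are the second column of \<open>g\<close> and the first row of \<open>g\<^sup>-\<^sup>1\<close>.\<close>

lemma act_conj_el:
  assumes v: "v \<in> rows n R" and g: "g \<in> carrier GL" and x: "x \<in> carrier R"
  shows "v \<star> (g \<otimes>\<^bsub>GL\<^esub> el 2 1 x \<otimes>\<^bsub>GL\<^esub> inv\<^bsub>GL\<^esub> g)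
      = transvect x (\<lambda>k. g (k, 2)) (\<lambda>k. (inv\<^bsub>GL\<^esub> g) (1, k)) v"
proof -
  let ?h = "inv\<^bsub>GL\<^esub> g"
  let ?c = "\<lambda>k. g (k, 2)" and ?r = "\<lambda>k. ?h (1, k)"
  have M: "g \<in> carrier M" "?h \<in> carrier M" using g by (auto simp: GL_M)
  have cr: "?c \<in> vec" "?r \<in> vec" using M idx by (auto simp: vec_def M_entry)
  define u where "u = v \<star> g"
  have u: "u \<in> rows n R" using v M by (simp add: u_def act_closed)
  have u2: "u 2 = dot v ?c" using idx by (simp add: u_def act_entry)
  have uc: "u i \<in> carrier R" if "i \<in> {1..n}" for i using u that by (simp add: rows_carrier)
  have "v \<star> (g \<otimes>\<^bsub>GL\<^esub> el 2 1 x \<otimes>\<^bsub>GL\<^esub> ?h) = move 2 1 x u \<star> ?h"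
    using v g x idx u unfolding u_def
    by (simp add: act_mult el_GL act_GL_closed flip: act_el_move)
  also have "\<dots> = transvect x ?c ?r v"
  proof (rule rows_eqI)
    show "move 2 1 x u \<star> ?h \<in> rows n R" using u x M idx by (intro act_closed move_closed) auto
    show "transvect x ?c ?r v \<in> rows n R" using v cr x by (intro transvect_closed) auto
    fix j assume j: "j \<in> {1..n}"
    let ?w = "\<lambda>k. ?h (k, j)" and ?e = "\<lambda>k. if k = 1 then u 2 \<otimes> x else \<zero>"
    have w: "?w \<in> {1..n} \<rightarrow> carrier R" using M j by (auto simp: M_entry)
    have "(move 2 1 x u \<star> ?h) j = dot (\<lambda>k. u k \<oplus> ?e k) ?w"
      unfolding act_entry[OF j] using w uc x idx
      by (intro dot_cong) (auto simp: move_def)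
    also have "\<dots> = dot u ?w \<oplus> dot ?e ?w" using w uc x idx by (intro dot_add) auto
    also have "dot u ?w = v j"
      using act_inv(1)[OF v g] act_entry[OF j, of u ?h] by (simp add: u_def)
    also have "dot ?e ?w = u 2 \<otimes> x \<otimes> ?h (1, j)" using w uc x idx by (intro dot_unit) auto
    finally show "(move 2 1 x u \<star> ?h) j = transvect x ?c ?r v j"
      using j by (simp add: transvect_def m_comm[OF x uc[OF idx(2)]] flip: u2)
  qed
  finally show ?thesis .
qed

text \<open>The second row of \<open>g\<^sup>-\<^sup>1\<close> witnesses that the second column of \<open>g\<close> is unimodular, and
  \<open>g\<^sup>-\<^sup>1 g = 1\<close> makes the first row of \<open>g\<^sup>-\<^sup>1\<close> orthogonal to it.\<close>

lemma row_equiv_conj_el: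
  assumes g: "g \<in> carrier GL" and x: "x \<in> I" and v: "v \<in> rel_rows"
  shows "row_equiv v (v \<star> (g \<otimes>\<^bsub>GL\<^esub> el 2 1 x \<otimes>\<^bsub>GL\<^esub> inv\<^bsub>GL\<^esub> g))"
proof -
  let ?h = "inv\<^bsub>GL\<^esub> g"
  let ?c = "\<lambda>k. g (k, 2)" and ?r = "\<lambda>k. ?h (1, k)" and ?d = "\<lambda>k. ?h (2, k)"
  have M: "g \<in> carrier M" "?h \<in> carrier M" using g by (auto simp: GL_M)
  have hg: "?h \<otimes>\<^bsub>M\<^esub> g = \<one>\<^bsub>M\<^esub>" using g by (simp flip: GL_mult GL_one)
  have "realized ?c ?r"
  proof (rule realized_orthogonal)
    show "?c \<in> vec" "?r \<in> vec" "?d \<in> vec" using M idx by (auto simp: vec_def M_entry)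
    show "dot ?r ?c = \<zero>"
      using M_mult_entry[OF idx(1,2), of ?h g] idx unfolding hg by (simp add: mat_monoid_def)
    show "dot ?d ?c = \<one>"
      using M_mult_entry[OF idx(2,2), of ?h g] idx unfolding hg by (simp add: mat_monoid_def)
  qed
  then show ?thesis
    using act_conj_el[OF rel_rowsD[OF v] g I_carrier[OF x]] realizedD(4) v x by auto
qed

lemma EI_row_equiv:
  assumes "h \<in> EI" "v \<in> rel_rows"
  shows "row_equiv v (v \<star> h)"
proof -
  let ?Q = "{h \<in> carrier GL. \<forall>v\<in>rel_rows. row_equiv v (v \<star> h) \<and> row_equiv v (v \<star> inv\<^bsub>GL\<^esub> h)}"
  have "subgroup ?Q GL"
  proof (rule GL.subgroupI)
    show "?Q \<noteq> {}" using act_GL_one rel_rowsD row_equiv.refl by (auto intro!: exI[of _ "\<one>\<^bsub>GL\<^esub>"])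
  next
    fix h k assume hk: "h \<in> ?Q" "k \<in> ?Q"
    have "row_equiv v (v \<star> (h \<otimes>\<^bsub>GL\<^esub> k))" "row_equiv v (v \<star> inv\<^bsub>GL\<^esub> (h \<otimes>\<^bsub>GL\<^esub> k))" if v: "v \<in> rel_rows" for v
    proof -
      have "row_equiv v (v \<star> h \<star> k)" using hk v row_equiv_rel_rows row_equiv_trans by blast
      then show "row_equiv v (v \<star> (h \<otimes>\<^bsub>GL\<^esub> k))" using hk v rel_rowsD by (simp add: act_mult)
      have "row_equiv v (v \<star> inv\<^bsub>GL\<^esub> k \<star> inv\<^bsub>GL\<^esub> h)" using hk v row_equiv_rel_rows row_equiv_trans by blast
      then show "row_equiv v (v \<star> inv\<^bsub>GL\<^esub> (h \<otimes>\<^bsub>GL\<^esub> k))"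
        using hk v rel_rowsD by (simp add: act_mult GL.inv_mult_group)
    qed
    then show "h \<otimes>\<^bsub>GL\<^esub> k \<in> ?Q" using hk by auto
  qed auto
  moreover have "g \<otimes>\<^bsub>GL\<^esub> el 2 1 x \<otimes>\<^bsub>GL\<^esub> inv\<^bsub>GL\<^esub> g \<in> ?Q" if g: "g \<in> E" and x: "x \<in> I" for g x
  proof -
    have el: "el 2 1 x \<in> carrier GL" "x \<in> carrier R"
      using x idx by (auto intro!: el_GL I_carrier)
    have "inv\<^bsub>GL\<^esub> (g \<otimes>\<^bsub>GL\<^esub> el 2 1 x \<otimes>\<^bsub>GL\<^esub> inv\<^bsub>GL\<^esub> g) = g \<otimes>\<^bsub>GL\<^esub> el 2 1 (\<ominus> x) \<otimes>\<^bsub>GL\<^esub> inv\<^bsub>GL\<^esub> g"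
      using g el idx inv_el[of 2 1 x] by (simp add: GL.inv_mult_group GL.m_assoc E_GL el_GL)
    then show ?thesis
      using row_equiv_conj_el[OF E_GL[OF g]] x g el by (auto simp: E_GL I_minus)
  qed
  ultimately have "EI \<subseteq> ?Q" by (rule EI_subset_subgroup)
  then show ?thesis using assms by auto
qed

theorem cls_rel_eq_iff_row_equiv:
  assumes "v \<in> rel_rows" "w \<in> rel_rows"
  shows "cls_rel n R I v = cls_rel n R I w \<longleftrightarrow> row_equiv v w"
  using cls_rel_eq_iff[of v w] assms EI_row_equiv row_equiv_cls_rel rel_rowsD by metis

end

section \<open>Excision rings\<close>

lemma (in ring) add_pow_eq_mult: "x \<in> carrier R \<Longrightarrow> add_pow R (m :: int) x = add_pow R m \<one> \<otimes> x"
  by (simp add: add_pow_ldistr_int)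

lemma (in ring) add_pow_one_mult:
  "add_pow R (m * k :: int) \<one> = add_pow R m \<one> \<otimes> add_pow R k \<one>"
  using add.int_pow_pow[of \<one> m k] add_pow_eq_mult[of "add_pow R k \<one>" m] by (simp add: mult.commute)

locale cring_ideal = cring R + ideal I R
  for R :: "('a, 'm) ring_scheme" (structure) and I :: "'a set"
begin

lemma Ic: "x \<in> I \<Longrightarrow> x \<in> carrier R"
  by (rule a_Hcarr)

lemma add_pow_I: "x \<in> I \<Longrightarrow> add_pow R (m :: int) x \<in> I"
  by (subst add_pow_eq_mult) (auto intro: Ic I_l_closed)

lemma I_add: "x \<in> I \<Longrightarrow> y \<in> I \<Longrightarrow> x \<oplus> y \<in> I" by (rule a_closed)

lemmas I_intros = I_add a_inv_closed I_l_closed Ic zero_closed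

lemma excision_simps:
  "carrier (excision R I) = carrier R \<times> I" "\<one>\<^bsub>excision R I\<^esub> = (\<one>, \<zero>)"
  "\<zero>\<^bsub>excision R I\<^esub> = (\<zero>, \<zero>)"
  "(r, i) \<oplus>\<^bsub>excision R I\<^esub> (s, j) = (r \<oplus> s, i \<oplus> j)"
  "(r, i) \<otimes>\<^bsub>excision R I\<^esub> (s, j) = (r \<otimes> s, (r \<otimes> j) \<oplus> (s \<otimes> i) \<oplus> (i \<otimes> j))"
  by (auto simp: excision_def)

lemma int_excision_simps:
  "carrier (int_excision R I) = UNIV \<times> I" "\<one>\<^bsub>int_excision R I\<^esub> = (1, \<zero>)"
  "\<zero>\<^bsub>int_excision R I\<^esub> = (0, \<zero>)"
  "(m, i) \<oplus>\<^bsub>int_excision R I\<^esub> (k, j) = (m + k, i \<oplus> j)"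
  "(m, i) \<otimes>\<^bsub>int_excision R I\<^esub> (k, j) = (m * k, add_pow R m j \<oplus> add_pow R k i \<oplus> (i \<otimes> j))"
  by (auto simp: int_excision_def)

lemma excision_abelian: "abelian_group (excision R I)"
proof (rule abelian_groupI)
  fix x assume "x \<in> carrier (excision R I)"
  then show "\<exists>y\<in>carrier (excision R I). y \<oplus>\<^bsub>excision R I\<^esub> x = \<zero>\<^bsub>excision R I\<^esub>"
    by (intro bexI[of _ "(\<ominus> fst x, \<ominus> snd x)"])
      (auto simp: excision_simps Ic l_neg a_inv_closed split: prod.splits)
qed (auto simp: excision_simps I_add Ic a_ac zero_closed)

lemma excision_cring: "cring (excision R I)"
proof (rule cringI[OF excision_abelian])
  show "comm_monoid (excision R I)"
  proof (rule comm_monoidI)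
    fix x y z assume xyz: "x \<in> carrier (excision R I)" "y \<in> carrier (excision R I)" "z \<in> carrier (excision R I)"
    obtain r i s j t k where e: "x = (r, i)" "y = (s, j)" "z = (t, k)" by (metis surj_pair)
    have c: "r \<in> carrier R" "s \<in> carrier R" "t \<in> carrier R" "i \<in> I" "j \<in> I" "k \<in> I"
      using xyz by (auto simp: e excision_simps)
    note c' = c(1-3) c(4-6)[THEN Ic]
    show "x \<otimes>\<^bsub>excision R I\<^esub> y \<in> carrier (excision R I)"
      using c by (auto simp: e excision_simps intro!: I_intros)
    have "(s \<otimes> t) \<otimes> i \<oplus> r \<otimes> (s \<otimes> k \<oplus> t \<otimes> j \<oplus> j \<otimes> k) \<oplus> i \<otimes> (s \<otimes> k \<oplus> t \<otimes> j \<oplus> j \<otimes> k)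
      = t \<otimes> (r \<otimes> j \<oplus> s \<otimes> i \<oplus> i \<otimes> j) \<oplus> r \<otimes> s \<otimes> k \<oplus> (r \<otimes> j \<oplus> s \<otimes> i \<oplus> i \<otimes> j) \<otimes> k"
      using c' by algebra
    then show "(x \<otimes>\<^bsub>excision R I\<^esub> y) \<otimes>\<^bsub>excision R I\<^esub> z = x \<otimes>\<^bsub>excision R I\<^esub> (y \<otimes>\<^bsub>excision R I\<^esub> z)"
      using c' by (simp add: e excision_simps m_assoc a_comm)
    show "\<one>\<^bsub>excision R I\<^esub> \<otimes>\<^bsub>excision R I\<^esub> x = x" using c' by (simp add: e excision_simps)
    have "r \<otimes> j \<oplus> s \<otimes> i \<oplus> i \<otimes> j = s \<otimes> i \<oplus> r \<otimes> j \<oplus> j \<otimes> i" using c' by algebra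
    then show "x \<otimes>\<^bsub>excision R I\<^esub> y = y \<otimes>\<^bsub>excision R I\<^esub> x"
      using c' by (simp add: e excision_simps m_comm)
  qed (auto simp: excision_simps zero_closed)
  fix x y z assume xyz: "x \<in> carrier (excision R I)" "y \<in> carrier (excision R I)" "z \<in> carrier (excision R I)"
  obtain r i s j t k where e: "x = (r, i)" "y = (s, j)" "z = (t, k)" by (metis surj_pair)
  have c': "r \<in> carrier R" "s \<in> carrier R" "t \<in> carrier R" "i \<in> carrier R" "j \<in> carrier R" "k \<in> carrier R"
    using xyz by (auto simp: e excision_simps Ic)
  then show "(x \<oplus>\<^bsub>excision R I\<^esub> y) \<otimes>\<^bsub>excision R I\<^esub> z
      = x \<otimes>\<^bsub>excision R I\<^esub> z \<oplus>\<^bsub>excision R I\<^esub> y \<otimes>\<^bsub>excision R I\<^esub> z"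
    by (simp add: e excision_simps) algebra
qed

lemma int_excision_abelian: "abelian_group (int_excision R I)"
proof (rule abelian_groupI)
  fix x assume "x \<in> carrier (int_excision R I)"
  then show "\<exists>y\<in>carrier (int_excision R I). y \<oplus>\<^bsub>int_excision R I\<^esub> x = \<zero>\<^bsub>int_excision R I\<^esub>"
    by (intro bexI[of _ "(- fst x, \<ominus> snd x)"])
      (auto simp: int_excision_simps Ic l_neg a_inv_closed split: prod.splits)
qed (auto simp: int_excision_simps I_add Ic a_ac zero_closed)

text \<open>Writing the integer multiples as products with integer multiples of \<open>1\<close> turns the laws of \<open>\<int> \<oplus> I\<close> into
  identities in \<open>R\<close>.\<close>

lemma int_mult_eq:
  "i \<in> I \<Longrightarrow> j \<in> I \<Longrightarrow> (m, i) \<otimes>\<^bsub>int_excision R I\<^esub> (k, j)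
    = (m * k, (add_pow R m \<one> \<otimes> j) \<oplus> (add_pow R k \<one> \<otimes> i) \<oplus> (i \<otimes> j))"
  by (subst int_excision_simps, subst (1 2) add_pow_eq_mult) (auto simp: Ic)

lemma int_excision_cring: "cring (int_excision R I)"
proof (rule cringI[OF int_excision_abelian])
  have one: "add_pow R (1 :: int) \<one> = \<one>" by simp
  show "comm_monoid (int_excision R I)"
  proof (rule comm_monoidI)
    fix x y z
    assume xyz: "x \<in> carrier (int_excision R I)" "y \<in> carrier (int_excision R I)" "z \<in> carrier (int_excision R I)"
    obtain m i p j q k where e: "x = (m, i)" "y = (p, j)" "z = (q, k)" by (metis surj_pair)
    have c: "i \<in> I" "j \<in> I" "k \<in> I" using xyz by (auto simp: e int_excision_simps)
    define r s t where "r = add_pow R m \<one>" and "s = add_pow R p \<one>" and "t = add_pow R q \<one>"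
    have c': "r \<in> carrier R" "s \<in> carrier R" "t \<in> carrier R" "i \<in> carrier R" "j \<in> carrier R" "k \<in> carrier R"
      using c by (auto simp: r_def s_def t_def Ic)
    note mult = int_mult_eq add_pow_one_mult r_def[symmetric] s_def[symmetric] t_def[symmetric]
    show "x \<otimes>\<^bsub>int_excision R I\<^esub> y \<in> carrier (int_excision R I)"
      using c c' by (auto simp: e mult) (auto simp: int_excision_simps intro!: I_intros)
    have I: "r \<otimes> j \<oplus> s \<otimes> i \<oplus> i \<otimes> j \<in> I" "s \<otimes> k \<oplus> t \<otimes> j \<oplus> j \<otimes> k \<in> I"
      using c c' by (auto intro!: I_intros)
    have "(s \<otimes> t) \<otimes> i \<oplus> r \<otimes> (s \<otimes> k \<oplus> t \<otimes> j \<oplus> j \<otimes> k) \<oplus> i \<otimes> (s \<otimes> k \<oplus> t \<otimes> j \<oplus> j \<otimes> k)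
      = t \<otimes> (r \<otimes> j \<oplus> s \<otimes> i \<oplus> i \<otimes> j) \<oplus> r \<otimes> s \<otimes> k \<oplus> (r \<otimes> j \<oplus> s \<otimes> i \<oplus> i \<otimes> j) \<otimes> k"
      using c' by algebra
    then show "(x \<otimes>\<^bsub>int_excision R I\<^esub> y) \<otimes>\<^bsub>int_excision R I\<^esub> z
        = x \<otimes>\<^bsub>int_excision R I\<^esub> (y \<otimes>\<^bsub>int_excision R I\<^esub> z)"
      using c' I c by (simp add: e mult mult.assoc a_comm)
    show "\<one>\<^bsub>int_excision R I\<^esub> \<otimes>\<^bsub>int_excision R I\<^esub> x = x"
      using c c' one by (simp add: e int_excision_simps(2) mult zero_closed)
    have "r \<otimes> j \<oplus> s \<otimes> i \<oplus> i \<otimes> j = s \<otimes> i \<oplus> r \<otimes> j \<oplus> j \<otimes> i" using c' by algebra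
    then show "x \<otimes>\<^bsub>int_excision R I\<^esub> y = y \<otimes>\<^bsub>int_excision R I\<^esub> x"
      using c by (simp add: e mult mult.commute)
  qed (auto simp: int_excision_simps zero_closed)
  fix x y z
  assume xyz: "x \<in> carrier (int_excision R I)" "y \<in> carrier (int_excision R I)" "z \<in> carrier (int_excision R I)"
  obtain m i p j q k where e: "x = (m, i)" "y = (p, j)" "z = (q, k)" by (metis surj_pair)
  have c: "i \<in> I" "j \<in> I" "k \<in> I" using xyz by (auto simp: e int_excision_simps)
  define r s t where "r = add_pow R m \<one>" and "s = add_pow R p \<one>" and "t = add_pow R q \<one>"
  have c': "r \<in> carrier R" "s \<in> carrier R" "t \<in> carrier R" "i \<in> carrier R" "j \<in> carrier R" "k \<in> carrier R"
    using c by (auto simp: r_def s_def t_def Ic)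
  have "add_pow R (m + p) \<one> = r \<oplus> s" by (simp add: r_def s_def add.int_pow_mult)
  moreover have "(r \<oplus> s) \<otimes> k \<oplus> t \<otimes> (i \<oplus> j) \<oplus> (i \<oplus> j) \<otimes> k
      = (r \<otimes> k \<oplus> t \<otimes> i \<oplus> i \<otimes> k) \<oplus> (s \<otimes> k \<oplus> t \<otimes> j \<oplus> j \<otimes> k)"
    using c' by algebra
  ultimately show "(x \<oplus>\<^bsub>int_excision R I\<^esub> y) \<otimes>\<^bsub>int_excision R I\<^esub> z
      = x \<otimes>\<^bsub>int_excision R I\<^esub> z \<oplus>\<^bsub>int_excision R I\<^esub> y \<otimes>\<^bsub>int_excision R I\<^esub> z"
    using c by (simp add: e int_mult_eq int_excision_simps(4) I_add r_def[symmetric] s_def[symmetric]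
        t_def[symmetric] distrib_right)
qed

lemma exc_ideal_ideal: "ideal (exc_ideal R I) (excision R I)"
proof -
  interpret X: cring "excision R I" by (rule excision_cring)
  have neg: "\<ominus>\<^bsub>excision R I\<^esub> (\<zero>, i) = (\<zero>, \<ominus> i)" if "i \<in> I" for i
    using that by (intro X.minus_equality) (auto simp: excision_simps Ic l_neg a_inv_closed)
  show ?thesis
  proof (rule idealI)
    show "ring (excision R I)" by (rule X.ring_axioms)
    show "subgroup (exc_ideal R I) (add_monoid (excision R I))"
      by (rule X.add.subgroupI) (auto simp: exc_ideal_def excision_simps neg intro!: I_intros)
  qed (auto simp: exc_ideal_def excision_simps intro!: I_intros)
qed

lemma int_exc_ideal_ideal: "ideal (int_exc_ideal I) (int_excision R I)"
proof -
  interpret X: cring "int_excision R I" by (rule int_excision_cring)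
  have neg: "\<ominus>\<^bsub>int_excision R I\<^esub> (0, i) = (0, \<ominus> i)" if "i \<in> I" for i
    using that by (intro X.minus_equality) (auto simp: int_excision_simps Ic l_neg a_inv_closed)
  show ?thesis
  proof (rule idealI)
    show "ring (int_excision R I)" by (rule X.ring_axioms)
    show "subgroup (int_exc_ideal I) (add_monoid (int_excision R I))"
      by (rule X.add.subgroupI) (auto simp: int_exc_ideal_def int_excision_simps neg intro!: I_intros)
  qed (auto simp: int_exc_ideal_def int_excision_simps intro!: I_intros add_pow_I)
qed

lemma pi2_hom: "pi2 R \<in> ring_hom (excision R I) R"
proof (rule ring_hom_memI)
  fix x y assume xy: "x \<in> carrier (excision R I)" "y \<in> carrier (excision R I)"
  obtain r i s j where e: "x = (r, i)" "y = (s, j)" by (metis surj_pair)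
  have c: "r \<in> carrier R" "s \<in> carrier R" "i \<in> carrier R" "j \<in> carrier R"
    using xy by (auto simp: e excision_simps Ic)
  show "pi2 R (x \<otimes>\<^bsub>excision R I\<^esub> y) = pi2 R x \<otimes> pi2 R y"
    using c unfolding e excision_simps pi2_def by (simp, algebra)
  show "pi2 R (x \<oplus>\<^bsub>excision R I\<^esub> y) = pi2 R x \<oplus> pi2 R y"
    using c unfolding e excision_simps pi2_def by (simp, algebra)
qed (auto simp: excision_simps pi2_def Ic)

lemma int_eval_hom: "int_eval R \<in> ring_hom (int_excision R I) R"
proof (rule ring_hom_memI)
  fix x y assume xy: "x \<in> carrier (int_excision R I)" "y \<in> carrier (int_excision R I)"
  obtain m i p j where e: "x = (m, i)" "y = (p, j)" by (metis surj_pair)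
  have c: "i \<in> I" "j \<in> I" using xy by (auto simp: e int_excision_simps)
  define r s where "r = add_pow R m \<one>" and "s = add_pow R p \<one>"
  have c': "r \<in> carrier R" "s \<in> carrier R" "i \<in> carrier R" "j \<in> carrier R"
    using c by (auto simp: r_def s_def Ic)
  have "r \<otimes> s \<oplus> (r \<otimes> j \<oplus> s \<otimes> i \<oplus> i \<otimes> j) = (r \<oplus> i) \<otimes> (s \<oplus> j)" using c' by algebra
  then show "int_eval R (x \<otimes>\<^bsub>int_excision R I\<^esub> y) = int_eval R x \<otimes> int_eval R y"
    using c by (simp add: e int_mult_eq int_eval_def add_pow_one_mult r_def s_def)
  have "r \<oplus> s \<oplus> (i \<oplus> j) = (r \<oplus> i) \<oplus> (s \<oplus> j)" using c' by algebra
  then show "int_eval R (x \<oplus>\<^bsub>int_excision R I\<^esub> y) = int_eval R x \<oplus> int_eval R y"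
    by (simp add: e int_excision_simps int_eval_def r_def s_def add.int_pow_mult)
qed (auto simp: int_excision_simps int_eval_def Ic)

lemma fst_hom: "fst \<in> ring_hom (int_excision R I) \<Z>"
  by (rule ring_hom_memI) (auto simp: int_excision_def split: prod.splits)

lemma int_incl_hom: "(\<lambda>m. (m, \<zero>)) \<in> ring_hom \<Z> (int_excision R I)"
  by (rule ring_hom_memI) (auto simp: int_excision_simps zero_closed)

lemma add_pow_excision:
  "i \<in> I \<Longrightarrow> add_pow (excision R I) (m :: int) (\<zero>, i) = (\<zero>, add_pow R m i)"
proof -
  assume i: "i \<in> I"
  interpret X: cring "excision R I" by (rule excision_cring)
  have hom: "fst \<in> hom (add_monoid (excision R I)) (add_monoid R)"
    "snd \<in> hom (add_monoid (excision R I)) (add_monoid R)"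
    by (auto simp: hom_def excision_def Ic)
  interpret f: group_hom "add_monoid (excision R I)" "add_monoid R" fst
    by unfold_locales (rule hom)
  interpret s: group_hom "add_monoid (excision R I)" "add_monoid R" snd
    by unfold_locales (rule hom)
  have "(\<zero>, i) \<in> carrier (add_monoid (excision R I))" using i by (simp add: excision_simps)
  from f.hom_int_pow[OF this, of m, folded add_pow_def] s.hom_int_pow[OF this, of m, folded add_pow_def]
  show ?thesis by (simp add: prod_eq_iff)
qed

lemma exc_cring_ideal: "cring_ideal (excision R I) (exc_ideal R I)"
  by (intro cring_ideal.intro excision_cring exc_ideal_ideal)

lemma int_exc_cring_ideal: "cring_ideal (int_excision R I) (int_exc_ideal I)"
  by (intro cring_ideal.intro int_excision_cring int_exc_ideal_ideal)

text \<open>The ring \<open>\<int> \<oplus> (0 \<oplus> I)\<close>.\<close>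

abbreviation Z2 where "Z2 \<equiv> int_excision (excision R I) (exc_ideal R I)"

lemma Z2_carrier: "carrier Z2 = UNIV \<times> ({\<zero>} \<times> I)"
  by (simp add: int_excision_def exc_ideal_def)

lemma drop_zero_hom: "drop_zero \<in> ring_hom Z2 (int_excision R I)"
proof (rule ring_hom_memI)
  interpret X: cring_ideal "excision R I" "exc_ideal R I" by (rule exc_cring_ideal)
  fix x y assume xy: "x \<in> carrier Z2" "y \<in> carrier Z2"
  then obtain m i k j where e: "x = (m, (\<zero>, i))" "y = (k, (\<zero>, j))" "i \<in> I" "j \<in> I"
    by (auto simp: Z2_carrier)
  show "drop_zero x \<in> carrier (int_excision R I)"
    using e by (simp add: drop_zero_def int_excision_simps)
  show "drop_zero (x \<otimes>\<^bsub>Z2\<^esub> y) = drop_zero x \<otimes>\<^bsub>int_excision R I\<^esub> drop_zero y"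
    using e by (simp add: drop_zero_def int_excision_simps X.int_excision_simps add_pow_excision
        excision_simps Ic add_pow_I)
  show "drop_zero (x \<oplus>\<^bsub>Z2\<^esub> y) = drop_zero x \<oplus>\<^bsub>int_excision R I\<^esub> drop_zero y"
    using e by (simp add: drop_zero_def int_excision_simps X.int_excision_simps excision_simps)
next
  interpret X: cring_ideal "excision R I" "exc_ideal R I" by (rule exc_cring_ideal)
  show "drop_zero \<one>\<^bsub>Z2\<^esub> = \<one>\<^bsub>int_excision R I\<^esub>"
    by (simp add: drop_zero_def int_excision_simps X.int_excision_simps excision_simps)
qed

definition put_zero :: "int \<times> 'a \<Rightarrow> int \<times> ('a \<times> 'a)" where
  "put_zero = (\<lambda>(m, i). (m, (\<zero>, i)))"

lemma put_zero_hom: "put_zero \<in> ring_hom (int_excision R I) Z2"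
proof (rule ring_hom_memI)
  interpret X: cring_ideal "excision R I" "exc_ideal R I" by (rule exc_cring_ideal)
  fix x y assume xy: "x \<in> carrier (int_excision R I)" "y \<in> carrier (int_excision R I)"
  then obtain m i k j where e: "x = (m, i)" "y = (k, j)" "i \<in> I" "j \<in> I"
    by (auto simp: int_excision_simps)
  show "put_zero x \<in> carrier Z2"
    using e by (simp add: put_zero_def Z2_carrier)
  show "put_zero (x \<otimes>\<^bsub>int_excision R I\<^esub> y) = put_zero x \<otimes>\<^bsub>Z2\<^esub> put_zero y"
    using e by (simp add: put_zero_def int_excision_simps X.int_excision_simps add_pow_excision
        excision_simps Ic add_pow_I)
  show "put_zero (x \<oplus>\<^bsub>int_excision R I\<^esub> y) = put_zero x \<oplus>\<^bsub>Z2\<^esub> put_zero y"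
    using e by (simp add: put_zero_def int_excision_simps X.int_excision_simps excision_simps)
next
  interpret X: cring_ideal "excision R I" "exc_ideal R I" by (rule exc_cring_ideal)
  show "put_zero \<one>\<^bsub>int_excision R I\<^esub> = \<one>\<^bsub>Z2\<^esub>"
    by (simp add: put_zero_def int_excision_simps X.int_excision_simps excision_simps)
qed

lemma drop_put_zero:
  "x \<in> carrier Z2 \<Longrightarrow> put_zero (drop_zero x) = x" "drop_zero (put_zero y) = y"
  by (auto simp: put_zero_def drop_zero_def int_excision_def exc_ideal_def split: prod.splits)

text \<open>Both composites send \<open>(m, (0, i))\<close> to \<open>m + i\<close>.\<close>

lemma pi2_int_eval:
  assumes "x \<in> carrier Z2"
  shows "pi2 R (int_eval (excision R I) x) = int_eval R (drop_zero x)"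
proof -
  interpret X: cring_ideal "excision R I" "exc_ideal R I" by (rule exc_cring_ideal)
  obtain m i where e: "x = (m, (\<zero>, i))" "i \<in> I"
    using assms by (auto simp: Z2_carrier)
  interpret h: ring_hom_cring "excision R I" R "pi2 R"
    using pi2_hom by unfold_locales
  have hom: "pi2 R \<in> hom (add_monoid (excision R I)) (add_monoid R)"
    using pi2_hom by (auto simp: hom_def ring_hom_def)
  interpret g: group_hom "add_monoid (excision R I)" "add_monoid R" "pi2 R"
    by unfold_locales (rule hom)
  have one: "\<one>\<^bsub>excision R I\<^esub> \<in> carrier (add_monoid (excision R I))" by simp
  have "pi2 R (add_pow (excision R I) m \<one>\<^bsub>excision R I\<^esub>) = add_pow R m (pi2 R \<one>\<^bsub>excision R I\<^esub>)"
    using g.hom_int_pow[OF one, of m] by (simp add: add_pow_def)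
  moreover have "pi2 R (\<zero>, i) = i" "(\<zero>, i) \<in> carrier (excision R I)"
    using e by (auto simp: pi2_def Ic excision_simps)
  ultimately show ?thesis
    by (simp add: e int_eval_def drop_zero_def)
qed

end

section \<open>Functoriality\<close>

locale matrix_hom = R: matrix_ring R n + S: matrix_ring S n
  for R :: "('a, 'm) ring_scheme" and S :: "('b, 'k) ring_scheme" and n :: nat +
  fixes f :: "'a \<Rightarrow> 'b"
  assumes f_hom: "f \<in> ring_hom R S"
begin

sublocale h: ring_hom_cring R S f
  using f_hom by unfold_locales

definition mapm :: "(nat \<times> nat \<Rightarrow> 'a) \<Rightarrow> nat \<times> nat \<Rightarrow> 'b" where
  "mapm A = (\<lambda>p\<in>{1..n} \<times> {1..n}. f (A p))"

abbreviation mapr where "mapr \<equiv> map_row n f"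

lemma mapr_rows: "v \<in> rows n R \<Longrightarrow> mapr v \<in> rows n S"
  by (auto simp: rows_def map_row_def)

lemma mapm_M: "A \<in> carrier R.M \<Longrightarrow> mapm A \<in> carrier S.M"
  by (auto simp: R.carrier_M S.carrier_M mapm_def)

lemma f_dot:
  assumes "v \<in> {1..n} \<rightarrow> carrier R" "w \<in> {1..n} \<rightarrow> carrier R"
  shows "f (R.dot v w) = S.dot (\<lambda>i. f (v i)) (\<lambda>i. f (w i))"
proof -
  have "f (R.dot v w) = (\<Oplus>\<^bsub>S\<^esub>i\<in>{1..n}. (f \<circ> (\<lambda>i. v i \<otimes>\<^bsub>R\<^esub> w i)) i)"
    unfolding R.dot_def using assms by (intro h.hom_finsum) (auto simp: Pi_def)
  also have "\<dots> = S.dot (\<lambda>i. f (v i)) (\<lambda>i. f (w i))"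
    unfolding S.dot_def using assms by (intro S.finsum_cong') (auto simp: Pi_def)
  finally show ?thesis .
qed

lemma mapr_act:
  assumes "v \<in> rows n R" "A \<in> carrier R.M"
  shows "mapr (R.act v A) = S.act (mapr v) (mapm A)"
proof (rule rows_eqI)
  show "mapr (R.act v A) \<in> rows n S" "S.act (mapr v) (mapm A) \<in> rows n S"
    using assms by (auto intro!: mapr_rows R.act_closed S.act_closed mapm_M)
  fix j assume j: "j \<in> {1..n}"
  have "mapr (R.act v A) j = f (R.dot v (\<lambda>k. A (k, j)))"
    using j by (simp add: map_row_def R.act_entry)
  also have "\<dots> = S.dot (\<lambda>k. f (v k)) (\<lambda>k. f (A (k, j)))"
    using assms j by (intro f_dot) (auto simp: rows_carrier R.M_entry)
  also have "\<dots> = S.dot (mapr v) (\<lambda>k. mapm A (k, j))"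
    using assms j
    by (intro S.dot_cong) (auto simp: rows_carrier R.M_entry map_row_def mapm_def)
  finally show "mapr (R.act v A) j = S.act (mapr v) (mapm A) j"
    using j by (simp add: S.act_entry)
qed

lemma mapm_mult:
  assumes "A \<in> carrier R.M" "B \<in> carrier R.M"
  shows "mapm (A \<otimes>\<^bsub>R.M\<^esub> B) = mapm A \<otimes>\<^bsub>S.M\<^esub> mapm B"
proof (rule S.M_eqI)
  show "mapm (A \<otimes>\<^bsub>R.M\<^esub> B) \<in> carrier S.M" "mapm A \<otimes>\<^bsub>S.M\<^esub> mapm B \<in> carrier S.M"
    using assms by (auto intro!: mapm_M R.M_mult_closed S.M_mult_closed)
  fix i j assume ij: "i \<in> {1..n}" "j \<in> {1..n}"
  have "mapm (A \<otimes>\<^bsub>R.M\<^esub> B) (i, j) = f (R.dot (\<lambda>k. A (i, k)) (\<lambda>k. B (k, j)))"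
    using ij by (simp add: mapm_def R.M_mult_entry)
  also have "\<dots> = S.dot (\<lambda>k. f (A (i, k))) (\<lambda>k. f (B (k, j)))"
    using assms ij by (intro f_dot) (auto simp: R.M_entry)
  also have "\<dots> = S.dot (\<lambda>k. mapm A (i, k)) (\<lambda>k. mapm B (k, j))"
    using assms ij by (intro S.dot_cong) (auto simp: R.M_entry mapm_def)
  finally show "mapm (A \<otimes>\<^bsub>R.M\<^esub> B) (i, j) = (mapm A \<otimes>\<^bsub>S.M\<^esub> mapm B) (i, j)"
    using ij by (simp add: S.M_mult_entry)
qed

lemma mapm_one: "mapm \<one>\<^bsub>R.M\<^esub> = \<one>\<^bsub>S.M\<^esub>"
  by (rule S.M_eqI[OF mapm_M[OF R.M_one_closed] S.M_one_closed])
    (auto simp: mapm_def mat_monoid_def)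

lemma mapm_GL:
  assumes "A \<in> carrier R.GL"
  shows "mapm A \<in> carrier S.GL"
proof -
  obtain B where B: "A \<in> carrier R.M" "B \<in> carrier R.M"
      "B \<otimes>\<^bsub>R.M\<^esub> A = \<one>\<^bsub>R.M\<^esub>" "A \<otimes>\<^bsub>R.M\<^esub> B = \<one>\<^bsub>R.M\<^esub>"
    using assms by (auto simp: GL_grp_def units_of_def Units_def)
  then have "mapm B \<otimes>\<^bsub>S.M\<^esub> mapm A = \<one>\<^bsub>S.M\<^esub>" "mapm A \<otimes>\<^bsub>S.M\<^esub> mapm B = \<one>\<^bsub>S.M\<^esub>"
    by (simp_all add: mapm_one flip: mapm_mult)
  then show ?thesis
    using B mapm_M by (auto simp: GL_grp_def units_of_def Units_def)
qed

sublocale g: group_hom R.GL S.GL mapm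
  by unfold_locales (auto simp: hom_def mapm_GL R.GL_mult S.GL_mult mapm_mult R.GL_M)

lemma mapm_el:
  "x \<in> carrier R \<Longrightarrow> mapm (R.el i j x) = S.el i j (f x)"
  by (auto simp: mapm_def elem_mat_def)

lemma mapm_E: "A \<in> R.E \<Longrightarrow> mapm A \<in> S.E"
proof (induction rule: R.E_induct)
  case one
  then show ?case using S.E_one by simp
next
  case (mult A i j x)
  then show ?case
    using S.E_mult[OF mult.IH S.el_E[of i j "f x"]] R.E_GL R.el_GL by (simp add: mapm_el)
qed

lemma mapr_cls:
  assumes "v \<in> rows n R" "A \<in> R.E"
  shows "cls n S (mapr (R.act v A)) = cls n S (mapr v)"
  using assms by (simp add: mapr_act R.GL_M R.E_GL S.cls_act mapr_rows mapm_E)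

lemma mapr_Um:
  assumes "v \<in> Um n R"
  shows "mapr v \<in> Um n S"
proof -
  obtain w where w: "v \<in> rows n R" "w \<in> rows n R" "R.dot v w = \<one>\<^bsub>R\<^esub>"
    using assms by (auto simp: Um_def R.dot_def)
  have "S.dot (mapr v) (mapr w) = S.dot (\<lambda>i. f (v i)) (\<lambda>i. f (w i))"
    using w by (intro S.dot_cong) (auto simp: map_row_def rows_carrier)
  also have "\<dots> = \<one>\<^bsub>S\<^esub>"
    using w f_dot[of v w] by (simp add: rows_carrier)
  finally show ?thesis using w mapr_rows by (auto simp: Um_def S.dot_def)
qed

end

locale relative_hom = R: relative_ring R n I + S: relative_ring S n J
  for R :: "('a, 'm) ring_scheme" and S :: "('b, 'k) ring_scheme" and n :: nat
    and I :: "'a set" and J :: "'b set" +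
  fixes f :: "'a \<Rightarrow> 'b"
  assumes f_hom: "f \<in> ring_hom R S" and f_ideal: "x \<in> I \<Longrightarrow> f x \<in> J"
begin

sublocale matrix_hom R S n f
  using f_hom by unfold_locales

lemma mapm_EI: "A \<in> R.EI \<Longrightarrow> mapm A \<in> S.EI"
proof -
  let ?Q = "{A \<in> carrier R.GL. mapm A \<in> S.EI}"
  have "R.EI \<subseteq> ?Q"
  proof (rule R.EI_subset_subgroup)
    show "subgroup ?Q R.GL"
      by (rule R.GL.subgroupI) (auto intro: S.EI_mult S.EI_inv exI[of _ "\<one>\<^bsub>R.GL\<^esub>"] simp: S.EI_one)
    fix g x assume g: "g \<in> R.E" and x: "x \<in> I"
    have el: "R.el 2 1 x \<in> carrier R.GL"
      using R.idx x by (intro R.el_GL) (auto simp: R.I_carrier)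
    have "mapm g \<otimes>\<^bsub>S.GL\<^esub> S.el 2 1 (f x) \<otimes>\<^bsub>S.GL\<^esub> inv\<^bsub>S.GL\<^esub> mapm g \<in> S.EI"
      using g x f_ideal by (intro S.EI_conj mapm_E S.el21_EI)
    then show "g \<otimes>\<^bsub>R.GL\<^esub> R.el 2 1 x \<otimes>\<^bsub>R.GL\<^esub> inv\<^bsub>R.GL\<^esub> g \<in> ?Q"
      using g x el by (simp add: R.E_GL mapm_el R.I_carrier)
  qed
  then show "A \<in> R.EI \<Longrightarrow> mapm A \<in> S.EI" by auto
qed

lemma mapr_cls_rel:
  assumes "v \<in> rows n R" "A \<in> R.EI"
  shows "cls_rel n S J (mapr (R.act v A)) = cls_rel n S J (mapr v)"
  using assms by (simp add: mapr_act R.GL_M R.EI_GL S.cls_rel_act mapr_rows mapm_EI)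

lemma mapr_rel_rows:
  assumes "v \<in> R.rel_rows"
  shows "mapr v \<in> S.rel_rows"
proof -
  have "v i \<in> carrier R" if "i \<in> {1..n}" for i using assms that by (rule R.rel_rows_carrier)
  then have "f (v 1 \<ominus>\<^bsub>R\<^esub> \<one>\<^bsub>R\<^esub>) = f (v 1) \<ominus>\<^bsub>S\<^esub> \<one>\<^bsub>S\<^esub>"
    using R.idx by (simp add: R.minus_eq S.minus_eq)
  then show ?thesis
    using assms R.idx f_ideal mapr_rows[of v] unfolding R.rel_rows_iff S.rel_rows_iff by (force simp: map_row_def)
qed

lemma mapr_Um_rel: "v \<in> Um_rel n R I \<Longrightarrow> mapr v \<in> Um_rel n S J"
  unfolding R.Um_rel_eq S.Um_rel_eq using mapr_Um mapr_rel_rows by auto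

end

lemma induced_map_eq:
  assumes "C \<noteq> {}" "\<And>v. v \<in> C \<Longrightarrow> q (f v) = D"
  shows "induced_map q f C = D"
proof -
  have "(\<lambda>v. q (f v)) ` C = {D}" using assms by auto
  then show ?thesis by (simp add: induced_map_def)
qed

lemma (in matrix_hom) induced_cls:
  assumes "v \<in> rows n R"
  shows "induced_map (cls n S) mapr (cls n R v) = cls n S (mapr v)"
  using R.E_one mapr_cls[OF assms] by (intro induced_map_eq) (auto simp: cls_def)

lemma (in relative_hom) induced_cls_rel:
  assumes "v \<in> rows n R"
  shows "induced_map (cls_rel n S J) mapr (cls_rel n R I v) = cls_rel n S J (mapr v)"
  using R.EI_one mapr_cls_rel[OF assms] by (intro induced_map_eq) (auto simp: cls_rel_def[of n R])

lemma (in relative_ring) induced_cls_rel_cls: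
  assumes "v \<in> rows n R"
  shows "induced_map (cls n R) (\<lambda>v. v) (cls_rel n R I v) = cls n R v"
  using EI_one cls_act[OF assms] EI_E by (intro induced_map_eq) (auto simp: cls_rel_def)

section \<open>Integer matrices fixing the first unit row\<close>

locale int_matrices = matrix_ring \<Z> n for n :: nat
begin

notation act (infixl \<open>\<star>\<close> 70)

lemma carrier_Z: "x \<in> carrier \<Z>" by simp

lemma dot_sum: "dot v w = (\<Sum>i\<in>{1..n}. v i * w i)"
  unfolding dot_def int_finsum_eq by simp

text \<open>The group generated by the \<open>E\<^sub>i\<^sub>j(m)\<close> with \<open>i \<in> S\<close> and \<open>j\<close> arbitrary.  It fixes \<open>e\<^sub>l\<close> for every
  \<open>l \<notin> S\<close>, so rows that have already been reduced are not disturbed.\<close>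

definition gens :: "nat set \<Rightarrow> (nat \<times> nat \<Rightarrow> int) set" where
  "gens S = generate GL {el i j m | i j m. i \<in> S \<and> j \<in> {1..n} \<and> i \<noteq> j}"

lemma gens_subset_GL: "S \<subseteq> {1..n} \<Longrightarrow> {el i j m | i j m. i \<in> S \<and> j \<in> {1..n} \<and> i \<noteq> j} \<subseteq> carrier GL"
  by (blast intro: el_GL carrier_Z)

lemma gens_subgroup: "S \<subseteq> {1..n} \<Longrightarrow> subgroup (gens S) GL"
  unfolding gens_def by (intro GL.generate_is_subgroup gens_subset_GL)

lemma gens_mono: "S \<subseteq> T \<Longrightarrow> gens S \<subseteq> gens T"
  unfolding gens_def by (intro GL.mono_generate) auto

lemma gens_E: "S \<subseteq> {1..n} \<Longrightarrow> gens S \<subseteq> E"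
  unfolding gens_def by (rule GL.generate_subgroup_incl[OF _ E_subgroup]) (blast intro: el_E carrier_Z)

lemma el_gens: "i \<in> S \<Longrightarrow> j \<in> {1..n} \<Longrightarrow> i \<noteq> j \<Longrightarrow> el i j m \<in> gens S"
  unfolding gens_def by (rule generate.incl) auto

definition reach :: "nat set \<Rightarrow> (nat \<Rightarrow> int) \<Rightarrow> (nat \<Rightarrow> int) \<Rightarrow> bool" where
  "reach S r r' \<longleftrightarrow> (\<exists>A\<in>gens S. r' = r \<star> A)"

lemma reach_refl: "S \<subseteq> {1..n} \<Longrightarrow> r \<in> rows n \<Z> \<Longrightarrow> reach S r r"
  unfolding reach_def using gens_subgroup[of S] subgroup.one_closed act_GL_one by metis

lemma reach_trans:
  assumes "S \<subseteq> {1..n}" "r \<in> rows n \<Z>" "reach S r r'" "reach S r' r''"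
  shows "reach S r r''"
proof -
  interpret S: subgroup "gens S" GL by (rule gens_subgroup[OF assms(1)])
  obtain A B where "A \<in> gens S" "B \<in> gens S" "r' = r \<star> A" "r'' = r' \<star> B"
    using assms by (auto simp: reach_def)
  then show ?thesis
    unfolding reach_def using assms by (intro bexI[of _ "A \<otimes>\<^bsub>GL\<^esub> B"]) (auto simp: act_mult)
qed

lemma reach_rows: "S \<subseteq> {1..n} \<Longrightarrow> r \<in> rows n \<Z> \<Longrightarrow> reach S r r' \<Longrightarrow> r' \<in> rows n \<Z>"
  unfolding reach_def using gens_E E_GL act_GL_closed by blast

lemma reach_move:
  assumes "S \<subseteq> {1..n}" "r \<in> rows n \<Z>" "i \<in> S" "j \<in> {1..n}" "i \<noteq> j"
  shows "reach S r (r(j := r j + r i * m))"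
proof -
  have "r \<star> el i j m = r(j := r j \<oplus>\<^bsub>\<Z>\<^esub> r i \<otimes>\<^bsub>\<Z>\<^esub> m)"
    using assms by (intro act_el) auto
  then show ?thesis
    unfolding reach_def using el_gens[of i S j m] assms by (intro bexI[of _ "el i j m"]) auto
qed

lemma reach_update:
  assumes "S \<subseteq> {1..n}" "r \<in> rows n \<Z>" "i \<in> S" "j \<in> {1..n}" "i \<noteq> j" "x = r j + r i * m"
  shows "reach S r (r(j := x))"
  using reach_move[OF assms(1-5)] assms(6) by simp

lemma rows_Z_update: "r \<in> rows n \<Z> \<Longrightarrow> j \<in> {1..n} \<Longrightarrow> r(j := x) \<in> rows n \<Z>"
  by (intro rows_update carrier_Z)

text \<open>The Euclidean algorithm: as long as two entries with index in \<open>S\<close> are nonzero, the larger one can be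
  decreased by the smaller one.  At the end a single entry \<open>\<plusminus>1\<close> remains.  If it is not at \<open>s\<close>, one step puts a
  \<open>1\<close> there; if it is at \<open>s\<close> with the wrong sign, the second index \<open>t\<close> is used to correct the sign.\<close>

lemma euclid:
  assumes S: "S \<subseteq> {1..n}" and st: "s \<in> S" "t \<in> S" "s \<noteq> t"
  shows "r \<in> rows n \<Z> \<Longrightarrow> (\<And>d. (\<forall>i\<in>S. d dvd r i) \<Longrightarrow> is_unit d) \<Longrightarrow> \<exists>r'. reach S r r' \<and> r' s = 1"
proof (induction "\<Sum>i\<in>S. nat \<bar>r i\<bar>" arbitrary: r rule: less_induct)
  case less
  note r = less.prems(1) and coprime = less.prems(2)
  have fin: "finite S" using S finite_subset by auto
  have S': "i \<in> {1..n}" if "i \<in> S" for i using S that by auto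
  show ?case
  proof (cases "\<exists>i\<in>S. \<exists>j\<in>S. i \<noteq> j \<and> r i \<noteq> 0 \<and> r j \<noteq> 0")
    case True
    then obtain i j where ij: "i \<in> S" "j \<in> S" "i \<noteq> j" "r i \<noteq> 0" "r j \<noteq> 0" "\<bar>r i\<bar> \<le> \<bar>r j\<bar>"
      by (metis linorder_linear)
    \<comment> \<open>with this sign, \<open>\<bar>r j + r i * m\<bar> = \<bar>r j\<bar> - \<bar>r i\<bar>\<close>\<close>
    define m where "m = - sgn (r i) * sgn (r j)"
    define x where "x = r j + r i * m"
    have x: "\<bar>x\<bar> < \<bar>r j\<bar>"
      using ij(4-6) by (auto simp: x_def m_def sgn_if)
    let ?r = "r(j := x)"
    have reach: "reach S r ?r" using reach_update[OF S r ij(1) _ ij(3)] ij S' by (simp add: x_def)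
    have "(\<Sum>i\<in>S. nat \<bar>?r i\<bar>) < (\<Sum>i\<in>S. nat \<bar>r i\<bar>)"
      by (rule sum_strict_mono_ex1[OF fin]) (use x ij in \<open>auto intro!: bexI[of _ j]\<close>)
    moreover have "?r \<in> rows n \<Z>" using r ij S' by (intro rows_Z_update) auto
    moreover have "is_unit d" if d: "\<forall>i\<in>S. d dvd ?r i" for d
    proof (rule coprime, rule ballI)
      fix k assume k: "k \<in> S"
      have "d dvd x" "d dvd r i" using d ij by (auto dest: bspec[of _ _ j] bspec[of _ _ i])
      then have "d dvd r j" by (simp add: x_def dvd_add_left_iff)
      then show "d dvd r k" using d k by (cases "k = j") auto
    qed
    ultimately obtain r' where "reach S ?r r'" "r' s = 1" using less.hyps by blast
    then show ?thesis using reach_trans[OF S r reach] by blast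
  next
    case False
    have "\<exists>q\<in>S. r q \<noteq> 0"
    proof (rule ccontr)
      assume "\<not> ?thesis"
      then have "is_unit (0::int)" by (intro coprime) auto
      then show False by simp
    qed
    then obtain q where q: "q \<in> S" "r q \<noteq> 0" by auto
    then have zero: "r i = 0" if "i \<in> S" "i \<noteq> q" for i using False that by auto
    have "is_unit (r q)"
    proof (rule coprime, rule ballI)
      fix i assume "i \<in> S"
      then show "r q dvd r i" using zero by (cases "i = q") auto
    qed
    then have rq: "r q = 1 \<or> r q = - 1" by auto
    show ?thesis
    proof (cases "q = s")
      case False
      then have "reach S r (r(s := 1))"
        using rq zero[of s] st S' by (intro reach_update[OF S r q(1), of s _ "r q"]) auto
      then show ?thesis by auto
    next
      case True
      show ?thesis
      proof (cases "r s = 1")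
        case True
        then show ?thesis using reach_refl[OF S r] by blast
      next
        case False
        then have rs: "r s = - 1" "r t = 0" using rq zero st True by auto
        \<comment> \<open>\<open>(-1, 0) \<mapsto> (-1, -1) \<mapsto> (1, -1)\<close> in the coordinates \<open>s, t\<close>\<close>
        let ?r = "r(t := - 1)"
        have r1: "reach S r ?r"
          using st rs S' by (intro reach_update[OF S r st(1), of t _ 1]) auto
        have "?r \<in> rows n \<Z>" using r st S' by (intro rows_Z_update) auto
        then have "reach S ?r (?r(s := 1))"
          using st rs S' by (intro reach_update[OF S _ st(2), of _ s _ "- 2"]) auto
        then have "reach S r (?r(s := 1))" using reach_trans[OF S r r1] by blast
        then show ?thesis by auto
      qed
    qed
  qed
qed

lemma clear:
  assumes S: "S \<subseteq> {1..n}" and s: "s \<in> S" and r: "r \<in> rows n \<Z>" "r s = 1"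
  shows "reach S r (unit_row s)"
proof -
  have "reach S r (\<lambda>i. if i \<in> T then 0 else r i)" if "finite T" "T \<subseteq> {1..n} - {s}" for T
    using that
  proof (induction T rule: finite_induct)
    case empty
    then show ?case using reach_refl[OF S r(1)] by simp
  next
    case (insert j T)
    let ?r = "\<lambda>i. if i \<in> T then 0 else r i"
    have r': "reach S r ?r" using insert by auto
    have "?r s = 1" using insert.prems r by auto
    then have "reach S ?r (?r(j := 0))"
      using insert.prems s reach_rows[OF S r(1) r']
      by (intro reach_update[OF S _ s, of _ j _ "- ?r j"]) auto
    moreover have "?r(j := 0) = (\<lambda>i. if i \<in> insert j T then 0 else r i)" by auto
    ultimately show ?case using reach_trans[OF S r(1) r'] by simp
  qed
  from this[of "{1..n} - {s}"]
  have "reach S r (\<lambda>i. if i \<in> {1..n} - {s} then 0 else r i)" by simp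
  also have "(\<lambda>i. if i \<in> {1..n} - {s} then 0 else r i) = unit_row s"
    using r S s by (auto simp: unit_row_def rows_def fun_eq_iff)
  finally show ?thesis .
qed

lemma reduce_to_unit:
  assumes S: "S \<subseteq> {1..n}" and st: "s \<in> S" "t \<in> S" "s \<noteq> t" and r: "r \<in> rows n \<Z>"
    and coprime: "\<And>d. (\<forall>i\<in>S. d dvd r i) \<Longrightarrow> is_unit d"
  shows "reach S r (unit_row s)"
proof -
  obtain r' where r': "reach S r r'" "r' s = 1" using euclid[OF S st r coprime] by blast
  then show ?thesis using clear[OF S st(1) reach_rows[OF S r r'(1)]] reach_trans[OF S r] by blast
qed

lemma Um_coprime:
  assumes "v \<in> Um n \<Z>" "\<forall>i\<in>{1..n}. d dvd v i"
  shows "is_unit d"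
proof -
  obtain w where w: "(\<Sum>i\<in>{1..n}. v i * w i) = 1"
    using assms by (auto simp: Um_def int_finsum_eq)
  have "d dvd (\<Sum>i\<in>{1..n}. v i * w i)"
    using assms by (intro dvd_sum dvd_mult2) auto
  then show ?thesis unfolding w .
qed

lemma gens_fix:
  assumes S: "S \<subseteq> {1..n}" and l: "l \<in> {1..n}" "l \<notin> S" and A: "A \<in> gens S"
  shows "unit_row l \<star> A = unit_row l"
proof -
  let ?Q = "{A \<in> carrier GL. unit_row l \<star> A = unit_row l}"
  have "subgroup ?Q GL"
  proof (rule GL.subgroupI)
    show "?Q \<noteq> {}" using act_GL_one[OF unit_row_closed] by blast
    fix A assume A: "A \<in> ?Q"
    then have "unit_row l \<star> inv\<^bsub>GL\<^esub> A = unit_row l"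
      using act_inv(1)[OF unit_row_closed, of A l] by auto
    then show "inv\<^bsub>GL\<^esub> A \<in> ?Q" using A by simp
  qed (auto simp: act_mult unit_row_closed)
  moreover have "el i j m \<in> ?Q" if "i \<in> S" "j \<in> {1..n}" "i \<noteq> j" for i j m
  proof -
    have i: "i \<in> {1..n}" "i \<noteq> l" using that S l by auto
    have "unit_row l \<star> el i j m = (unit_row l)(j := unit_row l j \<oplus>\<^bsub>\<Z>\<^esub> unit_row l i \<otimes>\<^bsub>\<Z>\<^esub> m)"
      using that i by (intro act_el unit_row_closed carrier_Z) auto
    also have "\<dots> = unit_row l" using i that by (auto simp: unit_row_def fun_eq_iff)
    finally show ?thesis using el_GL[of i j m] i that by simp
  qed
  ultimately have "gens S \<subseteq> ?Q"
    unfolding gens_def by (intro GL.generate_subgroup_incl) blast+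
  then show ?thesis using A by auto
qed

text \<open>The same matrix with indices starting at \<open>0\<close>, for which determinants are available.\<close>

definition jnf :: "(nat \<times> nat \<Rightarrow> int) \<Rightarrow> int mat" where
  "jnf A = mat n n (\<lambda>(i, j). A (Suc i, Suc j))"

lemma jnf_closed: "jnf A \<in> carrier_mat n n"
  by (simp add: jnf_def)

lemma jnf_mult: "jnf (A \<otimes>\<^bsub>M\<^esub> B) = jnf A * jnf B"
proof (rule eq_matI)
  fix i j assume ij: "i < dim_row (jnf A * jnf B)" "j < dim_col (jnf A * jnf B)"
  then have ij': "i < n" "j < n" by (auto simp: jnf_def)
  have "jnf (A \<otimes>\<^bsub>M\<^esub> B) $$ (i, j) = (\<Sum>k\<in>{1..n}. A (Suc i, k) * B (k, Suc j))"
    using ij' M_mult_entry[of "Suc i" "Suc j" A B] by (simp add: jnf_def dot_sum)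
  also have "\<dots> = (\<Sum>k\<in>{0..<n}. A (Suc i, Suc k) * B (Suc k, Suc j))"
    by (rule sum.reindex_bij_witness[of _ Suc "\<lambda>k. k - 1"]) auto
  also have "\<dots> = (jnf A * jnf B) $$ (i, j)"
    using ij' by (simp add: jnf_def scalar_prod_def)
  finally show "jnf (A \<otimes>\<^bsub>M\<^esub> B) $$ (i, j) = (jnf A * jnf B) $$ (i, j)" .
qed (auto simp: jnf_def)

lemma det_E: "A \<in> E \<Longrightarrow> det (jnf A) = 1"
proof (induction rule: E_induct)
  case one
  have "jnf \<one>\<^bsub>M\<^esub> = 1\<^sub>m n" by (rule eq_matI) (auto simp: jnf_def mat_monoid_def)
  then show ?case by (simp add: GL_one)
next
  case (mult A i j x)
  have "jnf (el i j x) = addrow_mat n x (i - 1) (j - 1)"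
    by (rule eq_matI) (use mult in \<open>auto simp: jnf_def elem_mat_def\<close>)
  moreover have "i - 1 \<noteq> j - 1" using mult by auto
  ultimately have "det (jnf (el i j x)) = 1" using det_addrow_mat by simp
  then show ?case
    using mult det_mult[OF jnf_closed jnf_closed, of A "el i j x"] by (simp add: GL_mult jnf_mult)
qed

text \<open>An element of \<open>E\<^sub>n(\<int>)\<close> has determinant \<open>1\<close>, which excludes the diagonal matrix with last entry \<open>-1\<close>.\<close>

lemma last_diagonal_entry:
  assumes "A \<in> E" "n \<ge> 1" "\<And>l. l \<in> {1..<n} \<Longrightarrow> row A l = unit_row l"
  shows "A (n, n) = 1"
proof -
  have entry: "A (Suc i, Suc j) = (if i = j then 1 else 0)" if "i < n - 1" "j < n" for i j
    using fun_cong[OF assms(3)[of "Suc i"], of "Suc j"] that by (auto simp: row_def unit_row_def)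
  have "1 = det (jnf A)" using assms det_E by simp
  also have "\<dots> = prod_list (diag_mat (jnf A))"
  proof (rule det_lower_triangular)
    fix i j assume "i < j" "j < n"
    then show "jnf A $$ (i, j) = 0" using entry[of i j] by (simp add: jnf_def)
  qed (simp add: jnf_def)
  also have "\<dots> = (\<Prod>i = 0..<n. A (Suc i, Suc i))" by (simp add: prod_list_diag_prod jnf_def)
  also have "\<dots> = (\<Prod>i = 0..<n - 1. A (Suc i, Suc i)) * A (n, n)"
    using assms(2) prod.atLeast0_lessThan_Suc[of "\<lambda>i. A (Suc i, Suc i)" "n - 1"] by simp
  also have "(\<Prod>i = 0..<n - 1. A (Suc i, Suc i)) = 1"
    using entry by (intro prod.neutral) auto
  finally show ?thesis by simp
qed

text \<open>The matrix is reduced row by row.  If its first \<open>k\<close> rows are unit rows, the same holds for its inverse,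
  so the entries of row \<open>k + 1\<close> after the \<open>k\<close>-th are unimodular and column operations turn that row into a
  unit row.  For \<open>k = n - 1\<close> there is a single such entry, and the determinant shows that it is \<open>1\<close>.\<close>

lemma unit_rows_gens:
  assumes "A \<in> E" "1 \<le> k" "k \<le> n" "\<And>l. l \<in> {1..k} \<Longrightarrow> row A l = unit_row l"
  shows "A \<in> gens {2..n}"
  using assms
proof (induction "n - k" arbitrary: k A)
  case 0
  have kn: "k = n" using 0 by simp
  have A: "A \<in> carrier M" using 0(2) by (simp add: E_GL GL_M)
  have "row A l = unit_row l" if "l \<in> {1..n}" for l using 0(5) that unfolding kn .
  then have "A = \<one>\<^bsub>M\<^esub>"
    by (intro M_eqI_rows[OF A M_one_closed]) (simp only: row_one)
  then show ?case
    using subgroup.one_closed[OF gens_subgroup[of "{2..n}"]] by (simp add: GL_one)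
next
  case (Suc d)
  note A = Suc.prems(1)
  have A': "A \<in> carrier GL" "A \<in> carrier M" using A by (auto simp: E_GL GL_M)
  have kn: "k < n" using Suc.hyps(2) by simp
  define s where "s = Suc k"
  define S where "S = {s..n}"
  have s: "s \<in> S" "s \<in> {1..n}" "S \<subseteq> {1..n}" "S \<subseteq> {2..n}"
    using kn Suc.prems(2) by (auto simp: s_def S_def)
  have rA: "row A s \<in> rows n \<Z>" using A' s by (intro row_closed)
  have "reach S (row A s) (unit_row s)"
  proof (cases "s = n")
    case True
    have "row A l = unit_row l" if "l \<in> {1..<n}" for l
      using that True by (intro Suc.prems(4)) (auto simp: s_def)
    then have "A (n, n) = 1" using A Suc.prems by (intro last_diagonal_entry) auto
    then show ?thesis using clear[OF s(3,1) rA] True s by (simp add: row_def)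
  next
    case False
    let ?B = "inv\<^bsub>GL\<^esub> A"
    have B: "?B \<in> carrier M" using A' by (simp add: GL_M)
    have rB: "?B (l, s) = 0" if l: "l \<in> {1..k}" for l
    proof -
      have l': "l \<in> {1..n}" using l kn by auto
      have "row ?B l = unit_row l \<star> ?B" using B l' by (simp add: unit_row_act)
      also have "\<dots> = unit_row l \<star> A \<star> ?B"
        using Suc.prems(4)[OF l] unit_row_act[OF A'(2) l'] by simp
      also have "\<dots> = unit_row l" using A' by (simp add: act_inv unit_row_closed)
      finally have "row ?B l s = unit_row l s" by simp
      then show ?thesis using s l by (auto simp: row_def unit_row_def s_def)
    qed
    have coprime: "is_unit d" if d: "\<forall>i\<in>S. d dvd row A s i" for d
    proof -
      have "d dvd A (s, i) * ?B (i, s)" if i: "i \<in> {1..n}" for i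
      proof (cases "i \<in> S")
        case True
        then have "d dvd A (s, i)" using d i by (auto simp: row_def)
        then show ?thesis by simp
      next
        case False
        then have "i \<in> {1..k}" using i by (auto simp: S_def s_def)
        then show ?thesis using rB by simp
      qed
      then have "d dvd (\<Sum>i\<in>{1..n}. A (s, i) * ?B (i, s))" by (rule dvd_sum)
      also have "\<dots> = (A \<otimes>\<^bsub>M\<^esub> ?B) (s, s)" using M_mult_entry[of s s A ?B] s by (simp add: dot_sum)
      also have "A \<otimes>\<^bsub>M\<^esub> ?B = \<one>\<^bsub>M\<^esub>" using A' GL.r_inv[of A] by (simp add: GL_mult GL_one)
      also have "\<one>\<^bsub>M\<^esub> (s, s) = 1" using s by (simp add: mat_monoid_def)
      finally show ?thesis .
    qed
    have "Suc s \<in> S" using False kn by (auto simp: S_def s_def)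
    then show ?thesis by (rule reduce_to_unit[OF s(3,1) _ _ rA coprime]) auto
  qed
  then obtain C where C: "C \<in> gens S" "row A s \<star> C = unit_row s" by (auto simp: reach_def)
  have CE: "C \<in> E" "C \<in> carrier GL" "C \<in> carrier M" using C gens_E[OF s(3)] E_GL GL_M by auto
  have "row (A \<otimes>\<^bsub>GL\<^esub> C) l = unit_row l" if l: "l \<in> {1..s}" for l
  proof (cases "l = s")
    case True
    then show ?thesis using C CE A' s by (simp add: GL_mult row_mult_row)
  next
    case False
    then have l': "l \<in> {1..k}" "l \<in> {1..n}" "l \<notin> S" using l kn by (auto simp: s_def S_def)
    then show ?thesis
      using C CE A' Suc.prems(4)[OF l'(1)] gens_fix[OF s(3) l'(2,3)] by (simp add: GL_mult row_mult_row)
  qed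
  moreover have "d = n - s" using Suc.hyps(2) by (simp add: s_def)
  ultimately have AC: "A \<otimes>\<^bsub>GL\<^esub> C \<in> gens {2..n}"
    using Suc.hyps(1)[of s "A \<otimes>\<^bsub>GL\<^esub> C"] A CE kn E_mult by (auto simp: s_def)
  interpret P: subgroup "gens {2..n}" GL by (rule gens_subgroup) auto
  have "C \<in> gens {2..n}" using C gens_mono[OF s(4)] by auto
  then have "A \<otimes>\<^bsub>GL\<^esub> C \<otimes>\<^bsub>GL\<^esub> inv\<^bsub>GL\<^esub> C \<in> gens {2..n}" using AC by auto
  then show ?case using A' CE by (simp add: GL.m_assoc)
qed

end

section \<open>Unimodular rows\<close>

lemma (in matrix_ring) Um_act:
  assumes "v \<in> Um n R" "g \<in> E"
  shows "v \<star> g \<in> Um n R"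
proof -
  obtain w where w: "v \<in> rows n R" "w \<in> rows n R" "dot v w = \<one>"
    using assms by (auto simp: Um_def dot_def)
  let ?h = "inv\<^bsub>GL\<^esub> g"
  have g: "g \<in> carrier GL" "?h \<in> carrier M" using assms by (auto simp: E_GL GL_M)
  have wc: "w \<in> {1..n} \<rightarrow> carrier R" using w by (auto simp: rows_carrier)
  have vg: "v \<star> g \<in> rows n R" using w g by (simp add: act_GL_closed)
  have vgc: "v \<star> g \<in> {1..n} \<rightarrow> carrier R" using vg by (auto simp: rows_carrier)
  define u where "u = (\<lambda>k\<in>{1..n}. dot (\<lambda>j. ?h (k, j)) w)"
  have u: "u \<in> rows n R"
    using g wc by (auto simp: u_def rows_def M_entry intro!: dot_closed)
  have "dot (v \<star> g) u = dot (v \<star> g) (\<lambda>k. dot (\<lambda>j. ?h (k, j)) w)"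
    using vgc g wc by (intro dot_cong) (auto simp: u_def M_entry intro!: dot_closed)
  also have "\<dots> = dot (\<lambda>j. dot (v \<star> g) (\<lambda>k. ?h (k, j))) w"
    using dot_assoc[OF vgc g(2) wc] by simp
  also have "\<dots> = dot (v \<star> g \<star> ?h) w"
    using g wc rows_carrier[OF vg]
    by (intro dot_cong) (auto simp: act_entry[of _ "v \<star> g"] M_entry intro!: dot_closed)
  also have "\<dots> = \<one>" using w g by (simp add: act_inv)
  finally show ?thesis using u vg by (auto simp: Um_def dot_def)
qed

context relative_ring
begin

lemma finsum_I: "finite F \<Longrightarrow> (\<And>i. i \<in> F \<Longrightarrow> f i \<in> I) \<Longrightarrow> (\<Oplus>i\<in>F. f i) \<in> I"
proof (induction F rule: finite_induct)
  case empty
  then show ?case by (simp add: finsum_empty additive_subgroup.zero_closed)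
next
  case (insert x F)
  then show ?case by (subst finsum_insert) (auto intro: add_I I_carrier)
qed

text \<open>A row congruent to \<open>e\<^sub>1\<close> has a unimodularity witness congruent to \<open>e\<^sub>1\<close>: replace \<open>w\<close> by
  \<open>s w + w\<^sub>1 e\<^sub>1\<close> where \<open>s = 1 - v\<^sub>1 w\<^sub>1\<close> lies in \<open>I\<close>.\<close>

lemma Um_rel_witness:
  assumes "v \<in> Um_rel n R I"
  obtains w where "w \<in> rel_rows" "dot v w = \<one>"
proof -
  have v: "v \<in> rel_rows" using assms by (simp add: Um_rel_eq)
  obtain w where w: "w \<in> rows n R" "dot v w = \<one>"
    using assms by (auto simp: Um_rel_def Um_def dot_def)
  have vc: "v \<in> {1..n} \<rightarrow> carrier R" using v by (auto simp: rel_rows_carrier)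
  have wc: "w \<in> {1..n} \<rightarrow> carrier R" using w by (auto simp: rows_carrier)
  have c: "v 1 \<in> carrier R" "w 1 \<in> carrier R" using vc wc idx by auto
  define s where "s = \<one> \<ominus> v 1 \<otimes> w 1"
  define t where "t = (\<Oplus>i\<in>{2..n}. v i \<otimes> w i)"
  have tI: "t \<in> I"
    unfolding t_def using v wc by (intro finsum_I) (auto intro!: I_r_closed rel_rows_I[OF v])
  have "{1..n} = insert 1 {2..n}" using n3 by auto
  then have "\<one> = v 1 \<otimes> w 1 \<oplus> t"
    using w(2) vc wc c unfolding dot_def t_def by (simp add: finsum_insert Pi_def)
  then have "s = v 1 \<otimes> w 1 \<oplus> t \<ominus> v 1 \<otimes> w 1" by (simp add: s_def)
  also have "\<dots> = t" using c I_carrier[OF tI] by algebra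
  finally have s: "s \<in> I" "s \<in> carrier R" using tI I_carrier by auto
  let ?e = "\<lambda>k. if k = 1 then w 1 else \<zero>"
  define w' where "w' = (\<lambda>i\<in>{1..n}. s \<otimes> w i \<oplus> ?e i)"
  have "v 1 \<ominus> \<one> \<in> I" using v by (simp add: rel_rows_iff)
  then have "(v 1 \<ominus> \<one>) \<otimes> w 1 \<in> I" using c by (intro I_r_closed)
  then have "\<ominus> s \<oplus> \<ominus> ((v 1 \<ominus> \<one>) \<otimes> w 1) \<oplus> s \<otimes> w 1 \<in> I"
    using s c by (intro add_I I_minus) (auto intro: I_r_closed)
  also have "\<ominus> s \<oplus> \<ominus> ((v 1 \<ominus> \<one>) \<otimes> w 1) \<oplus> s \<otimes> w 1 = s \<otimes> w 1 \<oplus> w 1 \<ominus> \<one>"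
    unfolding s_def using c by algebra
  finally have "w' 1 \<ominus> \<one> \<in> I" using idx by (simp add: w'_def)
  moreover have "w' \<in> rows n R" using s wc c by (auto simp: w'_def rows_def Pi_def)
  moreover have "w' i \<in> I" if "i \<in> {2..n}" for i
    using that s wc by (auto simp: w'_def Pi_def intro!: I_r_closed)
  ultimately have "w' \<in> rel_rows" by (simp add: rel_rows_iff)
  moreover have "dot v w' = \<one>"
  proof -
    have w'c: "w' \<in> {1..n} \<rightarrow> carrier R" using \<open>w' \<in> rel_rows\<close> by (auto simp: rel_rows_carrier)
    have "dot v w' = dot w' v" using vc w'c by (rule dot_comm)
    also have "\<dots> = dot (\<lambda>i. s \<otimes> w i \<oplus> ?e i) v"
      using vc wc s c by (intro dot_cong) (auto simp: w'_def Pi_def)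
    also have "\<dots> = dot (\<lambda>i. s \<otimes> w i) v \<oplus> dot ?e v"
      using vc wc s c by (intro dot_add) (auto simp: Pi_def)
    also have "dot (\<lambda>i. s \<otimes> w i) v = s \<otimes> dot w v" using vc wc s by (intro dot_smult) auto
    also have "dot w v = \<one>" using w(2) dot_comm[OF wc vc] by simp
    also have "dot ?e v = w 1 \<otimes> v 1" using vc c idx by (intro dot_unit) auto
    also have "s \<otimes> \<one> \<oplus> w 1 \<otimes> v 1 = \<one>" unfolding s_def using c by algebra
    finally show ?thesis .
  qed
  ultimately show ?thesis by (rule that)
qed

end

section \<open>The excision theorem\<close>

locale excision_setup = cring_ideal R I for R :: "('a, 'm) ring_scheme" (structure) and I :: "'a set" +
  fixes n :: nat
  assumes n_ge_3: "n \<ge> 3"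
begin

abbreviation B where "B \<equiv> int_excision R I"
abbreviation J where "J \<equiv> int_exc_ideal I"

lemma int_eval_0: "x \<in> I \<Longrightarrow> int_eval R (0, x) = x"
  by (simp add: int_eval_def add_pow_int_ge Ic)

lemma int_eval_1: "int_eval R (1, x) = \<one> \<oplus> x"
  by (simp add: int_eval_def)

sublocale base: relative_ring R n I
  by unfold_locales (rule n_ge_3)

sublocale B: relative_ring B n J
proof -
  interpret c: cring_ideal B J by (rule int_exc_cring_ideal)
  show "relative_ring B n J" by unfold_locales (rule n_ge_3)
qed

sublocale Z: int_matrices n
  by (intro int_matrices.intro matrix_ring.intro int_is_cring)

sublocale e: relative_hom B R n J I "int_eval R"
  by (intro relative_hom.intro relative_hom_axioms.intro base.relative_ring_axioms B.relative_ring_axioms)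
    (auto simp: int_eval_hom int_exc_ideal_def int_eval_0)

sublocale p: matrix_hom B \<Z> n fst
  by (intro matrix_hom.intro matrix_hom_axioms.intro B.matrix_ring_axioms Z.matrix_ring_axioms fst_hom)

sublocale z: matrix_hom \<Z> B n "\<lambda>m. (m, \<zero>)"
  by (intro matrix_hom.intro matrix_hom_axioms.intro B.matrix_ring_axioms Z.matrix_ring_axioms int_incl_hom)

lemma B_carrier: "carrier B = UNIV \<times> I" by (rule int_excision_simps)

lemma J_iff: "x \<in> carrier B \<Longrightarrow> x \<in> J \<longleftrightarrow> fst x = 0"
  by (cases x) (auto simp: B_carrier int_exc_ideal_def)

lemma fst_add: "fst (x \<oplus>\<^bsub>B\<^esub> y) = fst x + fst y"
  by (cases x, cases y) (simp add: int_excision_simps)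

lemma fst_minus:
  assumes "x \<in> carrier B" "y \<in> carrier B"
  shows "fst (x \<ominus>\<^bsub>B\<^esub> y) = fst x - fst y"
proof -
  have "fst (x \<ominus>\<^bsub>B\<^esub> y) = fst x + fst (\<ominus>\<^bsub>B\<^esub> y)"
    unfolding B.minus_eq by (rule fst_add)
  also have "fst (\<ominus>\<^bsub>B\<^esub> y) = - fst y"
    using p.h.hom_a_inv[OF assms(2)] by (simp only: int_a_inv_eq)
  finally show ?thesis by simp
qed

lemma B_rel_rows_iff:
  "w \<in> B.rel_rows \<longleftrightarrow> w \<in> rows n B \<and> (\<forall>i\<in>{1..n}. fst (w i) = (if i = 1 then 1 else 0))"
proof -
  have *: "w i \<ominus>\<^bsub>B\<^esub> (if i = 1 then \<one>\<^bsub>B\<^esub> else \<zero>\<^bsub>B\<^esub>) \<in> J \<longleftrightarrow> fst (w i) = (if i = 1 then 1 else 0)"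
    if "w \<in> rows n B" "i \<in> {1..n}" for i
  proof -
    let ?d = "if i = 1 then \<one>\<^bsub>B\<^esub> else \<zero>\<^bsub>B\<^esub>"
    have c: "w i \<in> carrier B" "?d \<in> carrier B" using rows_carrier[OF that] by simp_all
    then have "w i \<ominus>\<^bsub>B\<^esub> ?d \<in> carrier B" by (rule B.minus_closed)
    then have J: "w i \<ominus>\<^bsub>B\<^esub> ?d \<in> J \<longleftrightarrow> fst (w i \<ominus>\<^bsub>B\<^esub> ?d) = 0"
      by (rule J_iff)
    have d: "fst ?d = (if i = 1 then 1 else 0)"
      by (cases "i = 1") (simp_all only: if_True if_False int_excision_simps fst_conv refl)
    show ?thesis by (simp only: J fst_minus[OF c] d right_minus_eq)
  qed
  have "w \<in> rows n B \<Longrightarrow>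
      (\<forall>i\<in>{1..n}. w i \<ominus>\<^bsub>B\<^esub> (if i = 1 then \<one>\<^bsub>B\<^esub> else \<zero>\<^bsub>B\<^esub>) \<in> J) \<longleftrightarrow>
      (\<forall>i\<in>{1..n}. fst (w i) = (if i = 1 then 1 else 0))"
    by (intro ball_cong refl *)
  then show ?thesis unfolding B.rel_rows_def mem_Collect_eq by (rule conj_cong[OF refl])
qed

text \<open>The inverse, on rows congruent to \<open>e\<^sub>1\<close>, of the evaluation \<open>\<int> \<oplus> I \<rightarrow> R\<close>.\<close>

definition lift :: "(nat \<Rightarrow> 'a) \<Rightarrow> nat \<Rightarrow> int \<times> 'a" where
  "lift v = (\<lambda>i\<in>{1..n}. if i = 1 then (1, v i \<ominus> \<one>) else (0, v i))"

lemma lift_rel_rows: "v \<in> base.rel_rows \<Longrightarrow> lift v \<in> B.rel_rows"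
  unfolding B_rel_rows_iff by (auto simp: lift_def rows_def B_carrier base.rel_rows_iff)

lemma eval_lift: "v \<in> base.rel_rows \<Longrightarrow> e.mapr (lift v) = v"
proof (rule rows_eqI)
  assume v: "v \<in> base.rel_rows"
  show "e.mapr (lift v) \<in> rows n R" "v \<in> rows n R"
    using v lift_rel_rows[OF v] B.rel_rowsD base.rel_rowsD by (auto intro: e.mapr_rows)
  fix i assume i: "i \<in> {1..n}"
  show "e.mapr (lift v) i = v i"
  proof (cases "i = 1")
    case True
    have "v i \<in> carrier R" using v i by (rule base.rel_rows_carrier)
    then have "\<one> \<oplus> (v i \<ominus> \<one>) = v i" by algebra
    then show ?thesis using i True by (simp add: map_row_def lift_def int_eval_1)
  next
    case False
    then have "v i \<in> I" using base.rel_rows_I[OF v, of i] i by auto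
    then show ?thesis using i False by (simp add: map_row_def lift_def int_eval_0)
  qed
qed

lemma lift_eval:
  assumes w: "w \<in> B.rel_rows"
  shows "lift (e.mapr w) = w"
proof (rule rows_eqI)
  show "lift (e.mapr w) \<in> rows n B" "w \<in> rows n B"
    using w by (auto intro!: B.rel_rowsD lift_rel_rows e.mapr_rel_rows)
  fix i assume i: "i \<in> {1..n}"
  obtain m x where wi: "w i = (m, x)" "x \<in> I"
    using B.rel_rows_carrier[OF w i] by (auto simp: B_carrier)
  have "fst (w i) = (if i = 1 then 1 else 0)" using w i unfolding B_rel_rows_iff by blast
  then have m: "m = (if i = 1 then 1 else 0)" using wi by simp
  have "x \<in> carrier R" using wi by (simp add: Ic)
  then have x: "\<one> \<oplus> x \<ominus> \<one> = x" by algebra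
  show "lift (e.mapr w) i = w i"
  proof (cases "i = 1")
    case True
    then have "e.mapr w i = \<one> \<oplus> x" using i wi m by (simp add: map_row_def int_eval_1)
    then show ?thesis using i wi m x True by (simp add: lift_def)
  next
    case False
    then have "e.mapr w i = x" using i wi m by (simp add: map_row_def int_eval_0)
    then show ?thesis using i wi m False by (simp add: lift_def)
  qed
qed

lemma one_eqI:
  assumes "d \<in> carrier B" "fst d = 1" "int_eval R d = \<one>"
  shows "d = \<one>\<^bsub>B\<^esub>"
proof -
  obtain x where d: "d = (1, x)" using assms(2) by (cases d) simp
  then have x: "x \<in> carrier R" using assms(1) by (simp add: B_carrier Ic)
  have one: "\<one> \<oplus> x = \<one>" using assms(3) by (simp add: d int_eval_1)
  have "\<ominus> \<one> \<oplus> (\<one> \<oplus> x) = x" using x by (intro r_neg1) auto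
  then have "x = \<zero>" unfolding one by (simp add: l_neg)
  then show ?thesis unfolding d int_excision_simps by simp
qed

text \<open>If the witness is also congruent to \<open>e\<^sub>1\<close>, the product of the two lifts has integer part \<open>1\<close> and evaluates to
  \<open>1\<close>, so it is \<open>1\<close>.\<close>

lemma lift_Um_rel:
  assumes v: "v \<in> Um_rel n R I"
  shows "lift v \<in> Um_rel n B J"
proof -
  have vX: "v \<in> base.rel_rows" using v by (simp add: base.Um_rel_eq)
  obtain w where w: "w \<in> base.rel_rows" "base.dot v w = \<one>" using base.Um_rel_witness[OF v] .
  have l: "lift v \<in> B.rel_rows" "lift w \<in> B.rel_rows" using vX w by (auto intro: lift_rel_rows)
  have lc: "lift v \<in> {1..n} \<rightarrow> carrier B" "lift w \<in> {1..n} \<rightarrow> carrier B"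
    using l by (auto simp: B.rel_rows_carrier)
  let ?d = "B.dot (lift v) (lift w)"
  have dc: "?d \<in> carrier B" using lc by (rule B.dot_closed)
  have "fst ?d = (\<Sum>i\<in>{1..n}. fst (lift v i) * fst (lift w i))"
    unfolding p.f_dot[OF lc] by (rule Z.dot_sum)
  also have "\<dots> = (\<Sum>i\<in>{1..n}. if i = 1 then 1 else 0)"
    by (intro sum.cong) (auto simp: lift_def)
  also have "\<dots> = 1" using n_ge_3 by simp
  finally have fst: "fst ?d = 1" .
  have "int_eval R ?d = base.dot (\<lambda>i. int_eval R (lift v i)) (\<lambda>i. int_eval R (lift w i))"
    using lc by (rule e.f_dot)
  also have "\<dots> = base.dot v w"
  proof (rule base.dot_cong)
    show "v \<in> {1..n} \<rightarrow> carrier R" "w \<in> {1..n} \<rightarrow> carrier R"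
      using vX w by (auto simp: base.rel_rows_carrier)
    fix i assume i: "i \<in> {1..n}"
    show "int_eval R (lift v i) = v i" "int_eval R (lift w i) = w i"
      using fun_cong[OF eval_lift[OF vX], of i] fun_cong[OF eval_lift[OF w(1)], of i] i
      by (simp_all add: map_row_def)
  qed
  finally have "int_eval R ?d = \<one>" using w by simp
  then have "?d = \<one>\<^bsub>B\<^esub>" using dc fst by (intro one_eqI)
  then show ?thesis
    using l by (auto simp: B.Um_rel_eq Um_def B.rel_rowsD B.dot_def)
qed

lemma F_cls:
  "v \<in> rows n B \<Longrightarrow> F_map n R I (cls_rel n B J v) = cls_rel n R I (e.mapr v)"
  unfolding F_map_def by (rule e.induced_cls_rel)

lemma G_cls: "v \<in> rows n B \<Longrightarrow> G_map n R I (cls_rel n B J v) = cls n B v"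
  unfolding G_map_def by (rule B.induced_cls_rel_cls)

lemma eval_move:
  assumes "u \<in> rows n B" "i \<in> {1..n}" "j \<in> {1..n}" "c \<in> carrier B"
  shows "e.mapr (B.move i j c u) = base.move i j (int_eval R c) (e.mapr u)"
proof (rule rows_eqI)
  show "e.mapr (B.move i j c u) \<in> rows n R" by (intro e.mapr_rows B.move_closed assms)
  show "base.move i j (int_eval R c) (e.mapr u) \<in> rows n R"
    by (intro base.move_closed e.mapr_rows e.h.hom_closed assms)
  fix k assume k: "k \<in> {1..n}"
  have "u i \<in> carrier B" "u j \<in> carrier B" using rows_carrier[OF assms(1)] assms(2,3) by auto
  then show "e.mapr (B.move i j c u) k = base.move i j (int_eval R c) (e.mapr u) k"
    using k assms(2-4) by (cases "k = j") (simp_all add: map_row_def B.move_def base.move_def)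
qed

lemma lift_move:
  assumes v: "v \<in> base.rel_rows" and ij: "i \<in> {1..n}" "j \<in> {1..n}" "i \<noteq> j" and c: "c \<in> carrier B"
    and ok: "i \<ge> 2 \<or> c \<in> J"
  shows "B.row_equiv (lift v) (lift (base.move i j (int_eval R c) v))"
proof -
  have l: "lift v \<in> B.rel_rows" using v by (rule lift_rel_rows)
  have "e.mapr (B.move i j c (lift v)) = base.move i j (int_eval R c) v"
    unfolding eval_move[OF B.rel_rowsD[OF l] ij(1,2) c] eval_lift[OF v] ..
  moreover have "B.move i j c (lift v) \<in> B.rel_rows" using B.rel_rows_move[OF l ij c ok] .
  ultimately have "lift (base.move i j (int_eval R c) v) = B.move i j c (lift v)"
    using lift_eval by metis
  then show ?thesis using B.row_equiv_move[OF l ij c ok] by simp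
qed

lemma lift_row_equiv: "base.row_equiv v w \<Longrightarrow> B.row_equiv (lift v) (lift w)"
proof (rule base.row_equiv_le[of "\<lambda>v w. B.row_equiv (lift v) (lift w)"])
  show "B.row_equiv (lift v) (lift (base.move i j y v))"
    if "v \<in> base.rel_rows" "i \<in> {1..n}" "j \<in> {1..n}" "i \<noteq> j" "y \<in> I" for v i j y
  proof -
    have y: "(0, y) \<in> J" "(0, y) \<in> carrier B" "int_eval R (0, y) = y"
      using that by (auto simp: int_exc_ideal_def B_carrier int_eval_0)
    show ?thesis using lift_move[OF that(1-4) y(2) disjI2[OF y(1)]] unfolding y(3) .
  qed
  have one: "B.row_equiv (lift v) (lift (base.move k 1 (int_eval R c) v))"
    if "v \<in> base.rel_rows" "k \<in> {2..n}" "c \<in> carrier B" for v k c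
    using that n_ge_3 by (intro lift_move) auto
  have "int_eval R \<one>\<^bsub>B\<^esub> = \<one>" "int_eval R (\<ominus>\<^bsub>B\<^esub> \<one>\<^bsub>B\<^esub>) = \<ominus> \<one>"
    using e.h.hom_one e.h.hom_a_inv[OF B.one_closed] by simp_all
  then show "B.row_equiv (lift v) (lift (base.move k 1 \<one> v))"
    "B.row_equiv (lift v) (lift (base.move k 1 (\<ominus> \<one>) v))" if "v \<in> base.rel_rows" "k \<in> {2..n}" for v k
    using one[OF that B.one_closed]
      one[OF that abelian_group.a_inv_closed[OF B.abelian_group_axioms B.one_closed]] by simp_all
  show "B.row_equiv (lift u) (lift w)" if "B.row_equiv (lift u) (lift v)" "B.row_equiv (lift v) (lift w)" for u v w
    using B.row_equiv_trans[OF that(2,1)] .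
  show "B.row_equiv (lift v) (lift v)" if "v \<in> base.rel_rows" for v
    using lift_rel_rows[OF that] by (rule B.row_equiv.refl)
qed

text \<open>Equivalent rows over \<open>R\<close> have equivalent lifts, which gives injectivity; the lifts themselves give
  surjectivity.\<close>

theorem F_bij: "bij_betw (F_map n R I) (MSE_rel n B J) (MSE_rel n R I)"
  unfolding bij_betw_def
proof
  have X: "v \<in> B.rel_rows" "v \<in> rows n B" if "v \<in> Um_rel n B J" for v
    using that by (auto simp: B.Um_rel_eq B.rel_rowsD)
  show "inj_on (F_map n R I) (MSE_rel n B J)"
    unfolding MSE_rel_def
  proof (rule inj_onI, clarify)
    fix v w assume vw: "v \<in> Um_rel n B J" "w \<in> Um_rel n B J"
      and "F_map n R I (cls_rel n B J v) = F_map n R I (cls_rel n B J w)"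
    then have "cls_rel n R I (e.mapr v) = cls_rel n R I (e.mapr w)" by (simp add: F_cls X)
    then have "base.row_equiv (e.mapr v) (e.mapr w)"
      using vw by (simp add: base.cls_rel_eq_iff_row_equiv e.mapr_rel_rows X)
    then have "B.row_equiv v w" using lift_row_equiv lift_eval X vw by metis
    then show "cls_rel n B J v = cls_rel n B J w" by (rule B.row_equiv_cls_rel)
  qed
  show "F_map n R I ` MSE_rel n B J = MSE_rel n R I"
  proof
    show "F_map n R I ` MSE_rel n B J \<subseteq> MSE_rel n R I"
      using e.mapr_Um_rel by (auto simp: MSE_rel_def F_cls X)
    show "MSE_rel n R I \<subseteq> F_map n R I ` MSE_rel n B J"
    proof
      fix C assume "C \<in> MSE_rel n R I"
      then obtain v where v: "v \<in> Um_rel n R I" "C = cls_rel n R I v" by (auto simp: MSE_rel_def)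
      then have "C = F_map n R I (cls_rel n B J (lift v))"
        using lift_Um_rel[OF v(1)] by (simp add: F_cls X eval_lift base.Um_rel_eq)
      then show "C \<in> F_map n R I ` MSE_rel n B J"
        using lift_Um_rel[OF v(1)] by (auto simp: MSE_rel_def)
    qed
  qed
qed

lemma p_z: "A \<in> Z.E \<Longrightarrow> p.mapm (z.mapm A) = A"
proof -
  assume "A \<in> Z.E"
  then have A: "A \<in> carrier Z.M" by (simp add: Z.E_GL Z.GL_M)
  show ?thesis
  proof (rule Z.M_eqI)
    show "p.mapm (z.mapm A) \<in> carrier Z.M" using A by (intro p.mapm_M z.mapm_M)
  qed (use A in \<open>auto simp: p.mapm_def z.mapm_def\<close>)
qed

lemma p_unit: "w \<in> B.rel_rows \<Longrightarrow> p.mapr w = Z.unit_row 1"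
  by (auto simp: B_rel_rows_iff map_row_def Z.unit_row_def fun_eq_iff)

text \<open>Since \<open>E\<^sub>i\<^sub>j(m, x) = E\<^sub>i\<^sub>j(m, 0) E\<^sub>i\<^sub>j(0, x)\<close>, every elementary matrix is integral up to the normal subgroup
  \<open>E\<^sub>n(\<int> \<oplus> I, 0 \<oplus> I)\<close>.\<close>

lemma cls_rel_retract:
  assumes "g \<in> B.E" "v \<in> rows n B"
  shows "cls_rel n B J (B.act v g) = cls_rel n B J (B.act v (z.mapm (p.mapm g)))"
  using assms(1)
proof (induction rule: B.E_induct)
  case one
  then show ?case by simp
next
  case (mult g i j c)
  obtain m x where c: "c = (m, x)" "x \<in> I" using mult by (auto simp: B_carrier)
  have mc: "(m, \<zero>) \<in> carrier B" "(0, x) \<in> carrier B" "(0, x) \<in> J"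
    using c by (auto simp: B_carrier zero_closed int_exc_ideal_def)
  have "(m, \<zero>) \<oplus>\<^bsub>B\<^esub> (0, x) = c" using c by (simp add: int_excision_simps Ic)
  then have el: "B.el i j c = B.el i j (m, \<zero>) \<otimes>\<^bsub>B.GL\<^esub> B.el i j (0, x)"
    using B.el_mult[OF mult.hyps(2-4) mc(1,2)] by (simp add: B.GL_mult)
  have GL: "B.el i j (m, \<zero>) \<in> carrier B.GL" "B.el i j (0, x) \<in> carrier B.GL"
    "B.el i j c \<in> B.E"
    using mult mc by (auto intro!: B.el_GL B.el_E)
  let ?g = "z.mapm (p.mapm g)"
  have g: "g \<in> B.E" "g \<in> carrier B.GL" "?g \<in> carrier B.GL" "p.mapm g \<in> carrier Z.GL"
    using mult z.mapm_E p.mapm_E B.E_GL Z.E_GL by blast+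
  let ?u = "B.act v ?g"
  have rows: "?u \<in> rows n B" "B.act v g \<in> rows n B"
    using g assms by (auto intro: B.act_GL_closed)
  have "cls_rel n B J (B.act v (g \<otimes>\<^bsub>B.GL\<^esub> B.el i j c))
      = cls_rel n B J (B.act (B.act v g) (B.el i j c))"
    using assms g GL B.E_GL by (simp add: B.act_mult)
  also have "\<dots> = cls_rel n B J (B.act ?u (B.el i j c))"
    using rows mult.IH GL by (intro B.cls_rel_translate)
  also have "\<dots> = cls_rel n B J (B.act (B.act ?u (B.el i j (m, \<zero>))) (B.el i j (0, x)))"
    using rows GL by (simp add: el B.act_mult)
  also have "\<dots> = cls_rel n B J (B.act ?u (B.el i j (m, \<zero>)))"
    using rows GL mult mc assms(2) g by (intro B.cls_rel_act B.el_EI B.act_GL_closed)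
  also have "B.act ?u (B.el i j (m, \<zero>))
      = B.act v (z.mapm (p.mapm (g \<otimes>\<^bsub>B.GL\<^esub> B.el i j c)))"
  proof -
    have "Z.el i j m \<in> carrier Z.GL" using mult by (intro Z.el_GL) auto
    then have "z.mapm (p.mapm (g \<otimes>\<^bsub>B.GL\<^esub> B.el i j c)) = ?g \<otimes>\<^bsub>B.GL\<^esub> B.el i j (m, \<zero>)"
      using g GL B.E_GL mult by (simp add: p.mapm_el z.mapm_el c)
    then show ?thesis using assms g GL by (simp add: B.act_mult)
  qed
  finally show ?case .
qed

lemma gens_row_equiv:
  assumes "A \<in> Z.gens {2..n}" "v \<in> B.rel_rows"
  shows "B.row_equiv v (B.act v (z.mapm A))"
proof -
  have el: "B.row_equiv v (B.act v (z.mapm (Z.el i j m)))"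
    if "i \<in> {2..n}" "j \<in> {1..n}" "i \<noteq> j" "v \<in> B.rel_rows" for i j m v
  proof -
    have i: "i \<in> {1..n}" "i \<ge> 2" using that by auto
    have m: "(m, \<zero>) \<in> carrier B" by (simp add: B_carrier zero_closed)
    show ?thesis
      using B.row_equiv_move[OF that(4) i(1) that(2,3) m] i B.act_el_move[OF B.rel_rowsD[OF that(4)] i(1) that(2,3) m]
      by (simp add: z.mapm_el)
  qed
  have sub: "{Z.el i j m | i j m. i \<in> {2..n} \<and> j \<in> {1..n} \<and> i \<noteq> j} \<subseteq> carrier Z.GL"
    by (rule Z.gens_subset_GL) auto
  show ?thesis
    using assms unfolding Z.gens_def
  proof (induction A arbitrary: v rule: generate.induct)
    case one
    then show ?case by (simp add: B.act_GL_one B.rel_rowsD B.row_equiv.refl)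
  next
    case (incl h)
    then show ?case using el by auto
  next
    case (inv h)
    then obtain i j m where h: "h = Z.el i j m" "i \<in> {2..n}" "j \<in> {1..n}" "i \<noteq> j" by auto
    then have "inv\<^bsub>Z.GL\<^esub> h = Z.el i j (- m)"
      using Z.inv_el[of i j m] by auto
    then show ?case using el h inv by auto
  next
    case (eng h1 h2)
    have GL: "h1 \<in> carrier Z.GL" "h2 \<in> carrier Z.GL"
      using eng Z.GL.generate_in_carrier[OF sub] by auto
    have l1: "B.row_equiv v (B.act v (z.mapm h1))" using eng by auto
    then have "B.row_equiv v (B.act (B.act v (z.mapm h1)) (z.mapm h2))"
      using eng.IH(2) B.row_equiv_rel_rows B.row_equiv_trans by blast
    then show ?case using GL eng.prems by (simp add: B.act_mult B.rel_rowsD z.mapm_GL)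
  qed
qed

text \<open>If \<open>w = v g\<close> with both rows congruent to \<open>e\<^sub>1\<close>, the integral part of \<open>g\<close> fixes \<open>e\<^sub>1\<close>, hence acts on \<open>v\<close> by
  permitted additions.\<close>

theorem G_bij: "bij_betw (G_map n R I) (MSE_rel n B J) (MSE n B)"
  unfolding bij_betw_def
proof
  have X: "v \<in> B.rel_rows" "v \<in> rows n B" "v \<in> Um n B" if "v \<in> Um_rel n B J" for v
    using that by (auto simp: B.Um_rel_eq B.rel_rowsD)
  show "inj_on (G_map n R I) (MSE_rel n B J)"
    unfolding MSE_rel_def
  proof (rule inj_onI, clarify)
    fix v w assume vw: "v \<in> Um_rel n B J" "w \<in> Um_rel n B J"
      and "G_map n R I (cls_rel n B J v) = G_map n R I (cls_rel n B J w)"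
    then have "cls n B v = cls n B w" by (simp add: G_cls X)
    then obtain g where g: "g \<in> B.E" "w = B.act v g"
      using B.cls_eq_iff[OF X(2)[OF vw(1)] X(2)[OF vw(2)]] by auto
    define A where "A = p.mapm g"
    have A: "A \<in> Z.E" "A \<in> carrier Z.M" using g p.mapm_E Z.E_GL Z.GL_M by (auto simp: A_def)
    have gM: "g \<in> carrier B.M" using g by (simp add: B.E_GL B.GL_M)
    have 1: "1 \<in> {1..n}" using n_ge_3 by simp
    have "Z.row A 1 = Z.act (Z.unit_row 1) A" using Z.unit_row_act[OF A(2) 1] by simp
    also have "\<dots> = p.mapr (B.act v g)"
      using p.mapr_act[OF X(2)[OF vw(1)] gM] p_unit[OF X(1)[OF vw(1)]] by (simp add: A_def)
    also have "\<dots> = Z.unit_row 1" using p_unit[OF X(1)[OF vw(2)]] g by simp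
    finally have "A \<in> Z.gens {2..n}"
      using A n_ge_3 by (intro Z.unit_rows_gens[of A 1]) auto
    then have "B.row_equiv v (B.act v (z.mapm A))" using X(1)[OF vw(1)] by (rule gens_row_equiv)
    then have "cls_rel n B J v = cls_rel n B J (B.act v (z.mapm A))" by (rule B.row_equiv_cls_rel)
    also have "\<dots> = cls_rel n B J w"
      using cls_rel_retract[OF g(1) X(2)[OF vw(1)]] g by (simp add: A_def)
    finally show "cls_rel n B J v = cls_rel n B J w" .
  qed
  show "G_map n R I ` MSE_rel n B J = MSE n B"
  proof
    show "G_map n R I ` MSE_rel n B J \<subseteq> MSE n B"
      using X by (auto simp: MSE_rel_def MSE_def G_cls)
    show "MSE n B \<subseteq> G_map n R I ` MSE_rel n B J"
    proof
      fix C assume "C \<in> MSE n B"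
      then obtain v where v: "v \<in> Um n B" "C = cls n B v" by (auto simp: MSE_def)
      then have vr: "v \<in> rows n B" by (simp add: Um_def)
      have "Z.reach {1..n} (p.mapr v) (Z.unit_row 1)"
        using n_ge_3 v Z.Um_coprime[OF p.mapr_Um[OF v(1)]] p.mapr_rows[OF vr]
        by (intro Z.reduce_to_unit[of _ 1 2]) auto
      then obtain A where A: "A \<in> Z.gens {1..n}" "Z.unit_row 1 = Z.act (p.mapr v) A"
        by (auto simp: Z.reach_def)
      then have AE: "A \<in> Z.E" using Z.gens_E[of "{1..n}"] by auto
      define w where "w = B.act v (z.mapm A)"
      have g: "z.mapm A \<in> B.E" "z.mapm A \<in> carrier B.M"
        using AE z.mapm_E B.E_GL B.GL_M by blast+
      have wU: "w \<in> Um n B" using v g by (simp add: w_def B.Um_act)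
      have wr: "w \<in> rows n B" using wU by (simp add: Um_def)
      have "p.mapr w = Z.unit_row 1" using p.mapr_act[OF vr g(2)] A AE by (simp add: w_def p_z)
      then have "fst (w i) = (if i = 1 then 1 else 0)" if "i \<in> {1..n}" for i
        using that by (auto simp: map_row_def Z.unit_row_def dest!: fun_cong[of _ _ i])
      then have "w \<in> B.rel_rows" using wr by (simp add: B_rel_rows_iff)
      then have wR: "w \<in> Um_rel n B J" using wU by (simp add: B.Um_rel_eq)
      have "C = G_map n R I (cls_rel n B J w)"
        using wr vr g v by (simp add: G_cls) (simp add: w_def B.cls_act)
      then show "C \<in> G_map n R I ` MSE_rel n B J" using wR by (auto simp: MSE_rel_def)
    qed
  qed
qed

end

section \<open>The Vaserstein--van der Kallen rule under ring homomorphisms\<close>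

lemma Um_rows: "v \<in> Um n R \<Longrightarrow> v \<in> rows n R"
  by (simp add: Um_def)

lemma Um_rel_rows: "v \<in> Um_rel n R I \<Longrightarrow> v \<in> rows n R"
  by (simp add: Um_rel_def Um_rows)

text \<open>The row on the right-hand side of the \<open>Vv\<close> rule.\<close>

definition Vv_row ::
  "nat \<Rightarrow> ('a, 'm) ring_scheme \<Rightarrow> (nat \<Rightarrow> 'a) \<Rightarrow> (nat \<Rightarrow> 'a) \<Rightarrow> 'a \<Rightarrow> nat \<Rightarrow> 'a" where
  "Vv_row n R v w p = (\<lambda>i\<in>{1..n}.
            if i = 1 then (v 1 \<otimes>\<^bsub>R\<^esub> (w 1 \<oplus>\<^bsub>R\<^esub> p)) \<ominus>\<^bsub>R\<^esub> \<one>\<^bsub>R\<^esub>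
            else if i = 2 then v 2 \<otimes>\<^bsub>R\<^esub> (w 1 \<oplus>\<^bsub>R\<^esub> p)
            else v i)"

lemma Vv_ruleD:
  assumes "Vv_rule n R star" "v \<in> Um n R" "w \<in> Um n R" "p \<in> carrier R" "\<forall>i\<in>{2..n}. w i = v i"
    "(v 1 \<otimes>\<^bsub>R\<^esub> p) \<ominus>\<^bsub>R\<^esub> \<one>\<^bsub>R\<^esub> \<in> Idl\<^bsub>R\<^esub> (v ` {2..n})"
  shows "star (cls n R w) (cls n R v) = cls n R (Vv_row n R v w p)"
  using assms unfolding Vv_rule_def Vv_row_def by blast

lemma Vv_ruleI:
  assumes "\<And>v w p. v \<in> Um n R \<Longrightarrow> w \<in> Um n R \<Longrightarrow> p \<in> carrier R \<Longrightarrow> \<forall>i\<in>{2..n}. w i = v i \<Longrightarrow>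
    (v 1 \<otimes>\<^bsub>R\<^esub> p) \<ominus>\<^bsub>R\<^esub> \<one>\<^bsub>R\<^esub> \<in> Idl\<^bsub>R\<^esub> (v ` {2..n}) \<Longrightarrow>
    star (cls n R w) (cls n R v) = cls n R (Vv_row n R v w p)"
  shows "Vv_rule n R star"
  using assms unfolding Vv_rule_def Vv_row_def by blast

context matrix_ring
begin

lemma Vv_row_closed:
  assumes "v \<in> rows n R" "w \<in> rows n R" "p \<in> carrier R"
  shows "Vv_row n R v w p \<in> rows n R"
  using assms unfolding Vv_row_def rows_def by (auto simp: PiE_iff)

text \<open>This supplies the element \<open>p\<close> that the \<open>Vv\<close> rule asks for.\<close>

lemma witness_congruence:
  assumes n: "n \<ge> 1" and v: "v \<in> rows n R" and u: "u \<in> rows n R" and vu: "dot v u = \<one>"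
  shows "v 1 \<otimes> u 1 \<ominus> \<one> \<in> Idl (v ` {2..n})"
proof -
  have c: "v i \<in> carrier R" "u i \<in> carrier R" if "i \<in> {1..n}" for i
    using rows_carrier[OF v that] rows_carrier[OF u that] .
  have sub: "v ` {2..n} \<subseteq> carrier R" using c(1) by auto
  interpret A: ideal "Idl (v ` {2..n})" R by (rule genideal_ideal[OF sub])
  define t where "t = (\<Oplus>i\<in>{2..n}. v i \<otimes> u i)"
  have term_in: "v i \<otimes> u i \<in> Idl (v ` {2..n})" if "i \<in> {2..n}" for i
    using that c genideal_self[OF sub] by (intro A.I_r_closed) auto
  have "(\<Oplus>i\<in>F. v i \<otimes> u i) \<in> Idl (v ` {2..n})" if "finite F" "F \<subseteq> {2..n}" for F
    using that
  proof (induction F rule: finite_induct)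
    case empty
    then show ?case using A.zero_closed by (simp add: finsum_empty)
  next
    case (insert x F)
    have "(\<Oplus>i\<in>insert x F. v i \<otimes> u i) = v x \<otimes> u x \<oplus> (\<Oplus>i\<in>F. v i \<otimes> u i)"
      using insert.prems c by (intro finsum_insert[OF insert.hyps]) (auto intro!: m_closed)
    then show ?case using insert term_in A.a_closed by auto
  qed
  then have t: "t \<in> Idl (v ` {2..n})" by (simp add: t_def)
  have tc: "t \<in> carrier R" using A.a_Hcarr[OF t] .
  have 1: "1 \<in> {1..n}" using n by simp
  have "{1..n} = insert 1 {2..n}" using n by auto
  then have "dot v u = (\<Oplus>i\<in>insert 1 {2..n}. v i \<otimes> u i)" unfolding dot_def by simp
  also have "\<dots> = v 1 \<otimes> u 1 \<oplus> t"
    unfolding t_def using c n by (intro finsum_insert) (auto intro!: m_closed)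
  finally have one: "\<one> = v 1 \<otimes> u 1 \<oplus> t" using vu by simp
  have "v 1 \<otimes> u 1 \<ominus> (v 1 \<otimes> u 1 \<oplus> t) = \<ominus> t" using c[OF 1] tc by algebra
  then have "v 1 \<otimes> u 1 \<ominus> \<one> = \<ominus> t" unfolding one[symmetric] .
  then show ?thesis using A.a_inv_closed[OF t] by simp
qed

end

context matrix_hom
begin

lemma induced_MSE: "C \<in> MSE n R \<Longrightarrow> induced_map (cls n S) mapr C \<in> MSE n S"
proof -
  assume "C \<in> MSE n R"
  then obtain v where v: "v \<in> Um n R" "C = cls n R v" by (auto simp: MSE_def)
  then have "induced_map (cls n S) mapr C = cls n S (mapr v)"
    by (simp add: induced_cls Um_def)
  then show ?thesis using mapr_Um[OF v(1)] by (simp add: MSE_def)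
qed

lemma mapr_Vv_row:
  assumes n: "n \<ge> 2" and v: "v \<in> rows n R" and w: "w \<in> rows n R" and p: "p \<in> carrier R"
  shows "mapr (Vv_row n R v w p) = Vv_row n S (mapr v) (mapr w) (f p)"
proof (rule rows_eqI)
  show "mapr (Vv_row n R v w p) \<in> rows n S"
    by (intro mapr_rows R.Vv_row_closed v w p)
  show "Vv_row n S (mapr v) (mapr w) (f p) \<in> rows n S"
    by (intro mapr_rows S.Vv_row_closed v w h.hom_closed p)
  fix i assume i: "i \<in> {1..n}"
  have c: "v 1 \<in> carrier R" "v 2 \<in> carrier R" "w 1 \<in> carrier R"
    using rows_carrier[OF v] rows_carrier[OF w] n by auto
  have m: "f (v 1 \<otimes>\<^bsub>R\<^esub> (w 1 \<oplus>\<^bsub>R\<^esub> p) \<ominus>\<^bsub>R\<^esub> \<one>\<^bsub>R\<^esub>) = f (v 1) \<otimes>\<^bsub>S\<^esub> (f (w 1) \<oplus>\<^bsub>S\<^esub> f p) \<ominus>\<^bsub>S\<^esub> \<one>\<^bsub>S\<^esub>"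
    using c p by (simp add: R.minus_eq S.minus_eq)
  have m2: "f (v 2 \<otimes>\<^bsub>R\<^esub> (w 1 \<oplus>\<^bsub>R\<^esub> p)) = f (v 2) \<otimes>\<^bsub>S\<^esub> (f (w 1) \<oplus>\<^bsub>S\<^esub> f p)"
    using c p by simp
  have e: "mapr v 1 = f (v 1)" "mapr v 2 = f (v 2)" "mapr w 1 = f (w 1)" "mapr v i = f (v i)"
    using n i by (simp_all add: map_row_def)
  show "mapr (Vv_row n R v w p) i = Vv_row n S (mapr v) (mapr w) (f p) i"
    using i unfolding Vv_row_def e by (simp add: map_row_def m m2 del: One_nat_def)
qed

lemma induced_Vv:
  assumes n: "n \<ge> 2" and s: "Vv_rule n R s" and s': "Vv_rule n S s'"
    and v: "v \<in> Um n R" and w: "w \<in> Um n R" and vw: "\<forall>i\<in>{2..n}. w i = v i"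
  shows "induced_map (cls n S) mapr (s (cls n R w) (cls n R v))
    = s' (induced_map (cls n S) mapr (cls n R w)) (induced_map (cls n S) mapr (cls n R v))"
proof -
  obtain u where u: "v \<in> rows n R" "u \<in> rows n R" "R.dot v u = \<one>\<^bsub>R\<^esub>"
    using v by (auto simp: Um_def R.dot_def)
  have wr: "w \<in> rows n R" using w by (simp add: Um_def)
  have n1: "1 \<in> {1..n}" "n \<ge> 1" using n by auto
  have p: "u 1 \<in> carrier R" using rows_carrier[OF u(2) n1(1)] .
  have "s (cls n R w) (cls n R v) = cls n R (Vv_row n R v w (u 1))"
    using R.witness_congruence[OF n1(2) u] by (intro Vv_ruleD[OF s v w p vw])
  then have "induced_map (cls n S) mapr (s (cls n R w) (cls n R v))
      = cls n S (Vv_row n S (mapr v) (mapr w) (f (u 1)))"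
    using induced_cls[OF R.Vv_row_closed[OF u(1) wr p]] mapr_Vv_row[OF n u(1) wr p] by simp
  also have "\<dots> = s' (cls n S (mapr w)) (cls n S (mapr v))"
  proof (rule Vv_ruleD[OF s', symmetric])
    show "mapr v \<in> Um n S" "mapr w \<in> Um n S" using v w by (auto intro: mapr_Um)
    show "f (u 1) \<in> carrier S" using p by simp
    show "\<forall>i\<in>{2..n}. mapr w i = mapr v i" using vw by (simp add: map_row_def)
    have "S.dot (mapr v) (mapr u) = S.dot (\<lambda>i. f (v i)) (\<lambda>i. f (u i))"
      using rows_carrier[OF u(1)] rows_carrier[OF u(2)]
      by (intro S.dot_cong) (auto simp: map_row_def)
    also have "\<dots> = f (R.dot v u)"
      using rows_carrier[OF u(1)] rows_carrier[OF u(2)] by (intro f_dot[symmetric]) auto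
    finally have "S.dot (mapr v) (mapr u) = \<one>\<^bsub>S\<^esub>" using u by simp
    from S.witness_congruence[OF n1(2) mapr_rows[OF u(1)] mapr_rows[OF u(2)] this]
    show "mapr v 1 \<otimes>\<^bsub>S\<^esub> f (u 1) \<ominus>\<^bsub>S\<^esub> \<one>\<^bsub>S\<^esub> \<in> Idl\<^bsub>S\<^esub> (mapr v ` {2..n})"
      using n1 by (simp add: map_row_def)
  qed
  finally show ?thesis using induced_cls[OF u(1)] induced_cls[OF wr] by simp
qed

lemma f_Idl:
  assumes A: "A \<subseteq> carrier R" and x: "x \<in> Idl\<^bsub>R\<^esub> A"
  shows "f x \<in> Idl\<^bsub>S\<^esub> (f ` A)"
proof -
  have fA: "f ` A \<subseteq> carrier S" using A by auto
  have hom: "ring_hom_ring R S f"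
    by (intro ring_hom_ring.intro ring_hom_ring_axioms.intro R.ring_axioms S.ring_axioms f_hom)
  have "ideal {r \<in> carrier R. f r \<in> Idl\<^bsub>S\<^esub> (f ` A)} R"
    by (rule ring_hom_ring.ideal_vimage[OF hom S.genideal_ideal[OF fA]])
  moreover have "A \<subseteq> {r \<in> carrier R. f r \<in> Idl\<^bsub>S\<^esub> (f ` A)}"
    using A S.genideal_self[OF fA] by auto
  ultimately have "Idl\<^bsub>R\<^esub> A \<subseteq> {r \<in> carrier R. f r \<in> Idl\<^bsub>S\<^esub> (f ` A)}"
    by (rule R.genideal_minimal)
  then show ?thesis using x by auto
qed

end

locale matrix_iso = f: matrix_hom R S n f + g: matrix_hom S R n g
  for R :: "('a, 'm) ring_scheme" and S :: "('b, 'k) ring_scheme" and n :: nat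
    and f :: "'a \<Rightarrow> 'b" and g :: "'b \<Rightarrow> 'a" +
  assumes gf: "x \<in> carrier R \<Longrightarrow> g (f x) = x" and fg: "y \<in> carrier S \<Longrightarrow> f (g y) = y"
begin

lemma gf_row: "v \<in> rows n R \<Longrightarrow> g.mapr (f.mapr v) = v"
proof (rule rows_eqI)
  fix i assume "v \<in> rows n R" "i \<in> {1..n}"
  then show "g.mapr (f.mapr v) i = v i"
    using rows_carrier[of v n R i] by (simp add: map_row_def gf)
qed (auto intro: f.mapr_rows g.mapr_rows)

lemma fg_row: "v \<in> rows n S \<Longrightarrow> f.mapr (g.mapr v) = v"
proof (rule rows_eqI)
  fix i assume "v \<in> rows n S" "i \<in> {1..n}"
  then show "f.mapr (g.mapr v) i = v i"
    using rows_carrier[of v n S i] by (simp add: map_row_def fg)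
qed (auto intro: f.mapr_rows g.mapr_rows)

lemma induced_bij: "bij_betw (induced_map (cls n S) f.mapr) (MSE n R) (MSE n S)"
proof (rule bij_betw_byWitness[where f' = "induced_map (cls n R) g.mapr"])
  show "\<forall>C\<in>MSE n R. induced_map (cls n R) g.mapr (induced_map (cls n S) f.mapr C) = C"
  proof
    fix C assume "C \<in> MSE n R"
    then obtain v where v: "v \<in> rows n R" "C = cls n R v" by (auto simp: MSE_def Um_def)
    then show "induced_map (cls n R) g.mapr (induced_map (cls n S) f.mapr C) = C"
      by (simp add: f.induced_cls g.induced_cls f.mapr_rows gf_row)
  qed
  show "\<forall>C\<in>MSE n S. induced_map (cls n S) f.mapr (induced_map (cls n R) g.mapr C) = C"
  proof
    fix C assume "C \<in> MSE n S"
    then obtain v where v: "v \<in> rows n S" "C = cls n S v" by (auto simp: MSE_def Um_def)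
    then show "induced_map (cls n S) f.mapr (induced_map (cls n R) g.mapr C) = C"
      by (simp add: f.induced_cls g.induced_cls g.mapr_rows fg_row)
  qed
qed (use f.induced_MSE g.induced_MSE in auto)

text \<open>The rule for \<open>s\<close> needs the congruence in \<open>R\<close>; it follows from the one in \<open>S\<close> because ring homomorphisms
  map generated ideals into generated ideals.\<close>

lemma Vv_transport:
  assumes n: "n \<ge> 2" and s: "Vv_rule n R s"
    and s': "\<And>v w. v \<in> Um n S \<Longrightarrow> w \<in> Um n S \<Longrightarrow> s' (cls n S w) (cls n S v)
      = induced_map (cls n S) f.mapr (s (cls n R (g.mapr w)) (cls n R (g.mapr v)))"
  shows "Vv_rule n S s'"
proof (rule Vv_ruleI)
  fix v w p assume v: "v \<in> Um n S" and w: "w \<in> Um n S" and p: "p \<in> carrier S"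
    and vw: "\<forall>i\<in>{2..n}. w i = v i"
    and cong: "v 1 \<otimes>\<^bsub>S\<^esub> p \<ominus>\<^bsub>S\<^esub> \<one>\<^bsub>S\<^esub> \<in> Idl\<^bsub>S\<^esub> (v ` {2..n})"
  have r: "v \<in> rows n S" "w \<in> rows n S" using v w by (auto simp: Um_def)
  have gp: "g p \<in> carrier R" using p by simp
  have v1: "v 1 \<in> carrier S" using rows_carrier[OF r(1), of 1] n by simp
  have sub: "v ` {2..n} \<subseteq> carrier S" using rows_carrier[OF r(1)] by auto
  have "g.mapr v ` {2..n} = g ` v ` {2..n}"
    unfolding image_image by (intro image_cong) (auto simp: map_row_def)
  moreover have "g (v 1 \<otimes>\<^bsub>S\<^esub> p \<ominus>\<^bsub>S\<^esub> \<one>\<^bsub>S\<^esub>) = g.mapr v 1 \<otimes>\<^bsub>R\<^esub> g p \<ominus>\<^bsub>R\<^esub> \<one>\<^bsub>R\<^esub>"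
    using v1 p n by (simp add: f.R.minus_eq f.S.minus_eq map_row_def)
  ultimately have "g.mapr v 1 \<otimes>\<^bsub>R\<^esub> g p \<ominus>\<^bsub>R\<^esub> \<one>\<^bsub>R\<^esub> \<in> Idl\<^bsub>R\<^esub> (g.mapr v ` {2..n})"
    using g.f_Idl[OF sub cong] by simp
  moreover have "\<forall>i\<in>{2..n}. g.mapr w i = g.mapr v i" using vw by (simp add: map_row_def)
  ultimately have "s (cls n R (g.mapr w)) (cls n R (g.mapr v))
      = cls n R (Vv_row n R (g.mapr v) (g.mapr w) (g p))"
    using g.mapr_Um v w gp by (intro Vv_ruleD[OF s]) auto
  then have "s' (cls n S w) (cls n S v)
      = cls n S (f.mapr (Vv_row n R (g.mapr v) (g.mapr w) (g p)))"
    using s'[OF v w] f.induced_cls[OF f.R.Vv_row_closed[OF g.mapr_rows[OF r(1)] g.mapr_rows[OF r(2)] gp]]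
    by simp
  also have "f.mapr (Vv_row n R (g.mapr v) (g.mapr w) (g p)) = Vv_row n S v w p"
    using f.mapr_Vv_row[OF n g.mapr_rows[OF r(1)] g.mapr_rows[OF r(2)] gp] fg_row r fg[OF p] by simp
  finally show "s' (cls n S w) (cls n S v) = cls n S (Vv_row n S v w p)" .
qed

end

context excision_setup
begin

abbreviation M where "M \<equiv> MSE_rel n B J"

text \<open>The bijections \<open>G \<circ> F\<^sup>-\<^sup>1\<close> and \<open>F \<circ> G\<^sup>-\<^sup>1\<close> between relative and absolute orbits, along which
  operations are transferred.\<close>

definition to_abs :: "(nat \<Rightarrow> 'a) set \<Rightarrow> (nat \<Rightarrow> int \<times> 'a) set" where
  "to_abs C = G_map n R I (inv_into M (F_map n R I) C)"

definition of_abs :: "(nat \<Rightarrow> int \<times> 'a) set \<Rightarrow> (nat \<Rightarrow> 'a) set" where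
  "of_abs C = F_map n R I (inv_into M (G_map n R I) C)"

lemma to_abs_bij: "bij_betw to_abs (MSE_rel n R I) (MSE n B)"
  using bij_betw_trans[OF bij_betw_inv_into[OF F_bij] G_bij]
  by (simp add: to_abs_def[abs_def] comp_def)

lemma of_to_abs:
  assumes "C \<in> MSE_rel n R I"
  shows "of_abs (to_abs C) = C"
proof -
  have "inv_into M (F_map n R I) C \<in> M"
    using bij_betw_inv_into[OF F_bij] assms by (auto simp: bij_betw_def)
  then have "inv_into M (G_map n R I) (to_abs C) = inv_into M (F_map n R I) C"
    unfolding to_abs_def using G_bij by (intro inv_into_f_f) (auto simp: bij_betw_def)
  then show ?thesis
    unfolding of_abs_def using bij_betw_inv_into_right[OF F_bij assms] by simp
qed

lemma to_of_abs:
  assumes "C \<in> MSE n B"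
  shows "of_abs C \<in> MSE_rel n R I" "to_abs (of_abs C) = C"
proof -
  obtain D where D: "D \<in> MSE_rel n R I" "C = to_abs D"
    using to_abs_bij assms by (auto simp: bij_betw_def)
  then show "of_abs C \<in> MSE_rel n R I" "to_abs (of_abs C) = C" by (simp_all add: of_to_abs)
qed

lemma to_abs_cls:
  assumes v: "v \<in> Um_rel n B J"
  shows "to_abs (cls_rel n R I (e.mapr v)) = cls n B v"
proof -
  have r: "v \<in> rows n B" using v by (simp add: Um_rel_def Um_def)
  have "cls_rel n B J v \<in> M" using v by (simp add: MSE_rel_def)
  then have "inv_into M (F_map n R I) (cls_rel n R I (e.mapr v)) = cls_rel n B J v"
    using F_bij F_cls[OF r] by (metis bij_betw_def inv_into_f_f)
  then show ?thesis by (simp add: to_abs_def G_cls[OF r])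
qed

lemma transfer_op_eq: "transfer_op n R I s C D = to_abs (s (of_abs C) (of_abs D))"
  by (simp add: transfer_op_def Let_def to_abs_def of_abs_def)

lemma transfer_op_to_abs:
  "C \<in> MSE_rel n R I \<Longrightarrow> D \<in> MSE_rel n R I
    \<Longrightarrow> transfer_op n R I s (to_abs C) (to_abs D) = to_abs (s C D)"
  by (simp add: transfer_op_eq of_to_abs)

end

section \<open>The map induced by the second projection\<close>

locale excision_pair = lo: excision_setup R I n
  for R :: "('a, 'm) ring_scheme" and I :: "'a set" and n :: nat
begin

abbreviation RI where "RI \<equiv> excision R I"
abbreviation OI where "OI \<equiv> exc_ideal R I"

sublocale up: excision_setup RI OI n
  by (intro excision_setup.intro excision_setup_axioms.intro lo.exc_cring_ideal lo.n_ge_3)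

sublocale d: relative_hom up.B lo.B n up.J lo.J drop_zero
  by (intro relative_hom.intro relative_hom_axioms.intro up.B.relative_ring_axioms
      lo.B.relative_ring_axioms lo.drop_zero_hom)
    (auto simp: int_exc_ideal_def exc_ideal_def drop_zero_def)

sublocale q: relative_hom lo.B up.B n lo.J up.J lo.put_zero
  by (intro relative_hom.intro relative_hom_axioms.intro up.B.relative_ring_axioms
      lo.B.relative_ring_axioms lo.put_zero_hom)
    (auto simp: int_exc_ideal_def exc_ideal_def lo.put_zero_def)

sublocale iso: matrix_iso up.B lo.B n drop_zero lo.put_zero
  by (intro matrix_iso.intro matrix_iso_axioms.intro d.matrix_hom_axioms q.matrix_hom_axioms)
    (simp_all add: lo.drop_put_zero)

sublocale t: relative_hom RI R n OI I "pi2 R"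
  by (intro relative_hom.intro relative_hom_axioms.intro up.base.relative_ring_axioms
      lo.base.relative_ring_axioms lo.pi2_hom)
    (auto simp: exc_ideal_def pi2_def lo.Ic)

lemma middle_eq: "middle_map n R I = induced_map (cls n lo.B) d.mapr"
  by (simp add: middle_map_def)

lemma middle_cls: "v \<in> rows n up.B \<Longrightarrow> middle_map n R I (cls n up.B v) = cls n lo.B (d.mapr v)"
  unfolding middle_eq by (rule d.induced_cls)

lemma middle_bij: "bij_betw (middle_map n R I) (MSE n up.B) (MSE n lo.B)"
  unfolding middle_eq by (rule iso.induced_bij)

lemma pi2_cls: "v \<in> rows n RI \<Longrightarrow> pi2_map n R I (cls_rel n RI OI v) = cls_rel n R I (t.mapr v)"
  unfolding pi2_map_def by (rule t.induced_cls_rel)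

lemma pi2_eval_row:
  assumes "v \<in> rows n up.B"
  shows "t.mapr (up.e.mapr v) = lo.e.mapr (d.mapr v)"
proof -
  have "v i \<in> carrier lo.Z2" if "i \<in> {1..n}" for i using rows_carrier[OF assms that] .
  then show ?thesis by (auto simp: map_row_def lo.pi2_int_eval fun_eq_iff)
qed

lemma MSE_rel_obtain:
  assumes "C \<in> MSE_rel n RI OI"
  obtains v where "v \<in> Um_rel n up.B up.J" "C = cls_rel n RI OI (up.e.mapr v)"
proof -
  obtain w where w: "w \<in> Um_rel n RI OI" "C = cls_rel n RI OI w" using assms by (auto simp: MSE_rel_def)
  then show ?thesis
    using that[of "up.lift w"] up.lift_Um_rel[OF w(1)] up.eval_lift by (auto simp: up.base.Um_rel_eq)
qed

text \<open>Under the identifications of relative with absolute orbits, \<open>\<pi>\<^sub>2\<close> becomes the middle map of the chain.\<close>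

lemma pi2_commutes:
  assumes "C \<in> MSE_rel n RI OI"
  shows "pi2_map n R I C \<in> MSE_rel n R I" "lo.to_abs (pi2_map n R I C) = middle_map n R I (up.to_abs C)"
proof -
  obtain v where v: "v \<in> Um_rel n up.B up.J" "C = cls_rel n RI OI (up.e.mapr v)"
    using MSE_rel_obtain[OF assms] .
  have r: "v \<in> rows n up.B" using v by (simp add: Um_rel_def Um_def)
  have dv: "d.mapr v \<in> Um_rel n lo.B lo.J" using v(1) by (rule d.mapr_Um_rel)
  have p: "pi2_map n R I C = cls_rel n R I (lo.e.mapr (d.mapr v))"
    unfolding v(2) pi2_cls[OF up.e.mapr_rows[OF r]] pi2_eval_row[OF r] ..
  then show "pi2_map n R I C \<in> MSE_rel n R I"
    using lo.e.mapr_Um_rel[OF dv] by (simp add: MSE_rel_def)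
  show "lo.to_abs (pi2_map n R I C) = middle_map n R I (up.to_abs C)"
    unfolding p lo.to_abs_cls[OF dv] unfolding v(2) up.to_abs_cls[OF v(1)] middle_cls[OF r] ..
qed

lemma pi2_bij: "bij_betw (pi2_map n R I) (MSE_rel n RI OI) (MSE_rel n R I)"
proof -
  have "bij_betw lo.of_abs (MSE n lo.B) (MSE_rel n R I)"
    by (rule bij_betw_byWitness[where f' = lo.to_abs])
      (use lo.to_of_abs lo.of_to_abs lo.to_abs_bij in \<open>auto simp: bij_betw_def\<close>)
  with bij_betw_trans[OF up.to_abs_bij middle_bij]
  have "bij_betw (lo.of_abs \<circ> (middle_map n R I \<circ> up.to_abs)) (MSE_rel n RI OI) (MSE_rel n R I)"
    by (rule bij_betw_trans)
  moreover have "(lo.of_abs \<circ> (middle_map n R I \<circ> up.to_abs)) C = pi2_map n R I C"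
    if "C \<in> MSE_rel n RI OI" for C
    using pi2_commutes[OF that] lo.of_to_abs[of "pi2_map n R I C"] by simp
  ultimately show ?thesis by (simp cong: bij_betw_cong)
qed

text \<open>The lifts of \<open>v\<close> and \<open>w\<close> to \<open>\<int> \<oplus> (0 \<oplus> I)\<close> again agree outside the first coordinate, so the rule
  computes their product, and the isomorphism onto \<open>\<int> \<oplus> I\<close> carries it to the product of the images.\<close>

lemma pi2_rule_product:
  assumes H: "Vv_group n RI OI H" and K: "Vv_group n R I K"
    and v: "v \<in> Um_rel n RI OI" and w: "w \<in> Um_rel n RI OI" and vw: "\<forall>i\<in>{2..n}. w i = v i"
  shows "pi2_map n R I (cls_rel n RI OI w \<otimes>\<^bsub>H\<^esub> cls_rel n RI OI v)
    = pi2_map n R I (cls_rel n RI OI w) \<otimes>\<^bsub>K\<^esub> pi2_map n R I (cls_rel n RI OI v)"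
proof -
  interpret H: group H using H by (simp add: Vv_group_def)
  interpret K: group K using K by (simp add: Vv_group_def)
  have car: "carrier H = MSE_rel n RI OI" "carrier K = MSE_rel n R I"
    and rule: "Vv_rule n up.B (transfer_op n RI OI (monoid.mult H))" "Vv_rule n lo.B (transfer_op n R I (monoid.mult K))"
    using H K by (simp_all add: Vv_group_def)
  let ?C = "cls_rel n RI OI w" and ?D = "cls_rel n RI OI v"
  let ?p = "pi2_map n R I" and ?m = "middle_map n R I"
  have CD: "?C \<in> MSE_rel n RI OI" "?D \<in> MSE_rel n RI OI" using v w by (auto simp: MSE_rel_def)
  have CD': "?C \<otimes>\<^bsub>H\<^esub> ?D \<in> MSE_rel n RI OI" using CD H.m_closed by (simp add: car)
  have l: "up.lift v \<in> Um_rel n up.B up.J" "up.lift w \<in> Um_rel n up.B up.J"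
    using v w by (auto intro: up.lift_Um_rel)
  have X: "v \<in> up.base.rel_rows" "w \<in> up.base.rel_rows" using v w by (auto simp: up.base.Um_rel_eq)
  have abs: "up.to_abs ?C = cls n up.B (up.lift w)" "up.to_abs ?D = cls n up.B (up.lift v)"
    using up.to_abs_cls[OF l(1)] up.to_abs_cls[OF l(2)] up.eval_lift X by simp_all
  have agree: "\<forall>i\<in>{2..n}. up.lift w i = up.lift v i" using vw by (auto simp: up.lift_def)
  have U: "up.lift v \<in> Um n up.B" "up.lift w \<in> Um n up.B" using l by (simp_all add: Um_rel_def)
  have "lo.to_abs (?p (?C \<otimes>\<^bsub>H\<^esub> ?D)) = ?m (up.to_abs (?C \<otimes>\<^bsub>H\<^esub> ?D))"
    using CD' by (rule pi2_commutes)
  also have "up.to_abs (?C \<otimes>\<^bsub>H\<^esub> ?D)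
      = transfer_op n RI OI (monoid.mult H) (up.to_abs ?C) (up.to_abs ?D)"
    using CD by (simp add: up.transfer_op_to_abs)
  also have "?m \<dots> = transfer_op n R I (monoid.mult K) (?m (up.to_abs ?C)) (?m (up.to_abs ?D))"
    unfolding abs middle_eq using lo.n_ge_3
    by (intro d.induced_Vv rule U agree) simp
  also have "\<dots> = transfer_op n R I (monoid.mult K) (lo.to_abs (?p ?C)) (lo.to_abs (?p ?D))"
    using pi2_commutes(2)[OF CD(1)] pi2_commutes(2)[OF CD(2)] by simp
  also have "\<dots> = lo.to_abs (?p ?C \<otimes>\<^bsub>K\<^esub> ?p ?D)"
    using pi2_commutes(1)[OF CD(1)] pi2_commutes(1)[OF CD(2)] by (simp add: lo.transfer_op_to_abs)
  finally have eq: "lo.to_abs (?p (?C \<otimes>\<^bsub>H\<^esub> ?D)) = lo.to_abs (?p ?C \<otimes>\<^bsub>K\<^esub> ?p ?D)" .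
  have "?p ?C \<otimes>\<^bsub>K\<^esub> ?p ?D \<in> MSE_rel n R I"
    using pi2_commutes(1)[OF CD(1)] pi2_commutes(1)[OF CD(2)] K.m_closed by (simp add: car)
  with eq show ?thesis
    using lo.of_to_abs pi2_commutes(1)[OF CD'] by metis
qed

text \<open>Transporting the product of \<open>H\<close> along \<open>\<pi>\<^sub>2\<close> gives a group structure \<open>K'\<close> on \<open>MSE\<^sub>n(R, I)\<close> for which \<open>\<pi>\<^sub>2\<close> is a
  homomorphism.  On \<open>MSE\<^sub>n(\<int> \<oplus> I)\<close> it is the image of the product from \<open>H\<close> under a ring isomorphism, so it
  obeys the rule, and the hypothesis identifies it with \<open>K\<close>.\<close>

lemma pi2_hom_determined:
  assumes H: "Vv_group n RI OI H" and K: "Vv_group n R I K" and det: "Vv_determined n R I"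
  shows "pi2_map n R I \<in> hom H K"
proof -
  interpret H: group H using H by (simp add: Vv_group_def)
  have car: "carrier H = MSE_rel n RI OI" "carrier K = MSE_rel n R I"
    and rule: "Vv_rule n up.B (transfer_op n RI OI (monoid.mult H))"
    using H K by (simp_all add: Vv_group_def)
  let ?p = "pi2_map n R I" and ?m = "middle_map n R I"
  define r where "r = inv_into (MSE_rel n RI OI) ?p"
  have r: "r C \<in> MSE_rel n RI OI" "?p (r C) = C" if "C \<in> MSE_rel n R I" for C
    using bij_betw_inv_into[OF pi2_bij] bij_betw_inv_into_right[OF pi2_bij that] that
    by (auto simp: r_def bij_betw_def)
  have rp: "r (?p C) = C" if "C \<in> MSE_rel n RI OI" for C
    unfolding r_def by (rule bij_betw_inv_into_left[OF pi2_bij that])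
  define K' where "K' = \<lparr>carrier = MSE_rel n R I,
    monoid.mult = (\<lambda>C D. ?p (r C \<otimes>\<^bsub>H\<^esub> r D)), monoid.one = ?p \<one>\<^bsub>H\<^esub>\<rparr>"
  have "?p \<in> iso H K'"
    using pi2_bij rp pi2_commutes(1) by (auto simp: iso_def hom_def K'_def car)
  then have "group (K'\<lparr>one := ?p \<one>\<^bsub>H\<^esub>\<rparr>)" by (rule H.iso_imp_img_group)
  then have "group K'" by (simp add: K'_def)
  moreover have "Vv_rule n lo.B (transfer_op n R I (monoid.mult K'))"
  proof (rule iso.Vv_transport[OF _ rule])
    show "2 \<le> n" using lo.n_ge_3 by simp
    fix v w assume v: "v \<in> Um n lo.B" and w: "w \<in> Um n lo.B"
    have lift: "up.to_abs (r (lo.of_abs (cls n lo.B u))) = cls n up.B (q.mapr u)"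
      "r (lo.of_abs (cls n lo.B u)) \<in> MSE_rel n RI OI" if u: "u \<in> Um n lo.B" for u
    proof -
      have C: "cls n lo.B u \<in> MSE n lo.B" using u by (simp add: MSE_def)
      note o = lo.to_of_abs[OF C]
      show rC: "r (lo.of_abs (cls n lo.B u)) \<in> MSE_rel n RI OI" using r(1)[OF o(1)] .
      have qu: "q.mapr u \<in> Um n up.B" using u by (rule q.mapr_Um)
      have "?m (up.to_abs (r (lo.of_abs (cls n lo.B u)))) = cls n lo.B u"
        using pi2_commutes(2)[OF rC] r(2)[OF o(1)] o(2) by simp
      also have "\<dots> = ?m (cls n up.B (q.mapr u))"
        using qu u by (simp add: middle_cls iso.fg_row Um_def)
      finally have "?m (up.to_abs (r (lo.of_abs (cls n lo.B u)))) = ?m (cls n up.B (q.mapr u))" .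
      moreover have "up.to_abs (r (lo.of_abs (cls n lo.B u))) \<in> MSE n up.B"
        using up.to_abs_bij rC by (auto simp: bij_betw_def)
      moreover have "cls n up.B (q.mapr u) \<in> MSE n up.B" using qu by (simp add: MSE_def)
      ultimately show "up.to_abs (r (lo.of_abs (cls n lo.B u))) = cls n up.B (q.mapr u)"
        using middle_bij by (auto simp: bij_betw_def inj_on_def)
    qed
    let ?C = "r (lo.of_abs (cls n lo.B w))" and ?D = "r (lo.of_abs (cls n lo.B v))"
    have CD: "?C \<otimes>\<^bsub>H\<^esub> ?D \<in> MSE_rel n RI OI"
      using H.m_closed lift(2)[OF v] lift(2)[OF w] by (simp add: car)
    have "transfer_op n R I (monoid.mult K') (cls n lo.B w) (cls n lo.B v) = lo.to_abs (?p (?C \<otimes>\<^bsub>H\<^esub> ?D))"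
      by (simp add: lo.transfer_op_eq K'_def)
    also have "\<dots> = ?m (up.to_abs (?C \<otimes>\<^bsub>H\<^esub> ?D))" using CD by (rule pi2_commutes)
    also have "\<dots> = ?m (transfer_op n RI OI (monoid.mult H) (cls n up.B (q.mapr w)) (cls n up.B (q.mapr v)))"
      using up.transfer_op_to_abs[OF lift(2)[OF w] lift(2)[OF v], of "monoid.mult H"] lift(1)[OF v] lift(1)[OF w]
      by simp
    finally show "transfer_op n R I (monoid.mult K') (cls n lo.B w) (cls n lo.B v)
        = induced_map (cls n lo.B) d.mapr
            (transfer_op n RI OI (monoid.mult H) (cls n up.B (q.mapr w)) (cls n up.B (q.mapr v)))"
      by (simp add: middle_eq)
  qed
  ultimately have "Vv_group n R I K'" by (simp add: Vv_group_def K'_def)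
  then have eq: "C \<otimes>\<^bsub>K\<^esub> D = C \<otimes>\<^bsub>K'\<^esub> D" if "C \<in> MSE_rel n R I" "D \<in> MSE_rel n R I" for C D
    using det K that unfolding Vv_determined_def by blast
  show ?thesis
    using pi2_commutes(1) rp by (auto simp: hom_def car eq K'_def)
qed

text \<open>Rows over \<open>R\<close> lift along \<open>\<pi>\<^sub>2\<close> by way of \<open>\<int> \<oplus> I\<close> and \<open>\<int> \<oplus> (0 \<oplus> I)\<close>.\<close>

lemma Um_rel_obtain:
  assumes v: "v \<in> Um_rel n R I" and w: "w \<in> Um_rel n R I" and vw: "\<forall>i\<in>{2..n}. w i = v i"
  obtains v' w' where "v' \<in> Um_rel n RI OI" "w' \<in> Um_rel n RI OI" "\<forall>i\<in>{2..n}. w' i = v' i"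
    "t.mapr v' = v" "t.mapr w' = w"
proof -
  let ?l = "\<lambda>u. up.e.mapr (q.mapr (lo.lift u))"
  have l: "?l u \<in> Um_rel n RI OI" "t.mapr (?l u) = u" if u: "u \<in> Um_rel n R I" for u
  proof -
    have lu: "lo.lift u \<in> Um_rel n lo.B lo.J" using u by (rule lo.lift_Um_rel)
    then show "?l u \<in> Um_rel n RI OI" by (intro up.e.mapr_Um_rel q.mapr_Um_rel)
    have r: "lo.lift u \<in> rows n lo.B" using lu by (simp add: Um_rel_def Um_def)
    have "u \<in> lo.base.rel_rows" using u by (simp add: lo.base.Um_rel_eq)
    then show "t.mapr (?l u) = u"
      unfolding pi2_eval_row[OF q.mapr_rows[OF r]] iso.fg_row[OF r] by (rule lo.eval_lift)
  qed
  have "\<forall>i\<in>{2..n}. ?l w i = ?l v i" using vw by (auto simp: map_row_def lo.lift_def)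
  then show ?thesis using that[of "?l v" "?l w"] l v w by blast
qed

lemma pi2_nice:
  assumes H: "Vv_group n RI OI H" and K: "Vv_group n R I K" and nice: "nice n RI OI H"
  shows "nice n R I K"
  unfolding nice_def
proof (intro ballI impI)
  fix v w assume v: "v \<in> Um_rel n R I" and w: "w \<in> Um_rel n R I" and vw: "\<forall>i\<in>{2..n}. w i = v i"
  obtain v' w' where u: "v' \<in> Um_rel n RI OI" "w' \<in> Um_rel n RI OI" "\<forall>i\<in>{2..n}. w' i = v' i"
    "t.mapr v' = v" "t.mapr w' = w"
    using Um_rel_obtain[OF v w vw] .
  have r: "v' \<in> rows n RI" "w' \<in> rows n RI" using u by (auto simp: Um_rel_def Um_def)
  have 1: "1 \<in> {1..n}" using lo.n_ge_3 by simp
  have c: "v' 1 \<in> carrier RI" "w' 1 \<in> carrier RI" using rows_carrier[OF r(1) 1] rows_carrier[OF r(2) 1] .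
  let ?u = "v'(1 := v' 1 \<otimes>\<^bsub>RI\<^esub> w' 1)"
  have "?u \<in> rows n RI" using r 1 up.m_closed[OF c] by (intro rows_update)
  moreover have "t.mapr ?u = v(1 := v 1 \<otimes>\<^bsub>R\<^esub> w 1)"
  proof -
    have "v 1 = pi2 R (v' 1)" "w 1 = pi2 R (w' 1)" using u(4,5) 1 by (auto simp: map_row_def)
    then have "v 1 \<otimes>\<^bsub>R\<^esub> w 1 = pi2 R (v' 1 \<otimes>\<^bsub>RI\<^esub> w' 1)" using c by simp
    then show ?thesis unfolding u(4)[symmetric] using 1 by (auto simp: map_row_def fun_eq_iff)
  qed
  ultimately have "pi2_map n R I (cls_rel n RI OI ?u) = cls_rel n R I (v(1 := v 1 \<otimes>\<^bsub>R\<^esub> w 1))"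
    by (simp add: pi2_cls)
  moreover have "cls_rel n RI OI w' \<otimes>\<^bsub>H\<^esub> cls_rel n RI OI v' = cls_rel n RI OI ?u"
    using nice u by (simp add: nice_def)
  ultimately show "cls_rel n R I w \<otimes>\<^bsub>K\<^esub> cls_rel n R I v = cls_rel n R I (v(1 := v 1 \<otimes>\<^bsub>R\<^esub> w 1))"
    using pi2_rule_product[OF H K u(1-3)] by (simp add: pi2_cls r u)
qed

end

theorem lemma3p1:
  fixes R :: "('a, 'm) ring_scheme" and I :: "'a set" and n :: nat
  assumes "cring R" and "ideal I R" and "n \<ge> 3"
  shows
    "\<comment> \<open>the natural maps are well defined\<close>
     induces (map_row n (int_eval (excision R I))) (F_map n (excision R I) (exc_ideal R I))
       (Um_rel n (int_excision (excision R I) (exc_ideal R I)) (int_exc_ideal (exc_ideal R I)))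
       (cls_rel n (int_excision (excision R I) (exc_ideal R I)) (int_exc_ideal (exc_ideal R I)))
       (cls_rel n (excision R I) (exc_ideal R I)) \<and>
     induces (\<lambda>v. v) (G_map n (excision R I) (exc_ideal R I))
       (Um_rel n (int_excision (excision R I) (exc_ideal R I)) (int_exc_ideal (exc_ideal R I)))
       (cls_rel n (int_excision (excision R I) (exc_ideal R I)) (int_exc_ideal (exc_ideal R I)))
       (cls n (int_excision (excision R I) (exc_ideal R I))) \<and>
     induces (map_row n drop_zero) (middle_map n R I)
       (Um n (int_excision (excision R I) (exc_ideal R I)))
       (cls n (int_excision (excision R I) (exc_ideal R I)))
       (cls n (int_excision R I)) \<and>
     induces (\<lambda>v. v) (G_map n R I)
       (Um_rel n (int_excision R I) (int_exc_ideal I))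
       (cls_rel n (int_excision R I) (int_exc_ideal I))
       (cls n (int_excision R I)) \<and>
     induces (map_row n (int_eval R)) (F_map n R I)
       (Um_rel n (int_excision R I) (int_exc_ideal I))
       (cls_rel n (int_excision R I) (int_exc_ideal I))
       (cls_rel n R I) \<and>
     \<comment> \<open>the chain of bijections\<close>
     bij_betw (F_map n (excision R I) (exc_ideal R I))
       (MSE_rel n (int_excision (excision R I) (exc_ideal R I)) (int_exc_ideal (exc_ideal R I)))
       (MSE_rel n (excision R I) (exc_ideal R I)) \<and>
     bij_betw (G_map n (excision R I) (exc_ideal R I))
       (MSE_rel n (int_excision (excision R I) (exc_ideal R I)) (int_exc_ideal (exc_ideal R I)))
       (MSE n (int_excision (excision R I) (exc_ideal R I))) \<and>
     bij_betw (middle_map n R I)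
       (MSE n (int_excision (excision R I) (exc_ideal R I)))
       (MSE n (int_excision R I)) \<and>
     bij_betw (G_map n R I)
       (MSE_rel n (int_excision R I) (int_exc_ideal I))
       (MSE n (int_excision R I)) \<and>
     bij_betw (F_map n R I)
       (MSE_rel n (int_excision R I) (int_exc_ideal I))
       (MSE_rel n R I) \<and>
     \<comment> \<open>the map induced by \<open>\<pi>\<^sub>2\<close>\<close>
     pi2 R \<in> ring_hom (excision R I) R \<and>
     pi2 R ` carrier (excision R I) = carrier R \<and>
     induces (map_row n (pi2 R)) (pi2_map n R I)
       (Um_rel n (excision R I) (exc_ideal R I))
       (cls_rel n (excision R I) (exc_ideal R I))
       (cls_rel n R I) \<and>
     (\<forall>H K. Vv_group n (excision R I) (exc_ideal R I) H \<longrightarrow> Vv_group n R I K \<longrightarrow>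
        \<comment> \<open>\<open>\<pi>\<^sub>2\<close> preserves every product prescribed by the rule\<close>
        (\<forall>v \<in> Um_rel n (excision R I) (exc_ideal R I).
         \<forall>w \<in> Um_rel n (excision R I) (exc_ideal R I).
           (\<forall>i\<in>{2..n}. w i = v i) \<longrightarrow>
           pi2_map n R I (cls_rel n (excision R I) (exc_ideal R I) w \<otimes>\<^bsub>H\<^esub>
                          cls_rel n (excision R I) (exc_ideal R I) v) =
           pi2_map n R I (cls_rel n (excision R I) (exc_ideal R I) w) \<otimes>\<^bsub>K\<^esub>
           pi2_map n R I (cls_rel n (excision R I) (exc_ideal R I) v)) \<and>
        (Vv_determined n R I \<longrightarrow> pi2_map n R I \<in> hom H K) \<and>
        (nice n (excision R I) (exc_ideal R I) H \<longrightarrow> nice n R I K))"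
proof -
  interpret excision_pair R I n
    using assms by (intro excision_pair.intro excision_setup.intro cring_ideal.intro excision_setup_axioms.intro)
  have "pi2 R (x, \<zero>\<^bsub>R\<^esub>) = x" "(x, \<zero>\<^bsub>R\<^esub>) \<in> carrier RI" if "x \<in> carrier R" for x
    using that lo.zero_closed by (auto simp: pi2_def lo.excision_simps)
  then have "carrier R \<subseteq> pi2 R ` carrier RI" by (metis image_eqI subsetI)
  then have surj: "pi2 R ` carrier RI = carrier R" using t.h.hom_closed by auto
  show ?thesis
    unfolding induces_def
    by (intro conjI allI impI ballI up.F_cls up.G_cls middle_cls lo.G_cls lo.F_cls pi2_cls
        up.F_bij up.G_bij middle_bij lo.G_bij lo.F_bij lo.pi2_hom surj
        pi2_rule_product pi2_hom_determined pi2_nice)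
      (auto intro: Um_rows Um_rel_rows)
qed

end
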